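(* Let $0<\alpha<\tfrac12$. For $j=2,3$ and $\kappa\in(1/2,\infty]$, $$\operatorname{tr}(S_{\alpha,\kappa}^j)=Q_{j,\kappa}.$$ Let $\theta_1^{(N)}\ge\cdots\ge\theta_N^{(N)}\ge0$ be the eigenvalues of the $N\times N$ principal Laguerre compression of $S_{\alpha,\kappa}$. Then, with an empty sum interpreted as zero, $$\theta_1^{(N)}\le\lambda_{\max}(S_{\alpha,\kappa})\le U_N:=\min_{j\in\{2,3\}}\Bigl(Q_{j,\kappa}-\sum_{i=2}^N(\theta_i^{(N)})^j\Bigr)^{1/j},$$ and, as $N\to\infty$, $\theta_1^{(N)}\uparrow\lambda_{\max}(S_{\alpha,\kappa})$ and $U_N\downarrow\lambda_{\max}(S_{\alpha,\kappa})$ (monotone convergence). Dividing both endpoints by $\sqrt{2Q_{2,\kappa}}$ gives convergent two-sided bounds for $\Lambda_2(\alpha,d)$ when $\kappa=1-d-\alpha<\infty$, or for $\Lambda_2^{\exp}(\alpha)$ when $\kappa=\infty$.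
   Context: Let $\nu(du)=e^{-u}\,du$ on $[0,\infty)$. For $\kappa\in(1/2,\infty)$ put $k_{\alpha,\kappa}(u,v)=\bigl[2\kappa\sinh(|u-v|/(2\kappa))\bigr]^{-\alpha}$, and $k_{\alpha,\infty}(u,v)=|u-v|^{-\alpha}$. For $\kappa\in(1/2,\infty]$, $S_{\alpha,\kappa}$ is the positive Hilbert--Schmidt operator on $L^2(\nu)$ given by $(S_{\alpha,\kappa}h)(u)=\int_0^\infty k_{\alpha,\kappa}(u,v)h(v)\,\nu(dv)$. With $\mathcal L_n=L_n^{(0)}$ the standard Laguerre polynomials (an orthonormal basis of $L^2(\nu)$), the $N\times N$ principal Laguerre compression is the matrix $\bigl(\langle\mathcal L_i,S_{\alpha,\kappa}\mathcal L_j\rangle_{L^2(\nu)}\bigr)_{0\le i,j\le N-1}$. Explicit quantities ($B$ the beta function): for $\kappa<\infty$, $$Q_{2,\kappa}=\kappa^{1-2\alpha}B(\kappa+\alpha,1-2\alpha),\qquad Q_{2,\infty}=\Gamma(1-2\alpha),$$ $$Q_{3,\infty}=\frac{\Gamma(1-\alpha)^2\,\Gamma(1-3\alpha/2)}{\Gamma(1-\alpha/2)},\qquad Q_{3,\kappa}=Q_{3,\infty}\,\kappa^{3-3\alpha}\prod_{j=0}^{2}\frac{\Gamma(\kappa+(1-j/2)\alpha)}{\Gamma(\kappa+1-j\alpha/2)}\quad(\kappa<\infty).$$ For $d\in\mathbb R$ with $2d+2\alpha<1$ (equivalently $\kappa=1-d-\alpha>1/2$), the rank-two LIL constant is $$\Lambda_2(\alpha,d)=\frac{\lambda_{\max}(T_{\alpha,d})}{\sqrt{2\operatorname{tr}(T_{\alpha,d}^2)}},\qquad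 (T_{\alpha,d}f)(x)=\int_0^1x^{-d/2}y^{-d/2}|x-y|^{-\alpha}f(y)\,dy\ \text{ on }L^2(0,1),$$ and $\Lambda_2^{\exp}(\alpha)=\lambda_{\max}(S_{\alpha,\infty})/\sqrt{2\Gamma(1-2\alpha)}$. *)

theory Defs
  imports "HOL-Probability.Probability" "Jordan_Normal_Form.Char_Poly"
begin

text \<open>
  Vectors of \<open>L\<^sup>2(M)\<close> are represented by square-integrable measurable functions,
  equality in \<open>L\<^sup>2(M)\<close> being equality almost everywhere. Operators map functions to
  functions. All kernels below are real and symmetric, so real scalars are used.
\<close>

definition L2 :: "'a measure \<Rightarrow> ('a \<Rightarrow> real) set" where
  "L2 M = {f \<in> borel_measurable M. integrable M (\<lambda>x. (f x)\<^sup>2)}"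

definition L2_inner :: "'a measure \<Rightarrow> ('a \<Rightarrow> real) \<Rightarrow> ('a \<Rightarrow> real) \<Rightarrow> real" where
  "L2_inner M f g = (\<integral>x. f x * g x \<partial>M)"

definition L2_orthonormal_basis :: "'a measure \<Rightarrow> (nat \<Rightarrow> 'a \<Rightarrow> real) \<Rightarrow> bool" where
  "L2_orthonormal_basis M e \<longleftrightarrow>
     (\<forall>i. e i \<in> L2 M) \<and>
     (\<forall>i j. L2_inner M (e i) (e j) = (if i = j then 1 else 0)) \<and>
     (\<forall>f \<in> L2 M. (\<forall>i. L2_inner M (e i) f = 0) \<longrightarrow> (AE x in M. f x = 0))"

text \<open>
  The trace as the basis-independent sum of diagonal entries. Bases are indexed by
  \<^typ>\<open>nat\<close>, as the spaces considered here are separable and infinite-dimensional; the first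
  conjunct rules out a vacuous trace on spaces without such a basis.
\<close>

definition L2_has_trace :: "'a measure \<Rightarrow> (('a \<Rightarrow> real) \<Rightarrow> 'a \<Rightarrow> real) \<Rightarrow> real \<Rightarrow> bool" where
  "L2_has_trace M A t \<longleftrightarrow>
     (\<exists>e. L2_orthonormal_basis M e) \<and>
     (\<forall>e. L2_orthonormal_basis M e \<longrightarrow> ((\<lambda>i. L2_inner M (e i) (A (e i))) has_sum t) UNIV)"

definition L2_trace :: "'a measure \<Rightarrow> (('a \<Rightarrow> real) \<Rightarrow> 'a \<Rightarrow> real) \<Rightarrow> real" where
  "L2_trace M A = (THE t. L2_has_trace M A t)"

definition L2_eigenvalue :: "'a measure \<Rightarrow> (('a \<Rightarrow> real) \<Rightarrow> 'a \<Rightarrow> real) \<Rightarrow> real \<Rightarrow> bool" where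
  "L2_eigenvalue M A c \<longleftrightarrow>
     (\<exists>f \<in> L2 M. \<not> (AE x in M. f x = 0) \<and> (AE x in M. A f x = c * f x))"

definition L2_lambda_max :: "'a measure \<Rightarrow> (('a \<Rightarrow> real) \<Rightarrow> 'a \<Rightarrow> real) \<Rightarrow> real" where
  "L2_lambda_max M A = (GREATEST c. L2_eigenvalue M A c)"

definition nu :: "real measure" where
  "nu = density lborel (\<lambda>u. ennreal (exponential_density 1 u))"

text \<open>
  On the diagonal the singular kernels take the value \<^term>\<open>(0::real) powr (- \<alpha>) = 0\<close> instead
  of \<open>\<infinity>\<close>; this is a null set.
\<close>

definition kern :: "real \<Rightarrow> ereal \<Rightarrow> real \<Rightarrow> real \<Rightarrow> real" where
  "kern \<alpha> \<kappa> u v =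
     (if \<kappa> = \<infinity> then \<bar>u - v\<bar> powr (- \<alpha>)
      else let k = real_of_ereal \<kappa> in (2 * k * sinh (\<bar>u - v\<bar> / (2 * k))) powr (- \<alpha>))"

definition S_op :: "real \<Rightarrow> ereal \<Rightarrow> (real \<Rightarrow> real) \<Rightarrow> real \<Rightarrow> real" where
  "S_op \<alpha> \<kappa> h u = (\<integral>v. kern \<alpha> \<kappa> u v * h v \<partial>nu)"

definition laguerre :: "nat \<Rightarrow> real \<Rightarrow> real" where
  "laguerre n x = (\<Sum>k\<le>n. real (n choose k) * (- x) ^ k / fact k)"

definition laguerre_compression :: "real \<Rightarrow> ereal \<Rightarrow> nat \<Rightarrow> real mat" where
  "laguerre_compression \<alpha> \<kappa> N =
     Matrix.mat N N (\<lambda>(i, j). L2_inner nu (laguerre i) (S_op \<alpha> \<kappa> (laguerre j)))"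

text \<open>The real eigenvalues with algebraic multiplicity, in decreasing order.\<close>

definition eigenvalues_desc :: "real mat \<Rightarrow> real list" where
  "eigenvalues_desc A = rev (sorted_list_of_multiset (proots (char_poly A)))"

text \<open>The \<open>i\<close>-th largest eigenvalue of the \<open>N \<times> N\<close> compression, for \<open>1 \<le> i \<le> N\<close>.\<close>

definition theta :: "real \<Rightarrow> ereal \<Rightarrow> nat \<Rightarrow> nat \<Rightarrow> real" where
  "theta \<alpha> \<kappa> N i = eigenvalues_desc (laguerre_compression \<alpha> \<kappa> N) ! (i - 1)"

definition Q2 :: "real \<Rightarrow> ereal \<Rightarrow> real" where
  "Q2 \<alpha> \<kappa> =
     (if \<kappa> = \<infinity> then Gamma (1 - 2 * \<alpha>)
      else let k = real_of_ereal \<kappa> in k powr (1 - 2 * \<alpha>) * Beta (k + \<alpha>) (1 - 2 * \<alpha>))"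

definition Q3_inf :: "real \<Rightarrow> real" where
  "Q3_inf \<alpha> = (Gamma (1 - \<alpha>))\<^sup>2 * Gamma (1 - 3 * \<alpha> / 2) / Gamma (1 - \<alpha> / 2)"

definition Q3 :: "real \<Rightarrow> ereal \<Rightarrow> real" where
  "Q3 \<alpha> \<kappa> =
     (if \<kappa> = \<infinity> then Q3_inf \<alpha>
      else let k = real_of_ereal \<kappa> in
        Q3_inf \<alpha> * k powr (3 - 3 * \<alpha>) *
        (\<Prod>j = 0..2::nat. Gamma (k + (1 - real j / 2) * \<alpha>) / Gamma (k + 1 - real j * \<alpha> / 2)))"

text \<open>Only \<open>j = 2\<close> and \<open>j = 3\<close> are meaningful.\<close>

definition Q :: "nat \<Rightarrow> real \<Rightarrow> ereal \<Rightarrow> real" where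
  "Q j \<alpha> \<kappa> = (if j = 2 then Q2 \<alpha> \<kappa> else Q3 \<alpha> \<kappa>)"

definition U_bound :: "real \<Rightarrow> ereal \<Rightarrow> nat \<Rightarrow> real" where
  "U_bound \<alpha> \<kappa> N =
     Min ((\<lambda>j. (Q j \<alpha> \<kappa> - (\<Sum>i = 2..N. theta \<alpha> \<kappa> N i ^ j)) powr (1 / real j)) ` {2, 3})"

definition unit_interval :: "real measure" where
  "unit_interval = restrict_space lborel {0<..<1}"

definition T_op :: "real \<Rightarrow> real \<Rightarrow> (real \<Rightarrow> real) \<Rightarrow> real \<Rightarrow> real" where
  "T_op \<alpha> d f x =
     (\<integral>y. x powr (- d / 2) * y powr (- d / 2) * \<bar>x - y\<bar> powr (- \<alpha>) * f y \<partial>unit_interval)"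

definition Lambda2 :: "real \<Rightarrow> real \<Rightarrow> real" where
  "Lambda2 \<alpha> d = L2_lambda_max unit_interval (T_op \<alpha> d) /
     sqrt (2 * L2_trace unit_interval (T_op \<alpha> d ^^ 2))"

definition Lambda2_exp :: "real \<Rightarrow> real" where
  "Lambda2_exp \<alpha> = L2_lambda_max nu (S_op \<alpha> \<infinity>) / sqrt (2 * Gamma (1 - 2 * \<alpha>))"

text \<open>
  The sequences \<open>lo\<close> and \<open>up\<close>, indexed by \<open>N \<ge> 1\<close>, are convergent two-sided bounds for \<open>c\<close>.
\<close>

definition convergent_bounds :: "(nat \<Rightarrow> real) \<Rightarrow> (nat \<Rightarrow> real) \<Rightarrow> real \<Rightarrow> bool" where
  "convergent_bounds lo up c \<longleftrightarrow>
     (\<forall>N\<ge>1. lo N \<le> c \<and> c \<le> up N) \<and> lo \<longlonglongrightarrow> c \<and> up \<longlonglongrightarrow> c"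

end

theory Submission
  imports Defs "HOL-Real_Asymp.Real_Asymp"
begin

text \<open>
  In the orthonormal basis of Laguerre polynomials the operator \<open>S\<close> is an infinite symmetric matrix
  whose squared entries have a finite sum. Let \<open>A\<^sub>N\<close> be its \<open>N \<times> N\<close> compression. By the min-max
  principle (\<open>spectral_system_interlacing\<close>) the \<open>i\<close>-th eigenvalue of \<open>A\<^sub>N\<close> increases with \<open>N\<close>; let
  \<open>\<lambda>\<close> be the limit of the largest one. For \<open>j = 2, 3\<close> the traces of \<open>A\<^sub>N\<^sup>j\<close> converge to the trace of
  \<open>S\<^sup>j\<close>, by absolute convergence of the sums of products of matrix entries. Hence
  \<open>Q\<^sub>j - \<Sum>\<^sub>i\<^sub>\<ge>\<^sub>2 \<theta>\<^sub>i\<^sup>j = (Q\<^sub>j - tr A\<^sub>N\<^sup>j) + \<theta>\<^sub>1\<^sup>j\<close> tends to \<open>\<lambda>\<^sup>j\<close>, and as it decreases with \<open>N\<close> it never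
  falls below its limit. This gives the upper bounds (\<open>remainder_root_bounds\<close>).

  The number \<open>\<lambda>\<close> is the greatest eigenvalue of \<open>S\<close>. Unit top eigenvectors of the \<open>A\<^sub>N\<close> have a
  subsequence that converges in every coordinate; the summable squares dominate, so the limit is a
  nonzero eigenvector for \<open>\<lambda>\<close> (\<open>top_ev_eigenvector\<close>). On the other hand the quadratic form at any
  eigenvector is the limit of the quadratic forms of the compressions, which are bounded by
  \<open>\<lambda>\<close> times the squared norm (\<open>eigenvalue_le_top\<close>).

  The traces: by Parseval's identity for the rows \<open>k(u, \<cdot>)\<close> of the kernel, the diagonal sums of
  \<open>S\<^sup>2\<close> and \<open>S\<^sup>3\<close> are the double and triple integrals of products of \<open>k\<close>, in every basis
  (\<open>K_square_has_sum\<close>, \<open>K_cube_has_sum\<close>). The lack of memory of the exponential distribution turns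
  the double integral into a Beta or Gamma integral, and the triple one into
  \<open>2 \<integral>\<integral> k(r) k(t) k(r + t) e\<^sup>-\<^sup>r \<nu>(dr) \<nu>(dt)\<close> (\<open>nu_triple\<close>). For \<open>\<kappa> < \<infinity>\<close> the binomial expansion of
  \<open>k(r + t)\<close> in powers of \<open>exp (- (r + t) / \<kappa>)\<close> separates the variables and leaves a well-poised
  hypergeometric series at \<open>1\<close>, which Dixon's theorem sums (\<open>dixon_sum\<close>). For \<open>\<kappa> = \<infinity>\<close> one lets
  \<open>\<kappa>\<close> tend to infinity through the integers.

  Three more facts enter. The Laguerre polynomials are complete (\<open>laguerre_complete\<close>). The operator
  is positive, because \<open>|x - y|\<^sup>-\<^sup>\<alpha>\<close> is a positive superposition of products
  \<open>1\<^sub>(\<^sub>a\<^sub>,\<^sub>b\<^sub>)(x) 1\<^sub>(\<^sub>a\<^sub>,\<^sub>b\<^sub>)(y)\<close> and the substitution \<open>x = exp (- u / \<kappa>)\<close> brings the kernel with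
  finite \<open>\<kappa>\<close> into the form \<open>w(u) w(v) |x - y|\<^sup>-\<^sup>\<alpha>\<close> (\<open>hs_kernel_positive\<close>). The same substitution
  identifies \<open>T\<close> with \<open>\<kappa>\<^sup>\<alpha>\<^sup>-\<^sup>1 S\<close> (\<open>W_T\<close>), and the factor cancels in \<open>\<Lambda>\<^sub>2\<close>.
\<close>

section \<open>Square-integrable functions and Parseval's identity\<close>

lemma L2_measurable: "f \<in> L2 M \<Longrightarrow> f \<in> borel_measurable M"
  and L2_integrable_square: "f \<in> L2 M \<Longrightarrow> integrable M (\<lambda>x. (f x)\<^sup>2)"
  by (auto simp: L2_def)

lemma abs_mult_le_sum_squares: "\<bar>a * b\<bar> \<le> a\<^sup>2 + b\<^sup>2" for a b :: real
proof -
  have "2 * (\<bar>a\<bar> * \<bar>b\<bar>) \<le> a\<^sup>2 + b\<^sup>2"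
    using sum_squares_bound[of "\<bar>a\<bar>" "\<bar>b\<bar>"] by (simp add: mult.assoc)
  moreover have "0 \<le> \<bar>a\<bar> * \<bar>b\<bar>" by simp
  ultimately show ?thesis unfolding abs_mult by linarith
qed

lemma L2_integrable_mult:
  assumes "f \<in> L2 M" "g \<in> L2 M"
  shows "integrable M (\<lambda>x. f x * g x)"
proof (rule Bochner_Integration.integrable_bound[of M "\<lambda>x. (f x)\<^sup>2 + (g x)\<^sup>2"])
  show "integrable M (\<lambda>x. (f x)\<^sup>2 + (g x)\<^sup>2)"
    using assms by (simp add: L2_integrable_square)
  show "(\<lambda>x. f x * g x) \<in> borel_measurable M"
    using assms by (auto dest!: L2_measurable)
  show "AE x in M. norm (f x * g x) \<le> norm ((f x)\<^sup>2 + (g x)\<^sup>2)"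
    using order_trans[OF abs_mult_le_sum_squares abs_ge_self] by (intro AE_I2) simp
qed

lemma L2_scale: "f \<in> L2 M \<Longrightarrow> (\<lambda>x. c * f x) \<in> L2 M"
  by (auto simp: L2_def power_mult_distrib)

lemma L2_add:
  assumes "f \<in> L2 M" "g \<in> L2 M"
  shows "(\<lambda>x. f x + g x) \<in> L2 M"
proof -
  have "integrable M (\<lambda>x. (f x)\<^sup>2 + (g x)\<^sup>2 + 2 * (f x * g x))"
    by (intro Bochner_Integration.integrable_add integrable_mult_right
        L2_integrable_square L2_integrable_mult assms)
  moreover have "(f x + g x)\<^sup>2 = (f x)\<^sup>2 + (g x)\<^sup>2 + 2 * (f x * g x)" for x
    by (simp add: power2_sum)
  moreover have "(\<lambda>x. f x + g x) \<in> borel_measurable M"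
    by (intro borel_measurable_add L2_measurable assms)
  ultimately show ?thesis by (simp add: L2_def)
qed

lemma L2_diff: "f \<in> L2 M \<Longrightarrow> g \<in> L2 M \<Longrightarrow> (\<lambda>x. f x - g x) \<in> L2 M"
  using L2_add[of f M "\<lambda>x. -1 * g x"] L2_scale[of g M "-1"] by simp

lemma L2_sum: "(\<And>i. i \<in> I \<Longrightarrow> f i \<in> L2 M) \<Longrightarrow> (\<lambda>x. \<Sum>i\<in>I. f i x) \<in> L2 M"
proof (induction I rule: infinite_finite_induct)
  case (insert i I)
  then have "(\<lambda>x. f i x + (\<Sum>i\<in>I. f i x)) \<in> L2 M" by (intro L2_add) auto
  then show ?case using insert by simp
qed (auto simp: L2_def)

lemma L2_AE_cong:
  "f \<in> L2 M \<Longrightarrow> g \<in> borel_measurable M \<Longrightarrow> AE x in M. f x = g x \<Longrightarrow> g \<in> L2 M"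
  unfolding L2_def by (auto intro: integrable_cong_AE_imp)

lemma L2_inner_commute: "L2_inner M f g = L2_inner M g f"
  by (simp add: L2_inner_def mult.commute)

lemma L2_inner_cong_AE:
  assumes "f \<in> borel_measurable M" "g \<in> borel_measurable M" "f' \<in> borel_measurable M"
    "g' \<in> borel_measurable M" "AE x in M. f x = f' x" "AE x in M. g x = g' x"
  shows "L2_inner M f g = L2_inner M f' g'"
  unfolding L2_inner_def using assms by (intro integral_cong_AE) auto

lemma L2_inner_diff:
  "f \<in> L2 M \<Longrightarrow> g \<in> L2 M \<Longrightarrow> h \<in> L2 M \<Longrightarrow>
    L2_inner M h (\<lambda>x. f x - g x) = L2_inner M h f - L2_inner M h g"
  unfolding L2_inner_def by (simp add: right_diff_distrib L2_integrable_mult)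

lemma L2_inner_scale: "L2_inner M h (\<lambda>x. c * f x) = c * L2_inner M h f"
  unfolding L2_inner_def by (simp add: mult.left_commute)

lemma L2_inner_sum:
  assumes "h \<in> L2 M" "\<And>i. i \<in> I \<Longrightarrow> f i \<in> L2 M"
  shows "L2_inner M h (\<lambda>x. \<Sum>i\<in>I. f i x) = (\<Sum>i\<in>I. L2_inner M h (f i))"
  using assms unfolding L2_inner_def
  by (simp add: sum_distrib_left L2_integrable_mult)

lemma L2_inner_self_nonneg: "0 \<le> L2_inner M f f"
  unfolding L2_inner_def by (simp add: power2_eq_square[symmetric])

lemma L2_inner_self_eq_0:
  assumes "f \<in> L2 M" "L2_inner M f f = 0"
  shows "AE x in M. f x = 0"
  using integral_nonneg_eq_0_iff_AE[OF L2_integrable_square[OF assms(1)]] assms(2)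
  by (simp add: L2_inner_def power2_eq_square)

lemma L2_inner_diff_self:
  assumes "f \<in> L2 M" "g \<in> L2 M"
  shows "L2_inner M (\<lambda>x. f x - g x) (\<lambda>x. f x - g x)
    = L2_inner M f f - 2 * L2_inner M f g + L2_inner M g g"
proof -
  have d: "(\<lambda>x. f x - g x) \<in> L2 M" by (rule L2_diff[OF assms])
  have "L2_inner M (\<lambda>x. f x - g x) (\<lambda>x. f x - g x)
      = L2_inner M (\<lambda>x. f x - g x) f - L2_inner M (\<lambda>x. f x - g x) g"
    by (rule L2_inner_diff[OF assms d])
  also have "\<dots> = (L2_inner M f f - L2_inner M f g) - (L2_inner M g f - L2_inner M g g)"
    using assms by (simp add: L2_inner_commute[of M "\<lambda>x. f x - g x"] L2_inner_diff)
  finally show ?thesis by (simp add: L2_inner_commute[of M g f])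
qed

lemma L2_Cauchy_Schwarz:
  assumes "f \<in> L2 M" "g \<in> L2 M"
  shows "(L2_inner M f g)\<^sup>2 \<le> L2_inner M f f * L2_inner M g g"
proof (cases "L2_inner M g g = 0")
  case True
  then have "AE x in M. g x = 0" by (rule L2_inner_self_eq_0[OF assms(2)])
  then have "L2_inner M f g = L2_inner M f (\<lambda>x. 0)"
    using assms by (intro L2_inner_cong_AE) (auto dest: L2_measurable)
  then show ?thesis by (simp add: True L2_inner_def)
next
  case False
  then have pos: "0 < L2_inner M g g" using L2_inner_self_nonneg[of M g] by simp
  define t where "t = L2_inner M f g / L2_inner M g g"
  have "0 \<le> L2_inner M (\<lambda>x. f x - t * g x) (\<lambda>x. f x - t * g x)"
    by (rule L2_inner_self_nonneg)
  also have "\<dots> = L2_inner M f f - 2 * (t * L2_inner M f g) + t * (t * L2_inner M g g)"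
    using L2_inner_diff_self[OF assms(1) L2_scale[OF assms(2), of t]]
    by (simp add: L2_inner_scale L2_inner_commute[of M "\<lambda>x. t * g x"])
  also have "\<dots> = L2_inner M f f - (L2_inner M f g)\<^sup>2 / L2_inner M g g"
    using pos by (simp add: t_def power2_eq_square field_simps)
  finally show ?thesis using pos by (simp add: field_simps)
qed

text \<open>
  The partial sums are Cauchy in \<open>L\<^sup>2\<close>. Along a subsequence with geometrically small tails they
  converge almost everywhere, and Fatou's lemma bounds the distance of the pointwise limit from
  every partial sum by the tail of the coefficients.
\<close>

lemma Riesz_Fischer:
  fixes e :: "nat \<Rightarrow> 'a \<Rightarrow> real" and c :: "nat \<Rightarrow> real"
  assumes e: "\<And>i. e i \<in> L2 M"
    and on: "\<And>i j. L2_inner M (e i) (e j) = (if i = j then 1 else 0)"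
    and c: "summable (\<lambda>i. (c i)\<^sup>2)"
  obtains g where "g \<in> L2 M"
    "\<And>m. L2_inner M (\<lambda>x. g x - (\<Sum>i<m. c i * e i x)) (\<lambda>x. g x - (\<Sum>i<m. c i * e i x))
       \<le> (\<Sum>i. (c (i + m))\<^sup>2)"
proof -
  define s where "s = (\<lambda>m x. \<Sum>i<m. c i * e i x)"
  define T where "T = (\<lambda>m. \<Sum>i. (c (i + m))\<^sup>2)"
  have sL: "s m \<in> L2 M" for m
    unfolding s_def by (intro L2_sum L2_scale e)
  have eM[measurable]: "e i \<in> borel_measurable M" for i by (rule L2_measurable[OF e])
  have sM[measurable]: "s m \<in> borel_measurable M" for m by (rule L2_measurable[OF sL])
  have inner_es: "L2_inner M (e i) (\<lambda>x. \<Sum>i\<in>J. c i * e i x) = (if i \<in> J then c i else 0)"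
    if "finite J" for i J
    using that e by (subst L2_inner_sum) (auto simp: L2_scale L2_inner_scale on if_distrib
        cong: if_cong)
  have inner_ss: "L2_inner M (\<lambda>x. \<Sum>i\<in>J. c i * e i x) (\<lambda>x. \<Sum>i\<in>J. c i * e i x) = (\<Sum>i\<in>J. (c i)\<^sup>2)"
    if "finite J" for J
  proof -
    have "L2_inner M (\<lambda>x. \<Sum>i\<in>J. c i * e i x) (\<lambda>x. \<Sum>i\<in>J. c i * e i x)
      = (\<Sum>i\<in>J. c i * L2_inner M (e i) (\<lambda>x. \<Sum>i\<in>J. c i * e i x))"
      by (subst L2_inner_sum)
        (auto intro!: L2_sum L2_scale e sum.cong simp: L2_inner_scale L2_inner_commute[of M _ "e _"])
    also have "\<dots> = (\<Sum>i\<in>J. (c i)\<^sup>2)"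
      by (intro sum.cong refl) (simp add: inner_es that power2_eq_square)
    finally show ?thesis .
  qed
  have s_diff: "L2_inner M (\<lambda>x. s n x - s m x) (\<lambda>x. s n x - s m x) \<le> T m" if "m \<le> n" for m n
  proof -
    have "(\<lambda>x. s n x - s m x) = (\<lambda>x. \<Sum>i\<in>{m..<n}. c i * e i x)"
      using that by (auto simp: s_def fun_eq_iff sum_diff_nat_ivl lessThan_atLeast0)
    then have "L2_inner M (\<lambda>x. s n x - s m x) (\<lambda>x. s n x - s m x) = (\<Sum>i\<in>{m..<n}. (c i)\<^sup>2)"
      by (simp add: inner_ss)
    also have "\<dots> = (\<Sum>i<n - m. (c (i + m))\<^sup>2)"
      using that sum.shift_bounds_nat_ivl[of "\<lambda>i. (c i)\<^sup>2" 0 m "n - m"]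
      by (simp add: lessThan_atLeast0)
    also have "\<dots> \<le> T m"
      unfolding T_def using summable_ignore_initial_segment[OF c] by (intro sum_le_suminf) auto
    finally show ?thesis .
  qed
  have "T \<longlonglongrightarrow> 0"
    unfolding T_def by (rule suminf_exist_split2[OF c])
  then have "\<exists>N. \<forall>m\<ge>N. T m \<le> (1/4)^k" for k :: nat
    using order_tendstoD(2)[of T 0 sequentially "(1/4)^k"]
    by (auto simp: eventually_sequentially) (meson less_imp_le)
  then obtain N where N: "\<And>k m. N k \<le> m \<Longrightarrow> T m \<le> (1/4)^k" by metis
  \<comment> \<open>a strictly increasing sequence above \<open>N\<close>\<close>
  define r where "r = (\<lambda>k. \<Sum>i\<le>k. Suc (N i))"
  have r_mono: "strict_mono r" unfolding strict_mono_Suc_iff r_def by simp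
  have rN: "N k \<le> r k" for k
    unfolding r_def using member_le_sum[of k "{..k}" "\<lambda>i. Suc (N i)"] by simp
  define d where "d = (\<lambda>k x. s (r (Suc k)) x - s (r k) x)"
  have dM[measurable]: "d k \<in> borel_measurable M" for k unfolding d_def by measurable
  have d_le: "(\<integral>\<^sup>+x. ennreal ((d k x)\<^sup>2) \<partial>M) \<le> ennreal ((1/4)^k)" for k
  proof -
    have "d k \<in> L2 M" unfolding d_def by (intro L2_diff sL)
    then have "(\<integral>\<^sup>+x. ennreal ((d k x)\<^sup>2) \<partial>M) = ennreal (L2_inner M (d k) (d k))"
      unfolding L2_inner_def
      by (subst nn_integral_eq_integral) (auto simp: L2_integrable_square power2_eq_square[symmetric])
    also have "L2_inner M (d k) (d k) \<le> T (r k)"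
      unfolding d_def by (rule s_diff) (simp add: strict_mono_less_eq[OF r_mono])
    also have "\<dots> \<le> (1/4)^k" by (rule N[OF rN])
    finally show ?thesis by (simp add: ennreal_leI)
  qed
  \<comment> \<open>the weights \<open>2\<^sup>k\<close> still leave a convergent series, and control \<open>|d k x|\<close> through
    \<open>2 |d| \<le> 2\<^sup>-\<^sup>k + 2\<^sup>k d\<^sup>2\<close>\<close>
  have "(\<integral>\<^sup>+x. (\<Sum>k. ennreal (2^k * (d k x)\<^sup>2)) \<partial>M) = (\<Sum>k. \<integral>\<^sup>+x. ennreal (2^k * (d k x)\<^sup>2) \<partial>M)"
    by (rule nn_integral_suminf) measurable
  also have "\<dots> \<le> (\<Sum>k. ennreal ((1/2)^k))"
  proof (rule suminf_le)
    fix k :: nat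
    have "(\<integral>\<^sup>+x. ennreal (2^k * (d k x)\<^sup>2) \<partial>M) = ennreal (2^k) * (\<integral>\<^sup>+x. ennreal ((d k x)\<^sup>2) \<partial>M)"
      by (subst nn_integral_cmult[symmetric]) (auto simp: ennreal_mult)
    also have "\<dots> \<le> ennreal (2^k) * ennreal ((1/4)^k)" by (intro mult_left_mono d_le) simp
    also have "\<dots> = ennreal ((1/2)^k)"
      by (simp add: ennreal_mult[symmetric] power_mult_distrib[symmetric])
    finally show "(\<integral>\<^sup>+x. ennreal (2^k * (d k x)\<^sup>2) \<partial>M) \<le> ennreal ((1/2)^k)" .
  qed auto
  also have "\<dots> < \<infinity>"
    by (subst suminf_ennreal2) (auto simp: summable_geometric)
  finally have fin: "(\<integral>\<^sup>+x. (\<Sum>k. ennreal (2^k * (d k x)\<^sup>2)) \<partial>M) < \<infinity>" .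
  have "AE x in M. (\<Sum>k. ennreal (2^k * (d k x)\<^sup>2)) \<noteq> \<infinity>"
    by (rule nn_integral_PInf_AE) (use fin in auto)
  then have conv: "AE x in M. convergent (\<lambda>k. s (r k) x)"
  proof eventually_elim
    case (elim x)
    then have sm: "summable (\<lambda>k. 2^k * (d k x)\<^sup>2)"
      by (intro summable_suminf_not_top) (auto simp: top.not_eq_extremum)
    have "summable (\<lambda>k. (1/2)^k + 2^k * (d k x)\<^sup>2)"
      by (intro summable_add sm) (simp add: summable_geometric)
    then have "summable (\<lambda>k. d k x)"
    proof (rule summable_comparison_test'[where N = 0])
      fix k :: nat
      have "2 * \<bar>d k x\<bar> * 2^k \<le> 1 + (\<bar>d k x\<bar> * 2^k)\<^sup>2"
        using sum_squares_bound[of 1 "\<bar>d k x\<bar> * 2^k"] by (simp add: algebra_simps)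
      then have "2 * \<bar>d k x\<bar> \<le> (1 + (\<bar>d k x\<bar> * 2^k)\<^sup>2) / 2^k"
        by (simp add: field_simps)
      also have "\<dots> = (1/2)^k + 2^k * (d k x)\<^sup>2"
        by (simp add: field_simps power2_eq_square)
      finally show "norm (d k x) \<le> (1/2)^k + 2^k * (d k x)\<^sup>2" by simp
    qed
    then have "convergent (\<lambda>k. s (r 0) x + (\<Sum>j<k. d j x))"
      by (intro convergent_add convergent_const) (simp add: summable_iff_convergent)
    moreover have "s (r 0) x + (\<Sum>j<k. d j x) = s (r k) x" for k
      unfolding d_def by (subst sum_lessThan_telescope) simp
    ultimately show ?case by simp
  qed
  define g where "g = (\<lambda>x. lim (\<lambda>k. s (r k) x))"
  have gM[measurable]: "g \<in> borel_measurable M"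
    unfolding g_def by (rule borel_measurable_lim_metric) measurable
  have lim: "AE x in M. (\<lambda>k. s (r k) x) \<longlonglongrightarrow> g x"
    using conv by eventually_elim (simp add: g_def convergent_LIMSEQ_iff)
  have bound: "(\<integral>\<^sup>+x. ennreal ((g x - s m x)\<^sup>2) \<partial>M) \<le> ennreal (T m)" for m
  proof -
    have "(\<integral>\<^sup>+x. ennreal ((g x - s m x)\<^sup>2) \<partial>M)
        = (\<integral>\<^sup>+x. liminf (\<lambda>k. ennreal ((s (r k) x - s m x)\<^sup>2)) \<partial>M)"
    proof (rule nn_integral_cong_AE, use lim in eventually_elim)
      case (elim x)
      have "(\<lambda>k. ennreal ((s (r k) x - s m x)\<^sup>2)) \<longlonglongrightarrow> ennreal ((g x - s m x)\<^sup>2)"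
        by (intro tendsto_ennrealI tendsto_intros elim)
      then show ?case by (intro lim_imp_Liminf[symmetric]) auto
    qed
    also have "\<dots> \<le> liminf (\<lambda>k. \<integral>\<^sup>+x. ennreal ((s (r k) x - s m x)\<^sup>2) \<partial>M)"
      by (rule nn_integral_liminf) measurable
    also have "\<dots> \<le> ennreal (T m)"
    proof -
      have "eventually (\<lambda>k. m \<le> r k) sequentially"
        using filterlim_subseq[OF r_mono] by (auto simp: filterlim_at_top)
      then have "eventually (\<lambda>k. (\<integral>\<^sup>+x. ennreal ((s (r k) x - s m x)\<^sup>2) \<partial>M) \<le> ennreal (T m)) sequentially"
      proof eventually_elim
        case (elim k)
        have "(\<lambda>x. s (r k) x - s m x) \<in> L2 M" by (intro L2_diff sL)
        then have "(\<integral>\<^sup>+x. ennreal ((s (r k) x - s m x)\<^sup>2) \<partial>M)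
          = ennreal (L2_inner M (\<lambda>x. s (r k) x - s m x) (\<lambda>x. s (r k) x - s m x))"
          unfolding L2_inner_def
          by (subst nn_integral_eq_integral) (auto simp: L2_integrable_square power2_eq_square[symmetric]
              dest: L2_integrable_square)
        then show ?case using s_diff[OF elim] by (simp add: ennreal_leI)
      qed
      then have "limsup (\<lambda>k. \<integral>\<^sup>+x. ennreal ((s (r k) x - s m x)\<^sup>2) \<partial>M) \<le> ennreal (T m)"
        by (rule Limsup_bounded)
      then show ?thesis
        using Liminf_le_Limsup[OF sequentially_bot] order_trans by blast
    qed
    finally show ?thesis .
  qed
  have gs: "(\<lambda>x. g x - s m x) \<in> L2 M" for m
  proof -
    have "(\<integral>\<^sup>+x. ennreal ((g x - s m x)\<^sup>2) \<partial>M) < \<infinity>"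
      using bound[of m] by (rule order.strict_trans1) simp
    then show ?thesis by (auto simp: L2_def integrable_iff_bounded)
  qed
  show thesis
  proof
    show "g \<in> L2 M" using gs[of 0] by (simp add: s_def)
    fix m
    have "ennreal (L2_inner M (\<lambda>x. g x - s m x) (\<lambda>x. g x - s m x)) \<le> ennreal (T m)"
      using bound[of m] gs[of m] unfolding L2_inner_def
      by (subst (asm) nn_integral_eq_integral) (auto simp: power2_eq_square[symmetric]
              dest: L2_integrable_square)
    moreover have "0 \<le> T m" unfolding T_def
      using summable_ignore_initial_segment[OF c] by (intro suminf_nonneg) auto
    ultimately show "L2_inner M (\<lambda>x. g x - (\<Sum>i<m. c i * e i x)) (\<lambda>x. g x - (\<Sum>i<m. c i * e i x))
       \<le> (\<Sum>i. (c (i + m))\<^sup>2)"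
      by (simp add: s_def T_def)
  qed
qed

lemma Bessel_identity:
  fixes e :: "nat \<Rightarrow> 'a \<Rightarrow> real"
  assumes e: "\<And>i. e i \<in> L2 M" and f: "f \<in> L2 M"
    and on: "\<And>i j. L2_inner M (e i) (e j) = (if i = j then 1 else 0)"
  shows "L2_inner M (\<lambda>x. f x - (\<Sum>i<m. L2_inner M (e i) f * e i x))
      (\<lambda>x. f x - (\<Sum>i<m. L2_inner M (e i) f * e i x))
    = L2_inner M f f - (\<Sum>i<m. (L2_inner M (e i) f)\<^sup>2)"
proof -
  define s where "s = (\<lambda>x. \<Sum>i<m. L2_inner M (e i) f * e i x)"
  have sL: "s \<in> L2 M" unfolding s_def by (intro L2_sum L2_scale e)
  have fs: "L2_inner M h s = (\<Sum>i<m. L2_inner M (e i) f * L2_inner M (e i) h)" if "h \<in> L2 M" for h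
    unfolding s_def using that e
    by (subst L2_inner_sum) (auto simp: L2_scale L2_inner_scale L2_inner_commute[of M h])
  have es: "L2_inner M (e i) s = (if i < m then L2_inner M (e i) f else 0)" for i
    using fs[OF e[of i]] by (simp add: on if_distrib sum.delta cong: if_cong)
  have "L2_inner M s s = (\<Sum>i<m. (L2_inner M (e i) f)\<^sup>2)"
    using fs[OF sL] by (simp add: es power2_eq_square)
  moreover have "L2_inner M f s = (\<Sum>i<m. (L2_inner M (e i) f)\<^sup>2)"
    using fs[OF f] by (simp add: power2_eq_square)
  ultimately have "L2_inner M (\<lambda>x. f x - s x) (\<lambda>x. f x - s x)
    = L2_inner M f f - (\<Sum>i<m. (L2_inner M (e i) f)\<^sup>2)"
    using L2_inner_diff_self[OF f sL] by simp
  then show ?thesis by (simp add: s_def)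
qed

lemma Riesz_Fischer_coefficients:
  fixes e :: "nat \<Rightarrow> 'a \<Rightarrow> real" and c :: "nat \<Rightarrow> real"
  assumes e: "\<And>i. e i \<in> L2 M"
    and on: "\<And>i j. L2_inner M (e i) (e j) = (if i = j then 1 else 0)"
    and c: "summable (\<lambda>i. (c i)\<^sup>2)"
  obtains g where "g \<in> L2 M" "\<And>i. L2_inner M (e i) g = c i"
    "\<And>m. L2_inner M (\<lambda>x. g x - (\<Sum>i<m. c i * e i x)) (\<lambda>x. g x - (\<Sum>i<m. c i * e i x))
       \<le> (\<Sum>i. (c (i + m))\<^sup>2)"
proof -
  obtain g where g: "g \<in> L2 M" and
    gs: "\<And>m. L2_inner M (\<lambda>x. g x - (\<Sum>i<m. c i * e i x)) (\<lambda>x. g x - (\<Sum>i<m. c i * e i x))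
       \<le> (\<Sum>i. (c (i + m))\<^sup>2)"
    using Riesz_Fischer[OF e on c] by blast
  have T: "(\<lambda>m. \<Sum>i. (c (i + m))\<^sup>2) \<longlonglongrightarrow> 0"
    by (rule suminf_exist_split2[OF c])
  have sL: "(\<lambda>x. \<Sum>i<m. c i * e i x) \<in> L2 M" for m by (intro L2_sum L2_scale e)
  have gc: "L2_inner M (e j) g = c j" for j
  proof -
    have "(L2_inner M (e j) g - c j)\<^sup>2 \<le> (\<Sum>i. (c (i + m))\<^sup>2)" if "j < m" for m
    proof -
      have "L2_inner M (e j) (\<lambda>x. \<Sum>i<m. c i * e i x) = c j"
        using that e by (subst L2_inner_sum)
          (auto simp: L2_scale L2_inner_scale on if_distrib cong: if_cong)
      then have "(L2_inner M (e j) g - c j)\<^sup>2 = (L2_inner M (e j) (\<lambda>x. g x - (\<Sum>i<m. c i * e i x)))\<^sup>2"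
        using L2_inner_diff[OF g sL e] by simp
      also have "\<dots> \<le> L2_inner M (e j) (e j) * L2_inner M (\<lambda>x. g x - (\<Sum>i<m. c i * e i x)) (\<lambda>x. g x - (\<Sum>i<m. c i * e i x))"
        by (intro L2_Cauchy_Schwarz e L2_diff g sL)
      also have "\<dots> \<le> (\<Sum>i. (c (i + m))\<^sup>2)" using gs[of m] by (simp add: on)
      finally show ?thesis .
    qed
    then have "(L2_inner M (e j) g - c j)\<^sup>2 \<le> 0"
      by (intro LIMSEQ_le_const[OF T]) (auto intro!: exI[of _ "Suc j"])
    then show ?thesis by simp
  qed
  show thesis by (rule that[OF g gc gs])
qed

text \<open>
  The function with the coefficients of \<open>f\<close> that the preceding lemma supplies differs from \<open>f\<close> by
  something orthogonal to the basis, hence by a null function.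
\<close>

lemma Parseval:
  assumes b: "L2_orthonormal_basis M e" and f: "f \<in> L2 M"
  shows "(\<lambda>i. (L2_inner M (e i) f)\<^sup>2) sums L2_inner M f f"
proof -
  define c where "c i = L2_inner M (e i) f" for i
  have e: "e i \<in> L2 M" for i using b by (simp add: L2_orthonormal_basis_def)
  have on: "L2_inner M (e i) (e j) = (if i = j then 1 else 0)" for i j
    using b by (simp add: L2_orthonormal_basis_def)
  note bes = Bessel_identity[OF e f on, folded c_def]
  have le: "(\<Sum>i<m. (c i)\<^sup>2) \<le> L2_inner M f f" for m
    using L2_inner_self_nonneg[of M "\<lambda>x. f x - (\<Sum>i<m. c i * e i x)"] bes[of m] by simp
  have c: "summable (\<lambda>i. (c i)\<^sup>2)"
    by (rule summableI_nonneg_bounded[OF _ le]) simp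
  obtain g where g: "g \<in> L2 M" and gc: "\<And>i. L2_inner M (e i) g = c i" and
    gs: "\<And>m. L2_inner M (\<lambda>x. g x - (\<Sum>i<m. c i * e i x)) (\<lambda>x. g x - (\<Sum>i<m. c i * e i x))
       \<le> (\<Sum>i. (c (i + m))\<^sup>2)"
    using Riesz_Fischer_coefficients[OF e on c] by blast
  have T: "(\<lambda>m. \<Sum>i. (c (i + m))\<^sup>2) \<longlonglongrightarrow> 0"
    by (rule suminf_exist_split2[OF c])
  have sL: "(\<lambda>x. \<Sum>i<m. c i * e i x) \<in> L2 M" for m by (intro L2_sum L2_scale e)
  from gc have "\<forall>i. L2_inner M (e i) (\<lambda>x. f x - g x) = 0"
    using L2_inner_diff[OF f g e] by (simp add: c_def)
  then have "AE x in M. f x - g x = 0"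
    using b L2_diff[OF f g] unfolding L2_orthonormal_basis_def by blast
  then have fg: "AE x in M. f x = g x" by simp
  have "L2_inner M f f - (\<Sum>i<m. (c i)\<^sup>2) \<le> (\<Sum>i. (c (i + m))\<^sup>2)" for m
  proof -
    have "L2_inner M (\<lambda>x. f x - (\<Sum>i<m. c i * e i x)) (\<lambda>x. f x - (\<Sum>i<m. c i * e i x))
      = L2_inner M (\<lambda>x. g x - (\<Sum>i<m. c i * e i x)) (\<lambda>x. g x - (\<Sum>i<m. c i * e i x))"
      using fg by (intro L2_inner_cong_AE L2_measurable L2_diff f g sL) auto
    then show ?thesis using gs[of m] bes[of m] by simp
  qed
  then have "L2_inner M f f - suminf (\<lambda>i. (c i)\<^sup>2) \<le> 0"
    by (intro LIMSEQ_le[OF tendsto_diff[OF tendsto_const summable_LIMSEQ[OF c]] T]) auto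
  moreover have "suminf (\<lambda>i. (c i)\<^sup>2) \<le> L2_inner M f f"
    by (rule suminf_le_const[OF c le])
  ultimately show ?thesis using summable_sums[OF c] by (simp add: c_def)
qed

lemma Parseval_inner_summable:
  assumes b: "L2_orthonormal_basis M e" and f: "f \<in> L2 M" and g: "g \<in> L2 M"
  shows "summable (\<lambda>i. norm (L2_inner M (e i) f * L2_inner M (e i) g))"
proof (rule summable_comparison_test'[where N = 0])
  show "summable (\<lambda>i. (L2_inner M (e i) f)\<^sup>2 + (L2_inner M (e i) g)\<^sup>2)"
    using Parseval[OF b f] Parseval[OF b g] by (intro summable_add) (auto simp: sums_iff)
  show "norm (norm (L2_inner M (e i) f * L2_inner M (e i) g))
      \<le> (L2_inner M (e i) f)\<^sup>2 + (L2_inner M (e i) g)\<^sup>2" for i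
    using abs_mult_le_sum_squares by simp
qed

lemma Parseval_inner:
  assumes b: "L2_orthonormal_basis M e" and f: "f \<in> L2 M" and g: "g \<in> L2 M"
  shows "(\<lambda>i. L2_inner M (e i) f * L2_inner M (e i) g) sums L2_inner M f g"
proof -
  have e: "e i \<in> L2 M" for i using b by (simp add: L2_orthonormal_basis_def)
  have fg: "(\<lambda>x. f x - g x) \<in> L2 M" by (rule L2_diff[OF f g])
  have "(\<lambda>i. ((L2_inner M (e i) f)\<^sup>2 + (L2_inner M (e i) g)\<^sup>2 - (L2_inner M (e i) (\<lambda>x. f x - g x))\<^sup>2) / 2)
    sums ((L2_inner M f f + L2_inner M g g - L2_inner M (\<lambda>x. f x - g x) (\<lambda>x. f x - g x)) / 2)"
    by (intro sums_divide sums_diff sums_add Parseval[OF b] f g fg)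
  then show ?thesis
    by (simp add: L2_inner_diff_self[OF f g] L2_inner_diff[OF f g e] power2_diff)
qed

section \<open>Hilbert--Schmidt integral operators\<close>

definition integral_op :: "'a measure \<Rightarrow> ('a \<Rightarrow> 'a \<Rightarrow> real) \<Rightarrow> ('a \<Rightarrow> real) \<Rightarrow> 'a \<Rightarrow> real" where
  "integral_op M k h x = (\<integral>y. k x y * h y \<partial>M)"

locale hs_kernel = sigma_finite_measure M for M :: "'a measure" +
  fixes k :: "'a \<Rightarrow> 'a \<Rightarrow> real"
  assumes k_measurable[measurable]: "(\<lambda>(x, y). k x y) \<in> borel_measurable (M \<Otimes>\<^sub>M M)"
    and k_sym: "k x y = k y x"
    and k_square: "integrable (M \<Otimes>\<^sub>M M) (\<lambda>(x, y). (k x y)\<^sup>2)"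
begin

sublocale pair: pair_sigma_finite M M ..

abbreviation K where "K \<equiv> integral_op M k"

definition row :: "'a \<Rightarrow> real" where "row x = (\<integral>y. (k x y)\<^sup>2 \<partial>M)"

definition hs2 :: real where "hs2 = integral\<^sup>L M row"

lemma row_measurable[measurable]: "row \<in> borel_measurable M"
  unfolding row_def by measurable

lemma row_integrable: "integrable M row"
  using pair.integrable_fst'[OF k_square] by (simp add: row_def[abs_def])

lemma row_nonneg: "0 \<le> row x"
  by (simp add: row_def)

lemma AE_row_L2: "AE x in M. k x \<in> L2 M"
proof -
  have "AE x in M. x \<in> space M" by simp
  with pair.AE_integrable_fst'[OF k_square] show ?thesis
  proof eventually_elim
    case (elim x)
    then show ?case by (auto simp: L2_def)
  qed
qed

lemma K_eq_inner: "K h x = L2_inner M (k x) h"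
  by (simp add: integral_op_def L2_inner_def)

lemma row_eq_inner: "row x = L2_inner M (k x) (k x)"
  by (simp add: row_def L2_inner_def power2_eq_square)

lemma K_measurable[measurable]:
  assumes [measurable]: "h \<in> borel_measurable M"
  shows "K h \<in> borel_measurable M"
  unfolding integral_op_def[abs_def] by measurable

lemma K_pointwise:
  assumes "k x \<in> L2 M" "h \<in> L2 M"
  shows "(K h x)\<^sup>2 \<le> row x * L2_inner M h h"
  unfolding K_eq_inner row_eq_inner by (rule L2_Cauchy_Schwarz[OF assms])

lemma K_L2:
  assumes h: "h \<in> L2 M"
  shows "K h \<in> L2 M"
proof -
  have "integrable M (\<lambda>x. (K h x)\<^sup>2)"
  proof (rule Bochner_Integration.integrable_bound)
    show "integrable M (\<lambda>x. row x * L2_inner M h h)" using row_integrable by simp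
    show "(\<lambda>x. (K h x)\<^sup>2) \<in> borel_measurable M"
      using L2_measurable[OF h] by measurable
    show "AE x in M. norm ((K h x)\<^sup>2) \<le> norm (row x * L2_inner M h h)"
      using AE_row_L2
      by eventually_elim (use order_trans[OF K_pointwise[OF _ h] abs_ge_self] in simp)
  qed
  then show ?thesis using L2_measurable[OF h] by (simp add: L2_def)
qed

lemma K_norm_le:
  assumes h: "h \<in> L2 M"
  shows "L2_inner M (K h) (K h) \<le> hs2 * L2_inner M h h"
proof -
  have "L2_inner M (K h) (K h) = (\<integral>x. (K h x)\<^sup>2 \<partial>M)"
    by (simp add: L2_inner_def power2_eq_square)
  also have "\<dots> \<le> (\<integral>x. row x * L2_inner M h h \<partial>M)"
    using row_integrable L2_integrable_square[OF K_L2[OF h]] AE_row_L2 K_pointwise[OF _ h]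
    by (intro integral_mono_AE) auto
  finally show ?thesis by (simp add: hs2_def)
qed

lemma quadratic_integrable:
  assumes g: "g \<in> L2 M" and h: "h \<in> L2 M"
  shows "integrable (M \<Otimes>\<^sub>M M) (\<lambda>(x, y). g x * k x y * h y)"
proof (rule Bochner_Integration.integrable_bound)
  note [measurable] = L2_measurable[OF g] L2_measurable[OF h]
  have "integrable (M \<Otimes>\<^sub>M M) (\<lambda>(x, y). (g x)\<^sup>2 * (h y)\<^sup>2)"
    using L2_integrable_square[OF g] L2_integrable_square[OF h]
    by (intro pair.Fubini_integrable) (auto simp: abs_mult)
  then show "integrable (M \<Otimes>\<^sub>M M) (\<lambda>p. (case p of (x, y) \<Rightarrow> (g x)\<^sup>2 * (h y)\<^sup>2) + (case p of (x, y) \<Rightarrow> (k x y)\<^sup>2))"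
    by (intro Bochner_Integration.integrable_add k_square)
  show "(\<lambda>(x, y). g x * k x y * h y) \<in> borel_measurable (M \<Otimes>\<^sub>M M)" by measurable
  have "\<bar>a * c * b\<bar> \<le> \<bar>a\<^sup>2 * b\<^sup>2 + c\<^sup>2\<bar>" for a b c :: real
    using order_trans[OF abs_mult_le_sum_squares[of "a * b" c] abs_ge_self]
    by (simp add: power_mult_distrib ac_simps)
  then show "AE p in M \<Otimes>\<^sub>M M. norm (case p of (x, y) \<Rightarrow> g x * k x y * h y)
     \<le> norm ((case p of (x, y) \<Rightarrow> (g x)\<^sup>2 * (h y)\<^sup>2) + (case p of (x, y) \<Rightarrow> (k x y)\<^sup>2))"
    by (intro AE_I2) (auto split: prod.split)
qed

lemma K_inner_eq_double:
  assumes g: "g \<in> L2 M" and h: "h \<in> L2 M"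
  shows "L2_inner M g (K h) = (\<integral>(x, y). g x * k x y * h y \<partial>(M \<Otimes>\<^sub>M M))"
  using pair.integral_fst'[OF quadratic_integrable[OF g h]]
  by (simp add: L2_inner_def integral_op_def mult.assoc)

lemma K_symmetric:
  assumes g: "g \<in> L2 M" and h: "h \<in> L2 M"
  shows "L2_inner M g (K h) = L2_inner M (K g) h"
proof -
  have "L2_inner M g (K h) = (\<integral>x. (\<integral>y. g x * k x y * h y \<partial>M) \<partial>M)"
    by (simp add: L2_inner_def integral_op_def mult.assoc)
  also have "\<dots> = (\<integral>y. (\<integral>x. g x * k x y * h y \<partial>M) \<partial>M)"
    using pair.Fubini_integral[of "\<lambda>x y. g x * k x y * h y"] quadratic_integrable[OF g h] by simp
  also have "\<dots> = L2_inner M (K g) h"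
    unfolding L2_inner_def integral_op_def
    by (intro Bochner_Integration.integral_cong refl)
      (simp add: k_sym mult.commute mult.left_commute flip: integral_mult_right_zero)
  finally show ?thesis .
qed

lemma K_scale: "K (\<lambda>x. c * h x) = (\<lambda>x. c * K h x)"
  by (rule ext) (simp add: integral_op_def mult.left_commute)

lemma K_cong_AE:
  assumes "f \<in> borel_measurable M" "g \<in> borel_measurable M" "AE x in M. f x = g x" "x \<in> space M"
  shows "K f x = K g x"
  unfolding integral_op_def using assms by (intro integral_cong_AE) auto

context
  fixes e assumes e: "L2_orthonormal_basis M e"
begin

lemma basis_L2: "e i \<in> L2 M"
  using e by (simp add: L2_orthonormal_basis_def)

text \<open>
  Almost every row \<open>k x\<close> is square-integrable and \<open>K (e i) x\<close> is its \<open>i\<close>-th coefficient, so that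
  Parseval's identity holds under the integral over \<open>x\<close>.
\<close>

lemma K_basis_squares_sums: "(\<lambda>i. L2_inner M (K (e i)) (K (e i))) sums hs2"
proof -
  have eq: "L2_inner M (K (e i)) (K (e i)) = (\<integral>x. (K (e i) x)\<^sup>2 \<partial>M)" for i
    by (simp add: L2_inner_def power2_eq_square)
  have int: "integrable M (\<lambda>x. (K (e i) x)\<^sup>2)" for i
    by (intro L2_integrable_square K_L2 basis_L2)
  have par: "AE x in M. (\<lambda>i. (K (e i) x)\<^sup>2) sums row x"
    using AE_row_L2
  proof eventually_elim
    case (elim x)
    show ?case
      using Parseval[OF e elim] by (simp add: K_eq_inner row_eq_inner L2_inner_commute)
  qed
  have "(\<Sum>i<n. \<integral>x. (K (e i) x)\<^sup>2 \<partial>M) \<le> hs2" for n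
  proof -
    have "(\<Sum>i<n. \<integral>x. (K (e i) x)\<^sup>2 \<partial>M) = (\<integral>x. (\<Sum>i<n. (K (e i) x)\<^sup>2) \<partial>M)"
      by (simp add: int)
    also have "\<dots> \<le> hs2"
      unfolding hs2_def
    proof (intro integral_mono_AE row_integrable)
      show "AE x in M. (\<Sum>i<n. (K (e i) x)\<^sup>2) \<le> row x"
        using par
      proof eventually_elim
        case (elim x)
        then show ?case using sum_le_suminf[of "\<lambda>i. (K (e i) x)\<^sup>2" "{..<n}"] by (simp add: sums_iff)
      qed
    qed (simp add: int)
    finally show ?thesis .
  qed
  then have "summable (\<lambda>i. \<integral>x. (K (e i) x)\<^sup>2 \<partial>M)"
    by (intro summableI_nonneg_bounded) auto
  then have "(\<lambda>i. \<integral>x. (K (e i) x)\<^sup>2 \<partial>M) sums (\<integral>x. (\<Sum>i. (K (e i) x)\<^sup>2) \<partial>M)"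
    using par by (intro sums_integral int) (auto simp: sums_iff elim!: eventually_mono)
  moreover have "(\<integral>x. (\<Sum>i. (K (e i) x)\<^sup>2) \<partial>M) = hs2"
  proof -
    have [measurable]: "K (e i) \<in> borel_measurable M" for i
      by (intro K_measurable L2_measurable basis_L2)
    show ?thesis
      unfolding hs2_def using par by (intro integral_cong_AE) (auto simp: sums_iff elim!: eventually_mono)
  qed
  ultimately show ?thesis by (simp add: eq)
qed

lemma K_square_has_sum: "((\<lambda>i. L2_inner M (e i) (K (K (e i)))) has_sum hs2) UNIV"
proof -
  have "L2_inner M (e i) (K (K (e i))) = L2_inner M (K (e i)) (K (e i))" for i
    by (intro K_symmetric K_L2 basis_L2)
  then show ?thesis
    using sums_nonneg_imp_has_sum[OF K_basis_squares_sums L2_inner_self_nonneg] by simp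
qed

text \<open>
  By symmetry \<open>K (K (e i)) x\<close> is the \<open>i\<close>-th coefficient of \<open>K (k x)\<close>. The products of coefficients
  have no sign, so sum and integral are exchanged by absolute convergence.
\<close>

lemma K_cube_has_sum:
  "((\<lambda>i. L2_inner M (e i) (K (K (K (e i))))) has_sum (\<integral>x. L2_inner M (k x) (K (k x)) \<partial>M)) UNIV"
proof -
  have KL: "K (e i) \<in> L2 M" "K (K (e i)) \<in> L2 M" for i by (intro K_L2 basis_L2)+
  have [measurable]: "K (e i) \<in> borel_measurable M" "K (K (e i)) \<in> borel_measurable M" for i
    by (intro L2_measurable KL)+
  have eq: "L2_inner M (e i) (K (K (K (e i)))) = (\<integral>x. K (e i) x * K (K (e i)) x \<partial>M)" for i
    using K_symmetric[OF basis_L2 KL(2)] by (simp add: L2_inner_def)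
  have int: "integrable M (\<lambda>x. K (e i) x * K (K (e i)) x)" for i
    by (intro L2_integrable_mult KL)
  have par: "AE x in M. summable (\<lambda>i. norm (K (e i) x * K (K (e i)) x)) \<and>
    (\<lambda>i. K (e i) x * K (K (e i)) x) sums L2_inner M (k x) (K (k x))"
    using AE_row_L2
  proof eventually_elim
    case (elim x)
    have "K (K (e i)) x = L2_inner M (e i) (K (k x))" for i
      using K_symmetric[OF elim basis_L2, of i] by (simp add: K_eq_inner[of "K (e i)"] L2_inner_commute)
    moreover have "K (e i) x = L2_inner M (e i) (k x)" for i
      by (simp add: K_eq_inner L2_inner_commute)
    ultimately show ?case
      using Parseval_inner[OF e elim K_L2[OF elim]] Parseval_inner_summable[OF e elim K_L2[OF elim]]
      by simp
  qed
  have sm: "summable (\<lambda>i. \<integral>x. norm (K (e i) x * K (K (e i)) x) \<partial>M)"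
  proof (rule summable_comparison_test'[where N = 0])
    show "summable (\<lambda>i. (1 + hs2) * L2_inner M (K (e i)) (K (e i)))"
      using K_basis_squares_sums by (intro summable_mult) (auto simp: sums_iff)
    fix i :: nat
    have "(\<integral>x. norm (K (e i) x * K (K (e i)) x) \<partial>M)
        \<le> (\<integral>x. (K (e i) x)\<^sup>2 + (K (K (e i)) x)\<^sup>2 \<partial>M)"
      using abs_mult_le_sum_squares
      by (intro integral_mono integrable_norm int Bochner_Integration.integrable_add L2_integrable_square KL) auto
    also have "\<dots> = L2_inner M (K (e i)) (K (e i)) + L2_inner M (K (K (e i))) (K (K (e i)))"
      using KL by (simp add: L2_inner_def power2_eq_square L2_integrable_mult)
    also have "\<dots> \<le> (1 + hs2) * L2_inner M (K (e i)) (K (e i))"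
      using K_norm_le[OF KL(1)] by (simp add: algebra_simps)
    finally show "norm (\<integral>x. norm (K (e i) x * K (K (e i)) x) \<partial>M) \<le> (1 + hs2) * L2_inner M (K (e i)) (K (e i))"
      by simp
  qed
  have "(\<lambda>i. \<integral>x. K (e i) x * K (K (e i)) x \<partial>M) sums (\<integral>x. (\<Sum>i. K (e i) x * K (K (e i)) x) \<partial>M)"
    using par by (intro sums_integral int sm) (auto elim!: eventually_mono)
  moreover have "(\<integral>x. (\<Sum>i. K (e i) x * K (K (e i)) x) \<partial>M) = (\<integral>x. L2_inner M (k x) (K (k x)) \<partial>M)"
  proof -
    have "(\<lambda>x. L2_inner M (k x) (K (k x))) \<in> borel_measurable M"
      unfolding L2_inner_def integral_op_def by measurable
    then show ?thesis
      using par by (intro integral_cong_AE) (auto simp: sums_iff elim!: eventually_mono)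
  qed
  moreover have "summable (\<lambda>i. norm (\<integral>x. K (e i) x * K (K (e i)) x \<partial>M))"
    by (rule summable_comparison_test'[OF sm, of 0]) (use integral_norm_bound in auto)
  ultimately show ?thesis by (intro norm_summable_imp_has_sum) (auto simp: eq)
qed

lemma matrix_sym: "L2_inner M (e i) (K (e j)) = L2_inner M (e j) (K (e i))"
  by (metis K_symmetric basis_L2 L2_inner_commute)

text \<open>
  In coordinates with respect to the basis the operator is multiplication by its matrix; together with
  Riesz--Fischer this turns the eigenvalue problem into one for square-summable sequences.
\<close>

lemma matrix_row_sums:
  assumes h: "h \<in> L2 M"
  shows "(\<lambda>j. L2_inner M (e i) (K (e j)) * L2_inner M (e j) h) sums L2_inner M (e i) (K h)"
    and "(\<lambda>j. (L2_inner M (e i) (K (e j)))\<^sup>2) sums L2_inner M (K (e i)) (K (e i))"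
proof -
  have eq: "L2_inner M (e i) (K (e j)) = L2_inner M (e j) (K (e i))" for j by (rule matrix_sym)
  show "(\<lambda>j. L2_inner M (e i) (K (e j)) * L2_inner M (e j) h) sums L2_inner M (e i) (K h)"
    using Parseval_inner[OF e K_L2[OF basis_L2, of i] h] K_symmetric[OF basis_L2 h, of i]
    by (simp add: eq)
  show "(\<lambda>j. (L2_inner M (e i) (K (e j)))\<^sup>2) sums L2_inner M (K (e i)) (K (e i))"
    using Parseval[OF e K_L2[OF basis_L2, of i]] by (simp add: eq)
qed

lemma eigenvalue_of_coefficients:
  assumes x: "summable (\<lambda>i. (x i)\<^sup>2)" "x j \<noteq> 0"
    and ev: "\<And>i. (\<lambda>l. L2_inner M (e i) (K (e l)) * x l) sums (c * x i)"
  shows "L2_eigenvalue M K c"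
proof -
  have on: "L2_inner M (e i) (e j) = (if i = j then 1 else 0)" for i j
    using e by (simp add: L2_orthonormal_basis_def)
  obtain g where g: "g \<in> L2 M" "\<And>i. L2_inner M (e i) g = x i"
    using Riesz_Fischer_coefficients[OF basis_L2 on x(1)] by blast
  have "L2_inner M (e i) (K g) = c * x i" for i
    using matrix_row_sums(1)[OF g(1), of i] ev[of i] g(2) by (simp add: sums_unique2)
  then have "\<forall>i. L2_inner M (e i) (\<lambda>y. K g y - c * g y) = 0"
    using g by (simp add: L2_inner_diff K_L2 L2_scale basis_L2 L2_inner_scale)
  then have "AE y in M. K g y - c * g y = 0"
    using e L2_diff[OF K_L2[OF g(1)] L2_scale[OF g(1)], of c]
    unfolding L2_orthonormal_basis_def by blast
  then have "AE y in M. K g y = c * g y" by simp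
  moreover have "\<not> (AE y in M. g y = 0)"
  proof
    assume "AE y in M. g y = 0"
    then have "L2_inner M (e j) g = L2_inner M (e j) (\<lambda>_. 0)"
      using L2_measurable[OF g(1)] L2_measurable[OF basis_L2] by (intro L2_inner_cong_AE) auto
    then show False using x(2) g(2) by (simp add: L2_inner_def)
  qed
  ultimately show ?thesis using g(1) unfolding L2_eigenvalue_def by blast
qed

lemma coefficients_of_eigenvalue:
  assumes "L2_eigenvalue M K c"
  obtains x j where "summable (\<lambda>i. (x i)\<^sup>2)" "x j \<noteq> 0"
    "\<And>i. (\<lambda>l. L2_inner M (e i) (K (e l)) * x l) sums (c * x i)"
proof -
  obtain g where g: "g \<in> L2 M" "\<not> (AE y in M. g y = 0)" "AE y in M. K g y = c * g y"
    using assms unfolding L2_eigenvalue_def by blast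
  have "L2_inner M (e i) (K g) = c * L2_inner M (e i) g" for i
  proof -
    have "L2_inner M (e i) (K g) = L2_inner M (e i) (\<lambda>y. c * g y)"
      using g L2_measurable[OF K_L2[OF g(1)]] L2_measurable[OF g(1)] L2_measurable[OF basis_L2]
      by (intro L2_inner_cong_AE) auto
    then show ?thesis by (simp add: L2_inner_scale)
  qed
  then have "(\<lambda>l. L2_inner M (e i) (K (e l)) * L2_inner M (e l) g) sums (c * L2_inner M (e i) g)" for i
    using matrix_row_sums(1)[OF g(1), of i] by simp
  moreover obtain j where "L2_inner M (e j) g \<noteq> 0"
    using g e unfolding L2_orthonormal_basis_def by blast
  moreover have "summable (\<lambda>i. (L2_inner M (e i) g)\<^sup>2)"
    using Parseval[OF e g(1)] by (simp add: sums_iff)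
  ultimately show thesis using that[of "\<lambda>i. L2_inner M (e i) g"] by blast
qed

end

end

section \<open>Spectral decomposition of real symmetric matrices\<close>

text \<open>
  Vectors of all lengths live in one type: a vector of length \<open>N\<close> is also one of length \<open>N + 1\<close>,
  which makes matrices of different size comparable without embeddings.
\<close>

definition fvec :: "nat \<Rightarrow> (nat \<Rightarrow> real) set" where
  "fvec N = {x. \<forall>i\<ge>N. x i = 0}"

definition dotp :: "nat \<Rightarrow> (nat \<Rightarrow> real) \<Rightarrow> (nat \<Rightarrow> real) \<Rightarrow> real" where
  "dotp N x y = (\<Sum>i<N. x i * y i)"

definition appl :: "nat \<Rightarrow> (nat \<Rightarrow> nat \<Rightarrow> real) \<Rightarrow> (nat \<Rightarrow> real) \<Rightarrow> nat \<Rightarrow> real" where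
  "appl N a x i = (if i < N then \<Sum>j<N. a i j * x j else 0)"

lemma dotp_commute: "dotp N x y = dotp N y x"
  by (simp add: dotp_def mult.commute)

lemma dotp_add: "dotp N x (\<lambda>i. y i + z i) = dotp N x y + dotp N x z"
  by (simp add: dotp_def distrib_left sum.distrib)

lemma dotp_add_left: "dotp N (\<lambda>i. y i + z i) x = dotp N y x + dotp N z x"
  by (simp add: dotp_def distrib_right sum.distrib)

lemma dotp_diff: "dotp N x (\<lambda>i. y i - z i) = dotp N x y - dotp N x z"
  by (simp add: dotp_def right_diff_distrib sum_subtractf)

lemma dotp_scale: "dotp N x (\<lambda>i. c * y i) = c * dotp N x y"
  by (simp add: dotp_def sum_distrib_left mult.left_commute)

lemma dotp_scale_left: "dotp N (\<lambda>i. c * y i) x = c * dotp N y x"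
  by (simp add: dotp_def sum_distrib_left mult.assoc)

lemma dotp_sum: "dotp N x (\<lambda>i. \<Sum>l\<in>L. f l i) = (\<Sum>l\<in>L. dotp N x (f l))"
  unfolding dotp_def sum_distrib_left by (rule sum.swap)

lemma dotp_self_nonneg: "0 \<le> dotp N x x"
  by (simp add: dotp_def sum_nonneg)

lemma dotp_self_eq_0:
  assumes "x \<in> fvec N" "dotp N x x = 0"
  shows "x = (\<lambda>_. 0)"
proof
  fix i
  have "\<forall>i\<in>{..<N}. x i * x i = 0"
    using assms(2) unfolding dotp_def by (subst (asm) sum_nonneg_eq_0_iff) auto
  then show "x i = 0" using assms(1) by (cases "i < N") (auto simp: fvec_def)
qed

lemma appl_add: "appl N a (\<lambda>i. x i + y i) = (\<lambda>i. appl N a x i + appl N a y i)"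
  by (auto simp: fun_eq_iff appl_def distrib_left sum.distrib)

lemma appl_scale: "appl N a (\<lambda>i. c * x i) = (\<lambda>i. c * appl N a x i)"
  by (auto simp: fun_eq_iff appl_def sum_distrib_left mult.left_commute)

lemma appl_sum: "appl N a (\<lambda>i. \<Sum>l\<in>L. f l i) = (\<lambda>i. \<Sum>l\<in>L. appl N a (f l) i)"
  by (auto simp: fun_eq_iff appl_def sum_distrib_left intro: sum.swap)

lemma appl_fvec: "appl N a x \<in> fvec N"
  by (simp add: fvec_def appl_def)

lemma dotp_appl: "dotp N x (appl N a y) = (\<Sum>i<N. \<Sum>j<N. x i * a i j * y j)"
  by (simp add: dotp_def appl_def sum_distrib_left mult.assoc)

lemma dotp_appl_sym:
  assumes "\<And>i j. a i j = a j i"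
  shows "dotp N x (appl N a y) = dotp N (appl N a x) y"
proof -
  have "dotp N x (appl N a y) = (\<Sum>j<N. \<Sum>i<N. x i * a i j * y j)"
    unfolding dotp_appl by (rule sum.swap)
  also have "\<dots> = dotp N y (appl N a x)"
    unfolding dotp_appl by (intro sum.cong refl) (metis assms mult.commute mult.assoc)
  finally show ?thesis by (simp add: dotp_commute)
qed

text \<open>
  The first \<open>m\<close> members of an orthonormal system of eigenvectors, each maximizing the quadratic form
  among the vectors orthogonal to its predecessors. The maximum property is part of the definition
  because it is one half of the min-max principle.
\<close>

definition spectral_system ::
  "nat \<Rightarrow> (nat \<Rightarrow> nat \<Rightarrow> real) \<Rightarrow> nat \<Rightarrow> (nat \<Rightarrow> real) \<Rightarrow> (nat \<Rightarrow> nat \<Rightarrow> real) \<Rightarrow> bool" where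
  "spectral_system N a m \<mu> v \<longleftrightarrow>
     (\<forall>k<m. v k \<in> fvec N \<and> appl N a (v k) = (\<lambda>i. \<mu> k * v k i) \<and>
        (\<forall>l<m. dotp N (v k) (v l) = (if k = l then 1 else 0)) \<and>
        (\<forall>x\<in>fvec N. (\<forall>l<k. dotp N (v l) x = 0) \<longrightarrow>
            dotp N x (appl N a x) \<le> \<mu> k * dotp N x x))"

lemma continuous_on_coordinate[continuous_intros]:
  "continuous_on S (\<lambda>x::nat \<Rightarrow> real. x i)"
  by (rule continuous_on_subset[OF continuous_on_product_coordinates]) simp

text \<open>
  Padding the system with zero equations makes it square and singular.
\<close>

lemma underdetermined_system:
  fixes r :: "nat \<Rightarrow> nat \<Rightarrow> real"
  assumes "k < n"
  obtains c where "c \<in> fvec n" "c \<noteq> (\<lambda>_. 0)" "\<And>l. l < k \<Longrightarrow> (\<Sum>j<n. r l j * c j) = 0"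
proof -
  define A where "A = Matrix.mat n n (\<lambda>(i, j). if i < k then r i j else 0)"
  have A: "A \<in> carrier_mat n n" by (simp add: A_def)
  have "A = mat\<^sub>r n n (\<lambda>i. if i = k then 0\<^sub>v n else Matrix.row A i)"
    using assms by (intro eq_matI) (auto simp: A_def)
  moreover have "Determinant.det (mat\<^sub>r n n (\<lambda>i. if i = k then 0\<^sub>v n else Matrix.row A i)) = 0"
    by (rule det_row_0[OF assms]) (auto simp: A_def)
  ultimately have "Determinant.det A = 0" by simp
  then obtain w where w: "w \<in> carrier_vec n" "w \<noteq> 0\<^sub>v n" "A *\<^sub>v w = 0\<^sub>v n"
    using det_0_iff_vec_prod_zero_field[OF A] by blast
  define c where "c = (\<lambda>j. if j < n then w $ j else 0)"
  have "(\<Sum>j<n. r l j * c j) = 0" if "l < k" for l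
  proof -
    have "(A *\<^sub>v w) $ l = (\<Sum>j<n. r l j * c j)"
      using that assms w(1)
      by (auto simp: A_def scalar_prod_def c_def lessThan_atLeast0 intro!: sum.cong)
    then show ?thesis using w(3) that assms by simp
  qed
  moreover have "c \<noteq> (\<lambda>_. 0)"
  proof
    assume "c = (\<lambda>_. 0)"
    then have "w $ j = 0" if "j < n" for j
    proof -
      have "w $ j = c j" using that by (simp add: c_def)
      then show ?thesis by (simp add: \<open>c = (\<lambda>_. 0)\<close>)
    qed
    then have "w = 0\<^sub>v n" using w(1) by (intro eq_vecI) auto
    then show False using w(2) by simp
  qed
  ultimately show thesis by (intro that[of c]) (auto simp: fvec_def c_def)
qed

lemma max_quadratic_form:
  assumes m: "m < N"
  obtains y where "y \<in> fvec N" "dotp N y y = 1" "\<And>l. l < m \<Longrightarrow> dotp N (v l) y = 0"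
    "\<And>x. x \<in> fvec N \<Longrightarrow> dotp N x x = 1 \<Longrightarrow> (\<And>l. l < m \<Longrightarrow> dotp N (v l) x = 0) \<Longrightarrow>
       dotp N x (appl N a x) \<le> dotp N y (appl N a y)"
proof -
  define B where "B = PiE (UNIV::nat set) (\<lambda>i. if i < N then {-1..1::real} else {0})"
  define S where "S = B \<inter> {x. dotp N x x = 1} \<inter> (\<Inter>l<m. {x. dotp N (v l) x = 0})"
  have "compact B"
  proof -
    have "compactin (product_topology (\<lambda>i::nat. euclidean) UNIV) B"
      unfolding B_def by (subst compactin_PiE) auto
    then show ?thesis by (simp add: euclidean_product_topology)
  qed
  moreover have "closed {x. dotp N x x = 1}"
    unfolding dotp_def by (intro closed_Collect_eq continuous_intros)
  moreover have "closed (\<Inter>l<m. {x. dotp N (v l) x = 0})"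
    unfolding dotp_def by (intro closed_INT ballI closed_Collect_eq continuous_intros)
  ultimately have "compact S" unfolding S_def by (intro compact_Int_closed)
  have S_iff: "x \<in> S \<longleftrightarrow> x \<in> fvec N \<and> dotp N x x = 1 \<and> (\<forall>l<m. dotp N (v l) x = 0)" for x
  proof -
    have "\<bar>x i\<bar> \<le> 1" if "dotp N x x = 1" "i < N" for i
    proof -
      have "x i * x i \<le> (\<Sum>i<N. x i * x i)"
        using that(2) by (intro member_le_sum) auto
      then have "(x i)\<^sup>2 \<le> 1" using that(1) by (simp add: dotp_def power2_eq_square)
      then show ?thesis by (simp add: abs_square_le_1)
    qed
    moreover have "x \<in> B \<longleftrightarrow> (\<forall>i<N. \<bar>x i\<bar> \<le> 1) \<and> (\<forall>i\<ge>N. x i = 0)"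
      unfolding B_def PiE_iff by (force simp: abs_le_iff not_less)
    ultimately show ?thesis
      unfolding S_def fvec_def by blast
  qed
  have "S \<noteq> {}"
  proof -
    obtain c where c: "c \<in> fvec N" "c \<noteq> (\<lambda>_. 0)" "\<And>l. l < m \<Longrightarrow> (\<Sum>j<N. v l j * c j) = 0"
      using underdetermined_system[OF m, of v] by blast
    have pos: "0 < dotp N c c"
      using dotp_self_nonneg[of N c] dotp_self_eq_0[OF c(1)] c(2) by fastforce
    define t where "t = 1 / sqrt (dotp N c c)"
    have "t * (t * dotp N c c) = 1" using pos by (simp add: t_def)
    then have "dotp N (\<lambda>i. t * c i) (\<lambda>i. t * c i) = 1"
      by (simp only: dotp_scale dotp_scale_left)
    moreover have "dotp N (v l) (\<lambda>i. t * c i) = 0" if "l < m" for l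
      using c(3)[OF that] by (simp only: dotp_scale) (simp add: dotp_def)
    moreover have "(\<lambda>i. t * c i) \<in> fvec N" using c(1) by (simp add: fvec_def)
    ultimately have "(\<lambda>i. t * c i) \<in> S"
      unfolding S_iff by blast
    then show ?thesis by blast
  qed
  moreover have "continuous_on S (\<lambda>x. dotp N x (appl N a x))"
    unfolding dotp_appl by (intro continuous_intros)
  ultimately obtain y where "y \<in> S" "\<And>x. x \<in> S \<Longrightarrow> dotp N x (appl N a x) \<le> dotp N y (appl N a y)"
    using continuous_attains_sup[OF \<open>compact S\<close>] by blast
  then show thesis using that[of y] unfolding S_iff by blast
qed

text \<open>
  The first-order condition at a maximum: a quadratic without constant term that never becomes negative
  has no linear term.
\<close>

lemma linear_quadratic_nonneg:
  fixes b c :: real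
  assumes "\<And>t. 0 \<le> t * b + t\<^sup>2 * c"
  shows "b = 0"
proof (rule ccontr)
  assume b: "b \<noteq> 0"
  define s where "s = \<bar>c\<bar> + 1"
  have s: "0 < s" "\<bar>c\<bar> < s" by (auto simp: s_def)
  \<comment> \<open>a point so close to \<open>0\<close> that the linear term dominates\<close>
  have "0 \<le> (- b / s) * b + (- b / s)\<^sup>2 * c" by (rule assms)
  also have "\<dots> = (b\<^sup>2 / s) * (c / s - 1)"
    using s by (simp add: field_simps power2_eq_square)
  also have "\<dots> < 0"
    using b s by (intro mult_pos_neg) (auto simp: field_simps)
  finally show False by simp
qed

text \<open>
  A maximizer \<open>y\<close> on the unit sphere of the orthogonal complement is an eigenvector: moving it along
  the residual \<open>w = a y - c y\<close>, which also lies in the complement, changes the quadratic form to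
  first order by the squared norm of \<open>w\<close>.
\<close>

lemma spectral_system_extend:
  assumes sym: "\<And>i j. a i j = a j i" and m: "m < N" and sys: "spectral_system N a m \<mu> v"
  obtains c y where "spectral_system N a (Suc m) (\<mu>(m := c)) (v(m := y))"
proof -
  obtain y where y: "y \<in> fvec N" "dotp N y y = 1" "\<And>l. l < m \<Longrightarrow> dotp N (v l) y = 0"
    and max: "\<And>x. x \<in> fvec N \<Longrightarrow> dotp N x x = 1 \<Longrightarrow> (\<And>l. l < m \<Longrightarrow> dotp N (v l) x = 0) \<Longrightarrow>
       dotp N x (appl N a x) \<le> dotp N y (appl N a y)"
    using max_quadratic_form[OF m, of v a] by blast
  define c where "c = dotp N y (appl N a y)"
  have vk: "v k \<in> fvec N" "appl N a (v k) = (\<lambda>i. \<mu> k * v k i)" if "k < m" for k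
    using sys that by (auto simp: spectral_system_def)
  have le: "dotp N x (appl N a x) \<le> c * dotp N x x"
    if x: "x \<in> fvec N" "\<And>l. l < m \<Longrightarrow> dotp N (v l) x = 0" for x
  proof (cases "dotp N x x = 0")
    case True
    then have "x = (\<lambda>_. 0)" by (rule dotp_self_eq_0[OF x(1)])
    then show ?thesis by (simp add: dotp_def)
  next
    case False
    then have pos: "0 < dotp N x x" using dotp_self_nonneg[of N x] by simp
    define t where "t = 1 / sqrt (dotp N x x)"
    have t: "t * t * dotp N x x = 1" using pos by (simp add: t_def real_sqrt_mult_self)
    have "dotp N (\<lambda>i. t * x i) (appl N a (\<lambda>i. t * x i)) \<le> c"
      unfolding c_def using x t
      by (intro max) (auto simp: fvec_def dotp_scale dotp_scale_left)
    then have "t * t * dotp N x (appl N a x) \<le> c"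
      by (simp add: appl_scale dotp_scale dotp_scale_left mult.assoc)
    then have "t * t * dotp N x (appl N a x) * dotp N x x \<le> c * dotp N x x"
      using pos by (intro mult_right_mono) auto
    moreover have "t * t * dotp N x (appl N a x) * dotp N x x = dotp N x (appl N a x)"
      using t by (metis (no_types) mult.assoc mult.commute mult_1)
    ultimately show ?thesis by simp
  qed
  define w where "w = (\<lambda>i. appl N a y i - c * y i)"
  have wN: "w \<in> fvec N" using y(1) appl_fvec[of N a y] by (simp add: w_def fvec_def)
  have orth: "dotp N (v l) w = 0" if "l < m" for l
  proof -
    have "dotp N (v l) (appl N a y) = \<mu> l * dotp N (v l) y"
      using dotp_appl_sym[of a N "v l" y, OF sym] vk[OF that] by (simp add: dotp_scale_left)
    then show ?thesis using y(3)[OF that] by (simp add: w_def dotp_diff dotp_scale)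
  qed
  have "2 * dotp N w w = 0"
  proof (rule linear_quadratic_nonneg)
    fix t :: real
    define x where "x = (\<lambda>i. y i + (- t) * w i)"
    have "x \<in> fvec N" using y(1) wN by (simp add: x_def fvec_def)
    moreover have "dotp N (v l) x = 0" if "l < m" for l
      unfolding x_def dotp_add dotp_scale using orth[OF that] y(3)[OF that] by simp
    ultimately have "dotp N x (appl N a x) \<le> c * dotp N x x" by (rule le)
    moreover have "dotp N x (appl N a x) = c + 2 * (- t) * dotp N w (appl N a y) + t\<^sup>2 * dotp N w (appl N a w)"
      unfolding x_def appl_add appl_scale dotp_add dotp_scale dotp_add_left dotp_scale_left c_def
      using dotp_appl_sym[of a N y w, OF sym]
      by (simp add: dotp_commute[of N "appl N a y"] algebra_simps power2_eq_square)
    moreover have "dotp N x x = 1 + 2 * (- t) * dotp N w y + t\<^sup>2 * dotp N w w"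
      unfolding x_def dotp_add dotp_scale dotp_add_left dotp_scale_left
      by (simp add: y dotp_commute[of N y w] algebra_simps power2_eq_square)
    moreover have "dotp N w (appl N a y) = dotp N w w + c * dotp N w y"
    proof -
      have "dotp N w w = dotp N w (appl N a y) - c * dotp N w y"
        by (subst (2) w_def) (simp add: dotp_diff dotp_scale)
      then show ?thesis by simp
    qed
    ultimately show "0 \<le> t * (2 * dotp N w w) + t\<^sup>2 * (c * dotp N w w - dotp N w (appl N a w))"
      by (simp add: algebra_simps)
  qed
  then have "w = (\<lambda>_. 0)" using dotp_self_eq_0[OF wN] by simp
  then have ev: "appl N a y = (\<lambda>i. c * y i)" by (auto simp: w_def fun_eq_iff)
  have "spectral_system N a (Suc m) (\<mu>(m := c)) (v(m := y))"
    unfolding spectral_system_def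
  proof (intro allI impI conjI ballI)
    fix k assume k: "k < Suc m"
    show "(v(m := y)) k \<in> fvec N" using k vk y(1) by (cases "k = m") auto
    show "appl N a ((v(m := y)) k) = (\<lambda>i. (\<mu>(m := c)) k * (v(m := y)) k i)"
      using k vk ev by (cases "k = m") auto
    fix l assume l: "l < Suc m"
    show "dotp N ((v(m := y)) k) ((v(m := y)) l) = (if k = l then 1 else 0)"
    proof (cases "k = m"; cases "l = m")
      assume "k \<noteq> m" "l \<noteq> m"
      then show ?thesis using k l sys unfolding spectral_system_def by auto
    next
      assume "k \<noteq> m" "l = m"
      then show ?thesis using k y(3) by simp
    next
      assume "k = m" "l \<noteq> m"
      then show ?thesis using l y(3) dotp_commute[of N y "v l"] by simp
    qed (use y(2) in simp)
  next
    fix k x assume k: "k < Suc m" and x: "x \<in> fvec N" "\<forall>l<k. dotp N ((v(m := y)) l) x = 0"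
    show "dotp N x (appl N a x) \<le> (\<mu>(m := c)) k * dotp N x x"
    proof (cases "k = m")
      case True
      with x have "dotp N (v l) x = 0" if "l < m" for l using that by (metis fun_upd_other nat_neq_iff)
      with True show ?thesis using le[OF x(1)] by simp
    next
      case False
      with k have "k < m" by simp
      moreover have "\<forall>l<k. dotp N (v l) x = 0" using x(2) \<open>k < m\<close> by auto
      ultimately show ?thesis using sys x(1) unfolding spectral_system_def by simp
    qed
  qed
  then show thesis by (rule that)
qed

lemma spectral_system_exists:
  assumes "\<And>i j. a i j = a j i" and "m \<le> N"
  obtains \<mu> v where "spectral_system N a m \<mu> v"
proof -
  have "\<exists>\<mu> v. spectral_system N a m \<mu> v"
    using assms(2)
  proof (induction m)
    case 0
    show ?case by (simp add: spectral_system_def)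
  next
    case (Suc m)
    then obtain \<mu> v where "spectral_system N a m \<mu> v" by auto
    with Suc.prems show ?case using spectral_system_extend[where a = a, OF assms(1), where m = m and N = N and \<mu> = \<mu> and v = v] by (metis Suc_le_eq)
  qed
  then show thesis using that by blast
qed

lemma spectral_systemD:
  assumes "spectral_system N a m \<mu> v" "k < m"
  shows "v k \<in> fvec N" "appl N a (v k) = (\<lambda>i. \<mu> k * v k i)"
    "\<And>l. l < m \<Longrightarrow> dotp N (v k) (v l) = (if k = l then 1 else 0)"
    "\<And>x. x \<in> fvec N \<Longrightarrow> (\<And>l. l < k \<Longrightarrow> dotp N (v l) x = 0) \<Longrightarrow>
       dotp N x (appl N a x) \<le> \<mu> k * dotp N x x"
  using assms unfolding spectral_system_def by auto

lemma spectral_system_decreasing: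
  assumes sys: "spectral_system N a m \<mu> v" and kl: "k \<le> l" "l < m"
  shows "\<mu> l \<le> \<mu> k"
proof -
  note l = spectral_systemD[OF sys kl(2)]
  have "dotp N (v l) (appl N a (v l)) \<le> \<mu> k * dotp N (v l) (v l)"
    using kl spectral_systemD(3)[OF sys _ kl(2)]
    by (intro spectral_systemD(4)[OF sys] l(1)) auto
  then show ?thesis using l(3)[OF kl(2)] by (simp add: l(2) dotp_scale)
qed

lemma spectral_system_complete:
  assumes sys: "spectral_system N a N \<mu> v" and ij: "i < N" "j < N"
  shows "(\<Sum>k<N. v k i * v k j) = (if i = j then 1 else 0)"
proof -
  define V where "V = Matrix.mat N N (\<lambda>(i, k). v k i)"
  have V: "V \<in> carrier_mat N N" by (simp add: V_def)
  have "V\<^sup>T * V = 1\<^sub>m N"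
    using spectral_systemD(3)[OF sys]
    by (intro eq_matI) (auto simp: V_def scalar_prod_def dotp_def lessThan_atLeast0)
  then have "V * V\<^sup>T = 1\<^sub>m N"
    using mat_mult_left_right_inverse[of "V\<^sup>T" N V] V by simp
  then have "(V * V\<^sup>T) $$ (i, j) = (if i = j then 1 else 0)" using ij by simp
  then show ?thesis using ij by (simp add: V_def scalar_prod_def lessThan_atLeast0)
qed

lemma spectral_system_matrix:
  assumes sys: "spectral_system N a N \<mu> v" and ij: "i < N" "j < N"
  shows "a i j = (\<Sum>k<N. \<mu> k * v k i * v k j)"
proof -
  have "(\<Sum>k<N. \<mu> k * v k i * v k j) = (\<Sum>k<N. (\<Sum>l<N. a i l * v k l) * v k j)"
  proof (intro sum.cong refl)
    fix k assume "k \<in> {..<N}"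
    then have "appl N a (v k) i = \<mu> k * v k i" using spectral_systemD(2)[OF sys] by simp
    then show "\<mu> k * v k i * v k j = (\<Sum>l<N. a i l * v k l) * v k j"
      using ij by (simp add: appl_def)
  qed
  also have "\<dots> = (\<Sum>l<N. a i l * (\<Sum>k<N. v k l * v k j))"
    unfolding sum_distrib_left sum_distrib_right mult.assoc by (rule sum.swap)
  also have "\<dots> = (\<Sum>l<N. a i l * (if l = j then 1 else 0))"
    using spectral_system_complete[OF sys _ ij(2)] by (intro sum.cong refl) simp
  also have "\<dots> = a i j" using ij by (simp add: if_distrib cong: if_cong)
  finally show ?thesis ..
qed

lemma spectral_system_row:
  assumes sys: "spectral_system N a N \<mu> v" and "k < N" "i < N"
  shows "(\<Sum>l<N. a i l * v k l) = \<mu> k * v k i"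
  using fun_cong[OF spectral_systemD(2)[OF sys assms(2)], of i] assms(3) by (simp add: appl_def)

lemma trace_square:
  assumes sys: "spectral_system N a N \<mu> v"
  shows "(\<Sum>i<N. \<Sum>j<N. (a i j)\<^sup>2) = (\<Sum>k<N. (\<mu> k)\<^sup>2)"
proof -
  have "(a i j)\<^sup>2 = (\<Sum>k<N. a i j * (\<mu> k * v k i * v k j))" if "i < N" "j < N" for i j
    by (simp add: power2_eq_square spectral_system_matrix[OF sys that, symmetric] sum_distrib_left[symmetric])
  then have "(\<Sum>i<N. \<Sum>j<N. (a i j)\<^sup>2) = (\<Sum>i<N. \<Sum>j<N. \<Sum>k<N. a i j * (\<mu> k * v k i * v k j))"
    by (simp cong: sum.cong_simp)
  also have "\<dots> = (\<Sum>i<N. \<Sum>k<N. \<Sum>j<N. a i j * (\<mu> k * v k i * v k j))"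
    by (rule sum.cong[OF refl], rule sum.swap)
  also have "\<dots> = (\<Sum>k<N. \<Sum>i<N. \<Sum>j<N. a i j * (\<mu> k * v k i * v k j))"
    by (rule sum.swap)
  also have "\<dots> = (\<Sum>k<N. (\<mu> k)\<^sup>2)"
  proof (intro sum.cong refl)
    fix k assume "k \<in> {..<N}"
    then have k: "k < N" by simp
    have "(\<Sum>i<N. \<Sum>j<N. a i j * (\<mu> k * v k i * v k j))
      = (\<Sum>i<N. \<mu> k * v k i * (\<Sum>j<N. a i j * v k j))"
      by (simp add: sum_distrib_left ac_simps)
    also have "\<dots> = (\<Sum>i<N. (\<mu> k)\<^sup>2 * (v k i * v k i))"
      by (intro sum.cong refl) (simp add: spectral_system_row[OF sys k] power2_eq_square ac_simps)
    also have "\<dots> = (\<mu> k)\<^sup>2 * dotp N (v k) (v k)" by (simp add: dotp_def sum_distrib_left)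
    finally show "(\<Sum>i<N. \<Sum>j<N. a i j * (\<mu> k * v k i * v k j)) = (\<mu> k)\<^sup>2"
      using spectral_systemD(3)[OF sys k k] by simp
  qed
  finally show ?thesis .
qed

lemma trace_cube:
  assumes sys: "spectral_system N a N \<mu> v"
  shows "(\<Sum>i<N. \<Sum>m<N. \<Sum>l<N. a i m * a m l * a l i) = (\<Sum>k<N. \<mu> k ^ 3)"
proof -
  have "a i m * a m l * a l i = (\<Sum>k<N. a i m * a m l * (\<mu> k * v k l * v k i))"
    if "i < N" "l < N" for i m l
    by (simp add: spectral_system_matrix[OF sys that(2,1), symmetric] sum_distrib_left[symmetric])
  then have "(\<Sum>i<N. \<Sum>m<N. \<Sum>l<N. a i m * a m l * a l i)
      = (\<Sum>i<N. \<Sum>m<N. \<Sum>l<N. \<Sum>k<N. a i m * a m l * (\<mu> k * v k l * v k i))"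
    by (simp cong: sum.cong_simp)
  also have "\<dots> = (\<Sum>i<N. \<Sum>m<N. \<Sum>k<N. \<Sum>l<N. a i m * a m l * (\<mu> k * v k l * v k i))"
    by (rule sum.cong[OF refl], rule sum.cong[OF refl], rule sum.swap)
  also have "\<dots> = (\<Sum>i<N. \<Sum>k<N. \<Sum>m<N. \<Sum>l<N. a i m * a m l * (\<mu> k * v k l * v k i))"
    by (rule sum.cong[OF refl], rule sum.swap)
  also have "\<dots> = (\<Sum>k<N. \<Sum>i<N. \<Sum>m<N. \<Sum>l<N. a i m * a m l * (\<mu> k * v k l * v k i))"
    by (rule sum.swap)
  also have "\<dots> = (\<Sum>k<N. \<mu> k ^ 3)"
  proof (intro sum.cong refl)
    fix k assume "k \<in> {..<N}"
    then have k: "k < N" by simp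
    have "(\<Sum>i<N. \<Sum>m<N. \<Sum>l<N. a i m * a m l * (\<mu> k * v k l * v k i))
      = (\<Sum>i<N. \<mu> k * v k i * (\<Sum>m<N. a i m * (\<Sum>l<N. a m l * v k l)))"
      by (simp add: sum_distrib_left ac_simps)
    also have "\<dots> = (\<Sum>i<N. \<mu> k ^ 3 * (v k i * v k i))"
    proof (rule sum.cong[OF refl])
      fix i assume "i \<in> {..<N}"
      have "(\<Sum>m<N. a i m * (\<Sum>l<N. a m l * v k l)) = (\<Sum>m<N. \<mu> k * (a i m * v k m))"
        by (rule sum.cong[OF refl]) (simp add: spectral_system_row[OF sys k])
      also have "\<dots> = \<mu> k * (\<mu> k * v k i)"
        using \<open>i \<in> {..<N}\<close> by (simp add: spectral_system_row[OF sys k] flip: sum_distrib_left)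
      finally show "\<mu> k * v k i * (\<Sum>m<N. a i m * (\<Sum>l<N. a m l * v k l)) = \<mu> k ^ 3 * (v k i * v k i)"
        by (simp add: power3_eq_cube)
    qed
    also have "\<dots> = \<mu> k ^ 3 * dotp N (v k) (v k)" by (simp add: dotp_def sum_distrib_left)
    finally show "(\<Sum>i<N. \<Sum>m<N. \<Sum>l<N. a i m * a m l * (\<mu> k * v k l * v k i)) = \<mu> k ^ 3"
      using spectral_systemD(3)[OF sys k k] by simp
  qed
  finally show ?thesis .
qed

text \<open>
  Among the combinations of the first \<open>k + 1\<close> eigenvectors of the smaller matrix there is one that is
  orthogonal to the first \<open>k\<close> eigenvectors of the larger matrix. At this vector the two quadratic forms
  agree; the smaller matrix bounds it from below, the larger one from above.
\<close>

lemma spectral_system_interlacing: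
  assumes sys: "spectral_system N a m \<mu> v" and sys': "spectral_system N' a m' \<mu>' v'"
    and N: "N \<le> N'" and k: "k < m" "k < m'"
  shows "\<mu> k \<le> \<mu>' k"
proof -
  obtain c where c: "c \<in> fvec (Suc k)" "c \<noteq> (\<lambda>_. 0)"
    "\<And>l. l < k \<Longrightarrow> (\<Sum>j<Suc k. dotp N' (v' l) (v j) * c j) = 0"
    using underdetermined_system[of k "Suc k" "\<lambda>l j. dotp N' (v' l) (v j)"] by blast
  define x where "x = (\<lambda>i. \<Sum>j<Suc k. c j * v j i)"
  have vN: "v j \<in> fvec N" if "j < Suc k" for j
    using spectral_systemD(1)[OF sys, of j] that k by simp
  then have xN: "x \<in> fvec N" by (auto simp: x_def fvec_def)
  have dot_ext: "dotp N' y x = dotp N y x" for y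
    unfolding dotp_def using N xN
    by (intro sum.mono_neutral_right) (auto simp: fvec_def)
  have exta: "appl N' a x i = appl N a x i" if "i < N" for i
    unfolding appl_def using N xN that
    by (simp) (intro sum.mono_neutral_right, auto simp: fvec_def)
  have orth: "dotp N' (v' l) x = 0" if "l < k" for l
    using c(3)[OF that] unfolding x_def dotp_sum by (simp add: dotp_scale mult.commute)
  have vx: "dotp N (v j) x = c j" if "j < Suc k" for j
  proof -
    have "dotp N (v j) x = (\<Sum>l<Suc k. c l * dotp N (v j) (v l))"
      unfolding x_def dotp_sum by (simp only: dotp_scale)
    also have "\<dots> = (\<Sum>l<Suc k. c l * (if j = l then 1 else 0))"
      using spectral_systemD(3)[OF sys, of j] that k by (intro sum.cong refl) simp
    also have "\<dots> = c j" using that by (subst sum.cong[OF refl, where h = "\<lambda>l. if j = l then c l else 0"]) auto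
    finally show ?thesis .
  qed
  have xx: "dotp N x x = (\<Sum>j<Suc k. c j * c j)"
  proof -
    have "dotp N x x = (\<Sum>l<Suc k. c l * dotp N x (v l))"
      by (subst (2) x_def) (simp only: dotp_sum dotp_scale)
    then show ?thesis by (simp add: dotp_commute[of N x "v _"] vx del: sum.lessThan_Suc)
  qed
  have "dotp N x (appl N a x) = (\<Sum>l<Suc k. c l * (\<mu> l * dotp N x (v l)))"
  proof -
    have "appl N a x = (\<lambda>i. \<Sum>l<Suc k. c l * (\<mu> l * v l i))"
      unfolding x_def appl_sum appl_scale
    proof (rule ext, rule sum.cong[OF refl])
      fix i j assume "j \<in> {..<Suc k}"
      then have "appl N a (v j) = (\<lambda>i. \<mu> j * v j i)"
        using spectral_systemD(2)[OF sys, of j] k by simp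
      then show "c j * appl N a (v j) i = c j * (\<mu> j * v j i)" by simp
    qed
    then show ?thesis by (simp only: dotp_sum dotp_scale)
  qed
  also have "\<dots> = (\<Sum>l<Suc k. \<mu> l * (c l * c l))"
    by (simp add: dotp_commute[of N x "v _"] vx ac_simps del: sum.lessThan_Suc)
  also have "\<dots> \<ge> (\<Sum>l<Suc k. \<mu> k * (c l * c l))"
    using spectral_system_decreasing[OF sys _ k(1)] by (intro sum_mono mult_right_mono) auto
  finally have "\<mu> k * dotp N x x \<le> dotp N x (appl N a x)"
    unfolding xx by (simp only: sum_distrib_left)
  also have "\<dots> = dotp N' x (appl N' a x)"
  proof -
    have "dotp N (appl N a x) x = dotp N (appl N' a x) x"
      unfolding dotp_def using exta by simp
    also have "\<dots> = dotp N' (appl N' a x) x" by (rule dot_ext[symmetric])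
    finally show ?thesis by (simp only: dotp_commute[of _ "appl _ a x" x])
  qed
  also have "\<dots> \<le> \<mu>' k * dotp N' x x"
    using xN N orth by (intro spectral_systemD(4)[OF sys' k(2)]) (auto simp: fvec_def)
  also have "dotp N' x x = dotp N x x" by (rule dot_ext)
  finally have "\<mu> k * dotp N x x \<le> \<mu>' k * dotp N x x" .
  moreover have "0 < dotp N x x"
  proof -
    obtain j where "c j \<noteq> 0" using c(2) by auto
    moreover from this have "j < Suc k"
      using c(1) unfolding fvec_def by (metis (mono_tags, lifting) mem_Collect_eq not_less)
    ultimately show ?thesis
      unfolding xx by (intro sum_pos2[of _ j]) (auto simp: zero_less_mult_iff)
  qed
  ultimately show ?thesis by simp
qed

lemma proots_linear_factors: "proots (\<Prod>b\<leftarrow>xs. [:- b, 1:]) = mset (xs :: real list)"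
proof (induction xs)
  case (Cons b xs)
  have "(\<Prod>b\<leftarrow>xs. [:- b, 1:]) \<noteq> (0 :: real poly)" by (auto simp: prod_list_zero_iff)
  then have "proots ([:- b, 1:] * (\<Prod>b\<leftarrow>xs. [:- b, 1:])) = {#b#} + mset xs"
    using Cons.IH by (subst proots_mult) (auto simp del: mult_pCons_left)
  then show ?case by (simp del: mult_pCons_left)
qed simp

text \<open>
  The matrix is orthogonally similar to the diagonal matrix of the \<open>\<mu> k\<close>, and these are already in
  decreasing order.
\<close>

lemma eigenvalues_desc_eq:
  assumes sys: "spectral_system N a N \<mu> v"
  shows "eigenvalues_desc (Matrix.mat N N (\<lambda>(i, j). a i j)) = map \<mu> [0..<N]"
proof -
  define A where "A = Matrix.mat N N (\<lambda>(i, j). a i j)"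
  define V where "V = Matrix.mat N N (\<lambda>(i, k). v k i)"
  define D where "D = Matrix.mat N N (\<lambda>(i, k). if i = k then \<mu> k else 0)"
  have car: "A \<in> carrier_mat N N" "V \<in> carrier_mat N N" "D \<in> carrier_mat N N"
    by (simp_all add: A_def V_def D_def)
  have VV: "V\<^sup>T * V = 1\<^sub>m N"
    using spectral_systemD(3)[OF sys]
    by (intro eq_matI) (auto simp: V_def scalar_prod_def dotp_def lessThan_atLeast0)
  have VV': "V * V\<^sup>T = 1\<^sub>m N"
    using mat_mult_left_right_inverse[of "V\<^sup>T" N V] car VV by simp
  have "A = V * D * V\<^sup>T"
  proof (rule eq_matI)
    fix i j assume "i < dim_row (V * D * V\<^sup>T)" "j < dim_col (V * D * V\<^sup>T)"
    then have ij: "i < N" "j < N" by (simp_all add: V_def)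
    have VD: "(V * D) $$ (i, k) = \<mu> k * v k i" if "k < N" for k
      using that ij(1) by (simp add: V_def D_def scalar_prod_def if_distrib cong: if_cong)
    have "(V * D * V\<^sup>T) $$ (i, j) = (\<Sum>k = 0..<N. (V * D) $$ (i, k) * v k j)"
      using ij car by (simp add: scalar_prod_def V_def)
    also have "\<dots> = (\<Sum>k<N. \<mu> k * v k i * v k j)"
      by (simp add: VD lessThan_atLeast0)
    finally show "A $$ (i, j) = (V * D * V\<^sup>T) $$ (i, j)"
      using spectral_system_matrix[OF sys ij] ij by (simp add: A_def)
  qed (simp_all add: A_def V_def)
  then have "similar_mat A D"
    using car VV VV' unfolding similar_mat_def similar_mat_wit_def
    by (intro exI[of _ V] exI[of _ "V\<^sup>T"]) (simp add: Let_def)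
  then have "char_poly A = char_poly D" by (rule char_poly_similar)
  also have "\<dots> = (\<Prod>b\<leftarrow>diag_mat D. [:- b, 1:])"
    by (rule char_poly_upper_triangular[OF car(3)]) (auto simp: D_def)
  also have "diag_mat D = map \<mu> [0..<N]"
    by (simp add: diag_mat_def D_def)
  finally have "proots (char_poly A) = mset (map \<mu> [0..<N])"
    by (simp only: proots_linear_factors)
  moreover have "sort (map \<mu> [0..<N]) = rev (map \<mu> [0..<N])"
  proof (rule properties_for_sort)
    have "sorted_wrt (\<ge>) (map \<mu> [0..<N])"
      using spectral_system_decreasing[OF sys] by (auto simp: sorted_wrt_iff_nth_less)
    then show "sorted (rev (map \<mu> [0..<N]))" by (simp add: sorted_wrt_rev)
  qed simp
  ultimately have "rev (sorted_list_of_multiset (proots (char_poly A))) = map \<mu> [0..<N]"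
    by (simp only: sorted_list_of_multiset_mset rev_rev_ident)
  then show ?thesis by (simp only: eigenvalues_desc_def A_def)
qed

definition mat_ev :: "(nat \<Rightarrow> nat \<Rightarrow> real) \<Rightarrow> nat \<Rightarrow> nat \<Rightarrow> real" where
  "mat_ev a N k = eigenvalues_desc (Matrix.mat N N (\<lambda>(i, j). a i j)) ! k"

lemma mat_ev_spectral_system:
  assumes "\<And>i j. a i j = a j i"
  obtains v where "spectral_system N a N (mat_ev a N) v"
    "length (eigenvalues_desc (Matrix.mat N N (\<lambda>(i, j). a i j))) = N"
proof -
  obtain \<mu> v where sys: "spectral_system N a N \<mu> v"
    by (rule spectral_system_exists[of a N N]) (rule assms, rule order_refl)
  note eq = eigenvalues_desc_eq[OF sys]
  have "mat_ev a N k = \<mu> k" if "k < N" for k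
    using that unfolding mat_ev_def eq by (subst nth_map) auto
  note ev = this
  have "spectral_system N a N (mat_ev a N) v"
    unfolding spectral_system_def
  proof (intro allI impI)
    fix k assume k: "k < N"
    show "v k \<in> fvec N \<and> appl N a (v k) = (\<lambda>i. mat_ev a N k * v k i) \<and>
        (\<forall>l<N. dotp N (v k) (v l) = (if k = l then 1 else 0)) \<and>
        (\<forall>x\<in>fvec N. (\<forall>l<k. dotp N (v l) x = 0) \<longrightarrow>
            dotp N x (appl N a x) \<le> mat_ev a N k * dotp N x x)"
      unfolding ev[OF k] using sys k unfolding spectral_system_def by blast
  qed
  moreover have "length (eigenvalues_desc (Matrix.mat N N (\<lambda>(i, j). a i j))) = N"
    unfolding eq by simp
  ultimately show thesis by (rule that)
qed

section \<open>Infinite symmetric matrices with square-summable entries\<close>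

lemma suminf_Cauchy_Schwarz:
  fixes x y :: "nat \<Rightarrow> real"
  assumes x: "summable (\<lambda>i. (x i)\<^sup>2)" and y: "summable (\<lambda>i. (y i)\<^sup>2)"
  shows "summable (\<lambda>i. \<bar>x i * y i\<bar>)"
    and "(\<Sum>i. \<bar>x i * y i\<bar>)\<^sup>2 \<le> (\<Sum>i. (x i)\<^sup>2) * (\<Sum>i. (y i)\<^sup>2)"
proof -
  show sm: "summable (\<lambda>i. \<bar>x i * y i\<bar>)"
    by (rule summable_comparison_test'[OF summable_add[OF x y], of 0])
      (simp add: abs_mult_le_sum_squares)
  have fin: "(\<Sum>i<n. \<bar>x i * y i\<bar>)\<^sup>2 \<le> (\<Sum>i. (x i)\<^sup>2) * (\<Sum>i. (y i)\<^sup>2)" for n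
  proof -
    have "(\<Sum>i<n. \<bar>x i\<bar> * \<bar>y i\<bar>)\<^sup>2 \<le> (\<Sum>i<n. \<bar>x i\<bar>\<^sup>2) * (\<Sum>i<n. \<bar>y i\<bar>\<^sup>2)"
      by (rule Cauchy_Schwarz_ineq_sum)
    also have "\<dots> \<le> (\<Sum>i. (x i)\<^sup>2) * (\<Sum>i. (y i)\<^sup>2)"
      by (intro mult_mono) (auto intro!: sum_le_suminf x y sum_nonneg suminf_nonneg)
    finally show ?thesis by (simp add: abs_mult)
  qed
  show "(\<Sum>i. \<bar>x i * y i\<bar>)\<^sup>2 \<le> (\<Sum>i. (x i)\<^sup>2) * (\<Sum>i. (y i)\<^sup>2)"
    by (rule LIMSEQ_le_const2[OF tendsto_power[OF summable_LIMSEQ[OF sm]]]) (use fin in auto)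
qed

lemma finite_subset_box:
  fixes X :: "(nat \<times> nat) set"
  assumes "finite X"
  obtains N where "X \<subseteq> {..<N} \<times> {..<N}"
proof -
  have "finite (fst ` X \<union> snd ` X)" using assms by simp
  then obtain N where "fst ` X \<union> snd ` X \<subseteq> {..<N}" using finite_nat_iff_bounded by metis
  then have "X \<subseteq> {..<N} \<times> {..<N}" by force
  then show thesis by (rule that)
qed

lemma has_sum_box2:
  fixes f :: "nat \<times> nat \<Rightarrow> real"
  assumes "(f has_sum S) UNIV"
  shows "(\<lambda>N. \<Sum>i<N. \<Sum>j<N. f (i, j)) \<longlonglongrightarrow> S"
proof -
  have "filterlim (\<lambda>N::nat. {..<N} \<times> {..<N}) (finite_subsets_at_top UNIV) sequentially"
    unfolding filterlim_finite_subsets_at_top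
  proof safe
    fix X :: "(nat \<times> nat) set" assume "finite X"
    then obtain N where "X \<subseteq> {..<N} \<times> {..<N}" by (rule finite_subset_box)
    then show "\<forall>\<^sub>F y in sequentially. finite ({..<y} \<times> {..<y}) \<and> X \<subseteq> {..<y} \<times> {..<y} \<and> {..<y} \<times> {..<y} \<subseteq> UNIV"
      by (intro eventually_sequentiallyI[of N]) force
  qed
  then have "(\<lambda>N. sum f ({..<N} \<times> {..<N})) \<longlonglongrightarrow> S"
    using assms unfolding has_sum_def by (rule filterlim_compose[rotated])
  then show ?thesis by (simp add: sum.cartesian_product)
qed

lemma has_sum_box3:
  fixes f :: "(nat \<times> nat) \<times> nat \<Rightarrow> real"
  assumes "(f has_sum S) UNIV"
  shows "(\<lambda>N. \<Sum>i<N. \<Sum>j<N. \<Sum>l<N. f ((i, j), l)) \<longlonglongrightarrow> S"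
proof -
  have "filterlim (\<lambda>N::nat. ({..<N} \<times> {..<N}) \<times> {..<N}) (finite_subsets_at_top UNIV) sequentially"
    unfolding filterlim_finite_subsets_at_top
  proof safe
    fix X :: "((nat \<times> nat) \<times> nat) set" assume X: "finite X"
    obtain N where N: "fst ` X \<subseteq> {..<N} \<times> {..<N}" by (rule finite_subset_box[OF finite_imageI[OF X]])
    obtain N' where N': "snd ` X \<subseteq> {..<N'}" using X by (meson finite_imageI finite_nat_iff_bounded)
    have "X \<subseteq> ({..<y} \<times> {..<y}) \<times> {..<y}" if "max N N' \<le> y" for y
    proof
      fix p assume p: "p \<in> X"
      obtain i j l where q: "p = ((i, j), l)" by (metis surj_pair)
      have "fst p \<in> {..<N} \<times> {..<N}" "snd p \<in> {..<N'}" using N N' p by blast+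
      then show "p \<in> ({..<y} \<times> {..<y}) \<times> {..<y}" using that by (simp add: q)
    qed
    then show "\<forall>\<^sub>F y in sequentially. finite (({..<y} \<times> {..<y}) \<times> {..<y}) \<and>
        X \<subseteq> ({..<y} \<times> {..<y}) \<times> {..<y} \<and> ({..<y} \<times> {..<y}) \<times> {..<y} \<subseteq> UNIV"
      by (intro eventually_sequentiallyI[of "max N N'"] conjI finite_cartesian_product finite_lessThan subset_UNIV) blast
  qed
  then have "(\<lambda>N. sum f (({..<N} \<times> {..<N}) \<times> {..<N})) \<longlonglongrightarrow> S"
    using assms unfolding has_sum_def by (rule filterlim_compose[rotated])
  moreover have "sum f (({..<N} \<times> {..<N}) \<times> {..<N}) = (\<Sum>i<N. \<Sum>j<N. \<Sum>l<N. f ((i, j), l))" for N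
  proof -
    have "sum f (({..<N} \<times> {..<N}) \<times> {..<N}) = (\<Sum>p\<in>{..<N} \<times> {..<N}. \<Sum>l<N. f (p, l))"
      using sum.cartesian_product[of "\<lambda>p l. f (p, l)" "{..<N}" "{..<N} \<times> {..<N}"]
      by (simp add: case_prod_eta)
    also have "\<dots> = (\<Sum>i<N. \<Sum>j<N. \<Sum>l<N. f ((i, j), l))"
      using sum.cartesian_product[of "\<lambda>i j. \<Sum>l<N. f ((i, j), l)" "{..<N}" "{..<N}"]
      by (simp add: case_prod_unfold)
    finally show ?thesis .
  qed
  ultimately show ?thesis by simp
qed

text \<open>
  Weak convergence in \<open>\<ell>\<^sup>2\<close>: on the unit ball the tail of the pairing with \<open>b\<close> is uniformly small, so
  that finitely many coordinates decide.
\<close>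

lemma weak_convergence:
  fixes x :: "nat \<Rightarrow> nat \<Rightarrow> real" and b y :: "nat \<Rightarrow> real"
  assumes b: "summable (\<lambda>l. (b l)\<^sup>2)"
    and x: "\<And>n. summable (\<lambda>l. (x n l)\<^sup>2)" "\<And>n. (\<Sum>l. (x n l)\<^sup>2) \<le> 1"
    and y: "summable (\<lambda>l. (y l)\<^sup>2)" "(\<Sum>l. (y l)\<^sup>2) \<le> 1"
    and lim: "\<And>l. (\<lambda>n. x n l) \<longlonglongrightarrow> y l"
  shows "(\<lambda>n. \<Sum>l. b l * x n l) \<longlonglongrightarrow> (\<Sum>l. b l * y l)"
proof -
  have tail: "\<bar>(\<Sum>l. b l * z l) - (\<Sum>l<L. b l * z l)\<bar> \<le> sqrt (\<Sum>l. (b (l + L))\<^sup>2)"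
    if z: "summable (\<lambda>l. (z l)\<^sup>2)" "(\<Sum>l. (z l)\<^sup>2) \<le> 1" for z L
  proof -
    note bL = summable_ignore_initial_segment[OF b, of L]
    note zL = summable_ignore_initial_segment[OF z(1), of L]
    have sm: "summable (\<lambda>l. \<bar>b l * z l\<bar>)" by (rule suminf_Cauchy_Schwarz[OF b z(1)])
    have "(\<Sum>l. b l * z l) - (\<Sum>l<L. b l * z l) = (\<Sum>l. b (l + L) * z (l + L))"
      using suminf_split_initial_segment[OF summable_rabs_cancel[OF sm], of L] by simp
    also have "\<bar>\<dots>\<bar> \<le> (\<Sum>l. \<bar>b (l + L) * z (l + L)\<bar>)"
      by (rule summable_rabs) (rule suminf_Cauchy_Schwarz[OF bL zL])
    also have "\<dots> \<le> sqrt ((\<Sum>l. (b (l + L))\<^sup>2) * (\<Sum>l. (z (l + L))\<^sup>2))"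
      by (intro real_le_rsqrt suminf_Cauchy_Schwarz[OF bL zL])
    also have "\<dots> \<le> sqrt (\<Sum>l. (b (l + L))\<^sup>2)"
    proof -
      have "(\<Sum>l. (z (l + L))\<^sup>2) \<le> (\<Sum>l. (z l)\<^sup>2)"
        using suminf_split_initial_segment[OF z(1), of L] by (simp add: sum_nonneg)
      then have "(\<Sum>l. (z (l + L))\<^sup>2) \<le> 1" using z(2) by simp
      moreover have "0 \<le> (\<Sum>l. (b (l + L))\<^sup>2)" by (intro suminf_nonneg bL) simp
      ultimately show ?thesis by (simp add: mult_left_le)
    qed
    finally show ?thesis .
  qed
  have "(\<lambda>L. sqrt (\<Sum>l. (b (l + L))\<^sup>2)) \<longlonglongrightarrow> sqrt 0"
    by (intro tendsto_real_sqrt suminf_exist_split2[OF b])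
  show ?thesis
  proof (rule LIMSEQ_I)
    fix \<epsilon> :: real assume \<epsilon>: "0 < \<epsilon>"
    then have "\<epsilon> / 3 > 0" by simp
    with \<open>(\<lambda>L. sqrt (\<Sum>l. (b (l + L))\<^sup>2)) \<longlonglongrightarrow> sqrt 0\<close>
    have "\<forall>\<^sub>F L in sequentially. sqrt (\<Sum>l. (b (l + L))\<^sup>2) < \<epsilon> / 3"
      by (intro order_tendstoD(2)) auto
    then obtain L where L: "sqrt (\<Sum>l. (b (l + L))\<^sup>2) < \<epsilon> / 3"
      by (auto simp: eventually_sequentially)
    have "(\<lambda>n. \<Sum>l<L. b l * x n l) \<longlonglongrightarrow> (\<Sum>l<L. b l * y l)"
      by (intro tendsto_intros lim)
    from LIMSEQ_D[OF this \<open>\<epsilon> / 3 > 0\<close>]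
    obtain n0 where n0: "\<And>n. n \<ge> n0 \<Longrightarrow> \<bar>(\<Sum>l<L. b l * x n l) - (\<Sum>l<L. b l * y l)\<bar> < \<epsilon> / 3"
      by auto
    have "norm ((\<Sum>l. b l * x n l) - (\<Sum>l. b l * y l)) < \<epsilon>" if "n \<ge> n0" for n
      using n0[OF that] tail[OF x(1)[of n] x(2)[of n], of L] tail[OF y, of L] L
      unfolding real_norm_def by linarith
    then show "\<exists>no. \<forall>n\<ge>no. norm ((\<Sum>l. b l * x n l) - (\<Sum>l. b l * y l)) < \<epsilon>" by blast
  qed
qed

text \<open>
  The matrix of a positive Hilbert--Schmidt operator. \<open>R i\<close> is the squared norm of the \<open>i\<close>-th row, and
  \<open>lam N k\<close> below is the \<open>k\<close>-th eigenvalue, counted from \<open>0\<close>, of the \<open>N \<times> N\<close> compression.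
\<close>

locale hs_matrix =
  fixes a :: "nat \<Rightarrow> nat \<Rightarrow> real" and R :: "nat \<Rightarrow> real" and H :: real
  assumes sym: "a i j = a j i"
    and row_sums: "(\<lambda>j. (a i j)\<^sup>2) sums R i"
    and total: "R sums H"
    and psd: "x \<in> fvec N \<Longrightarrow> 0 \<le> dotp N x (appl N a x)"
    and pos: "0 < a 0 0"
begin

abbreviation "lam \<equiv> mat_ev a"

lemma row_summable: "summable (\<lambda>j. (a i j)\<^sup>2)"
  using row_sums by (auto simp: sums_iff)

lemma R_eq: "R i = (\<Sum>j. (a i j)\<^sup>2)"
  using row_sums by (auto simp: sums_iff)

lemma R_nonneg: "0 \<le> R i"
  unfolding R_eq by (intro suminf_nonneg row_summable) simp

lemma R_summable: "summable R"
  using total by (auto simp: sums_iff)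

lemma R_has_sum: "(R has_sum H) UNIV"
  by (rule sums_nonneg_imp_has_sum[OF total R_nonneg])

lemma squares_has_sum: "((\<lambda>(i, j). (a i j)\<^sup>2) has_sum H) UNIV"
proof -
  have r: "((\<lambda>j. case (i, j) of (i, j) \<Rightarrow> (a i j)\<^sup>2) has_sum R i) UNIV" for i
    using sums_nonneg_imp_has_sum[OF row_sums] by simp
  have "((\<lambda>(i, j). (a i j)\<^sup>2) has_sum H) (Sigma UNIV (\<lambda>_. UNIV))"
  proof (rule has_sum_SigmaI[OF r R_has_sum])
    show "(\<lambda>(i, j). (a i j)\<^sup>2) summable_on (Sigma UNIV (\<lambda>_. UNIV))"
      using R_has_sum by (intro summable_on_SigmaI[OF r]) (auto simp: summable_on_def)
  qed
  then show ?thesis by simp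
qed

lemma squares_box_limit: "(\<lambda>N. \<Sum>i<N. \<Sum>j<N. (a i j)\<^sup>2) \<longlonglongrightarrow> H"
  using has_sum_box2[OF squares_has_sum] by simp

lemma squares_box_le: "(\<Sum>i<N. \<Sum>j<N. (a i j)\<^sup>2) \<le> H"
proof -
  have "(\<Sum>i<N. \<Sum>j<N. (a i j)\<^sup>2) \<le> (\<Sum>i<N. R i)"
    unfolding R_eq by (intro sum_mono sum_le_suminf row_summable) auto
  also have "\<dots> \<le> H"
    using sum_le_suminf[OF R_summable, of "{..<N}"] R_nonneg total by (simp add: sums_iff)
  finally show ?thesis .
qed

text \<open>
  The triple series converges absolutely: by Cauchy--Schwarz the inner sum of \<open>|a m l * a l i|\<close> is at
  most the geometric mean of \<open>R m\<close> and \<open>R i\<close>. It may therefore be summed over boxes or iteratively.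
\<close>

lemma cubes_box_limit:
  assumes b: "\<And>m i. (\<lambda>l. a m l * a l i) sums b m i"
    and t: "\<And>i. (\<lambda>m. a i m * b m i) sums t i"
    and T: "t sums T"
  shows "(\<lambda>N. \<Sum>i<N. \<Sum>m<N. \<Sum>l<N. a i m * a m l * a l i) \<longlonglongrightarrow> T"
proof -
  define f where "f = (\<lambda>((i, m), l). a i m * a m l * a l i)"
  define c where "c = (\<lambda>m i. \<Sum>l. \<bar>a m l * a l i\<bar>)"
  have col: "summable (\<lambda>l. (a l i)\<^sup>2)" for i using row_summable[of i] sym[of i] by simp
  have csm: "summable (\<lambda>l. \<bar>a m l * a l i\<bar>)" for m i
    by (rule suminf_Cauchy_Schwarz[OF row_summable col])
  have c_nonneg: "0 \<le> c m i" for m i unfolding c_def by (intro suminf_nonneg csm) simp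
  have c_le: "(c m i)\<^sup>2 \<le> R m * R i" for m i
    using suminf_Cauchy_Schwarz(2)[OF row_summable[of m] col[of i]] sym[of _ i]
    by (simp add: c_def R_eq)
  have inner: "((\<lambda>l. \<bar>f (p, l)\<bar>) has_sum (case p of (i, m) \<Rightarrow> \<bar>a i m\<bar> * c m i)) UNIV" for p
  proof (cases p)
    case (Pair i m)
    have "(\<lambda>l. \<bar>a i m\<bar> * \<bar>a m l * a l i\<bar>) sums (\<bar>a i m\<bar> * c m i)"
      unfolding c_def by (intro sums_mult summable_sums csm)
    then show ?thesis
      unfolding Pair f_def by (intro sums_nonneg_imp_has_sum) (auto simp: abs_mult mult.assoc)
  qed
  have "(\<lambda>(i, m). R i * R m) summable_on (Sigma UNIV (\<lambda>_. UNIV))"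
  proof (rule summable_on_SigmaI)
    show "((\<lambda>m. case (i, m) of (i, m) \<Rightarrow> R i * R m) has_sum R i * H) UNIV" for i
      using has_sum_cmult_right[OF R_has_sum] by simp
    show "(\<lambda>i. R i * H) summable_on UNIV"
      using has_sum_cmult_left[OF R_has_sum] by (auto simp: summable_on_def)
  qed (auto intro: mult_nonneg_nonneg R_nonneg)
  then have "(\<lambda>p. (case p of (i, m) \<Rightarrow> (a i m)\<^sup>2) + (case p of (i, m) \<Rightarrow> R i * R m)) summable_on UNIV"
    using squares_has_sum by (intro summable_on_add) (auto simp: summable_on_def)
  then have outer: "(\<lambda>(i, m). \<bar>a i m\<bar> * c m i) summable_on UNIV"
  proof (rule summable_on_comparison_test)
    fix p :: "nat \<times> nat"
    obtain i m where p: "p = (i, m)" by (cases p)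
    have "\<bar>a i m\<bar> * c m i \<le> (a i m)\<^sup>2 + (c m i)\<^sup>2"
      using abs_mult_le_sum_squares[of "a i m" "c m i"] c_nonneg[of m i] by (simp add: abs_mult)
    also have "\<dots> \<le> (a i m)\<^sup>2 + R i * R m" using c_le[of m i] by (simp add: mult.commute)
    finally show "(case p of (i, m) \<Rightarrow> \<bar>a i m\<bar> * c m i)
        \<le> (case p of (i, m) \<Rightarrow> (a i m)\<^sup>2) + (case p of (i, m) \<Rightarrow> R i * R m)" by (simp add: p)
  qed (auto intro!: mult_nonneg_nonneg c_nonneg)
  have "(\<lambda>p. \<bar>f p\<bar>) summable_on (Sigma UNIV (\<lambda>_. UNIV))"
    by (rule summable_on_SigmaI[OF inner]) (use outer in auto)
  then have "f summable_on UNIV"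
    using summable_on_iff_abs_summable_on_real[of f UNIV] unfolding real_norm_def UNIV_Times_UNIV by blast
  then obtain S where S: "(f has_sum S) UNIV" by (auto simp: summable_on_def)
  have bsum: "((\<lambda>l. f ((i, m), l)) has_sum (a i m * b m i)) UNIV" for i m
  proof -
    have "(\<lambda>l. a i m * (a m l * a l i)) sums (a i m * b m i)" by (intro sums_mult b)
    moreover have "summable (\<lambda>l. norm (a i m * (a m l * a l i)))"
      using summable_mult[OF csm[of m i], of "\<bar>a i m\<bar>"] by (simp add: abs_mult)
    ultimately show ?thesis
      unfolding f_def by (simp add: norm_summable_imp_has_sum mult.assoc)
  qed
  have "((\<lambda>p. case p of (i, m) \<Rightarrow> a i m * b m i) has_sum S) UNIV"
  proof (rule has_sum_SigmaD)
    show "(f has_sum S) (Sigma UNIV (\<lambda>_. UNIV))" using S by simp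
    show "((\<lambda>l. f (p, l)) has_sum (case p of (i, m) \<Rightarrow> a i m * b m i)) UNIV" for p
      using bsum by (cases p) simp
  qed
  then have S2: "((\<lambda>p. case p of (i, m) \<Rightarrow> a i m * b m i) has_sum S) (Sigma UNIV (\<lambda>_. UNIV))" by simp
  have "((\<lambda>i. \<Sum>\<^sub>\<infinity>m. a i m * b m i) has_sum S) UNIV"
  proof (rule has_sum_SigmaD[OF S2])
    fix i :: nat
    have "(\<lambda>p. case p of (i, m) \<Rightarrow> a i m * b m i) summable_on (Sigma UNIV (\<lambda>_. UNIV))"
      using S2 by (auto simp: summable_on_def)
    from summable_on_SigmaD1[OF this, of i]
    show "((\<lambda>m. case (i, m) of (i, m) \<Rightarrow> a i m * b m i) has_sum (\<Sum>\<^sub>\<infinity>m. a i m * b m i)) UNIV"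
      by (simp add: has_sum_infsum)
  qed
  moreover have "(\<Sum>\<^sub>\<infinity>m. a i m * b m i) = t i" for i
  proof -
    have "(\<lambda>p. case p of (i, m) \<Rightarrow> a i m * b m i) summable_on (Sigma UNIV (\<lambda>_. UNIV))"
      using S2 by (auto simp: summable_on_def)
    from summable_on_SigmaD1[OF this, of i]
    have "((\<lambda>m. a i m * b m i) has_sum (\<Sum>\<^sub>\<infinity>m. a i m * b m i)) UNIV"
      by (simp add: has_sum_infsum)
    then show ?thesis using has_sum_imp_sums t[of i] sums_unique2 by blast
  qed
  ultimately have "t sums S" by (simp add: has_sum_imp_sums)
  then have "S = T" using T sums_unique2 by blast
  with has_sum_box3[OF S] show ?thesis by (simp add: f_def)
qed

lemma ev_system:
  obtains v where "spectral_system N a N (lam N) v"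
  by (rule mat_ev_spectral_system[of a N, OF sym])

lemma ev_length: "length (eigenvalues_desc (Matrix.mat N N (\<lambda>(i, j). a i j))) = N"
  by (rule mat_ev_spectral_system[of a N, OF sym])

lemma ev_nonneg:
  assumes "k < N" shows "0 \<le> lam N k"
proof -
  obtain v where sys: "spectral_system N a N (lam N) v" by (rule ev_system)
  note v = spectral_systemD[OF sys assms]
  have "0 \<le> dotp N (v k) (appl N a (v k))" by (rule psd[OF v(1)])
  then show ?thesis using v(2) v(3)[OF assms] by (simp add: dotp_scale)
qed

lemma ev_mono:
  assumes "k < N" "N \<le> N'" shows "lam N k \<le> lam N' k"
proof -
  obtain v where sys: "spectral_system N a N (lam N) v" by (rule ev_system)
  obtain v' where sys': "spectral_system N' a N' (lam N') v'" by (rule ev_system)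
  show ?thesis using assms by (intro spectral_system_interlacing[OF sys sys']) auto
qed

lemma ev_squares: "(\<Sum>k<N. (lam N k)\<^sup>2) = (\<Sum>i<N. \<Sum>j<N. (a i j)\<^sup>2)"
  by (rule ev_system[of N]) (rule trace_square[symmetric])

lemma ev_cubes: "(\<Sum>k<N. (lam N k)^3) = (\<Sum>i<N. \<Sum>m<N. \<Sum>l<N. a i m * a m l * a l i)"
  by (rule ev_system[of N]) (rule trace_cube[symmetric])

lemma ev_rayleigh:
  assumes "0 < N" "x \<in> fvec N"
  shows "dotp N x (appl N a x) \<le> lam N 0 * dotp N x x"
proof -
  obtain v where sys: "spectral_system N a N (lam N) v" by (rule ev_system)
  show ?thesis by (rule spectral_systemD(4)[OF sys assms]) simp
qed

definition top_ev :: real where "top_ev = (SUP N\<in>{1..}. lam N 0)"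

lemma ev_bounded:
  assumes "0 < N" shows "lam N 0 \<le> sqrt H"
proof (rule real_le_rsqrt)
  have "(lam N 0)\<^sup>2 \<le> (\<Sum>k<N. (lam N k)\<^sup>2)"
    using assms by (intro member_le_sum) auto
  also have "\<dots> \<le> H" unfolding ev_squares by (rule squares_box_le)
  finally show "(lam N 0)\<^sup>2 \<le> H" .
qed

lemma ev_le_top: "0 < N \<Longrightarrow> lam N 0 \<le> top_ev"
  unfolding top_ev_def by (intro cSUP_upper) (auto intro!: bdd_aboveI2[where M = "sqrt H"] ev_bounded)

lemma ev_tendsto_top: "(\<lambda>N. lam N 0) \<longlonglongrightarrow> top_ev"
proof -
  have "(\<lambda>n. lam (Suc n) 0) \<longlonglongrightarrow> (SUP n. lam (Suc n) 0)"
    by (rule LIMSEQ_incseq_SUP)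
      (auto intro!: bdd_aboveI2[where M = "sqrt H"] ev_bounded incseq_SucI ev_mono)
  moreover have "(SUP n. lam (Suc n) 0) = top_ev"
  proof -
    have "{1..} = range Suc" by (auto simp: image_iff Suc_le_eq gr0_conv_Suc)
    then show ?thesis by (simp add: top_ev_def image_image)
  qed
  ultimately show ?thesis by (simp add: LIMSEQ_imp_Suc)
qed

lemma top_ev_pos: "0 < top_ev"
proof -
  have "dotp 1 (\<lambda>i. if i = 0 then 1 else 0) (appl 1 a (\<lambda>i. if i = 0 then 1 else 0))
      \<le> lam 1 0 * dotp 1 (\<lambda>i. if i = 0 then 1 else 0) (\<lambda>i. if i = 0 then 1 else 0)"
    by (rule ev_rayleigh) (auto simp: fvec_def)
  then have "a 0 0 \<le> lam 1 0" by (simp add: dotp_def appl_def)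
  then show ?thesis using pos ev_le_top[of 1] by simp
qed

text \<open>
  The quadratic form at an eigenvector is an absolutely convergent double series. Summed by rows it is
  \<open>c\<close> times the squared norm; summed over boxes it is a limit of values bounded through \<open>ev_rayleigh\<close>.
\<close>

lemma eigenvalue_le_top:
  assumes x: "summable (\<lambda>i. (x i)\<^sup>2)" "x j \<noteq> 0"
    and eig: "\<And>i. (\<lambda>l. a i l * x l) sums (c * x i)"
  shows "c \<le> top_ev"
proof -
  define X where "X = (\<Sum>i. (x i)\<^sup>2)"
  have x_has_sum: "((\<lambda>i. (x i)\<^sup>2) has_sum X) UNIV"
    unfolding X_def by (rule sums_nonneg_imp_has_sum[OF summable_sums[OF x(1)]]) simp
  have "0 < X" unfolding X_def using x by (intro suminf_pos2[of _ j]) auto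
  define f where "f = (\<lambda>(i, l). x i * a i l * x l)"
  have "(\<lambda>(i, m). (x i)\<^sup>2 * (x m)\<^sup>2) summable_on (Sigma UNIV (\<lambda>_. UNIV))"
  proof (rule summable_on_SigmaI)
    show "((\<lambda>m. case (i, m) of (i, m) \<Rightarrow> (x i)\<^sup>2 * (x m)\<^sup>2) has_sum (x i)\<^sup>2 * X) UNIV" for i
      using has_sum_cmult_right[OF x_has_sum] by simp
    show "(\<lambda>i. (x i)\<^sup>2 * X) summable_on UNIV"
      using has_sum_cmult_left[OF x_has_sum] by (auto simp: summable_on_def)
  qed auto
  then have "(\<lambda>p. (case p of (i, m) \<Rightarrow> (x i)\<^sup>2 * (x m)\<^sup>2) + (case p of (i, m) \<Rightarrow> (a i m)\<^sup>2)) summable_on UNIV"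
    using squares_has_sum by (intro summable_on_add) (auto simp: summable_on_def)
  then have "(\<lambda>p. \<bar>f p\<bar>) summable_on UNIV"
  proof (rule summable_on_comparison_test)
    fix p :: "nat \<times> nat"
    obtain i m where p: "p = (i, m)" by (cases p)
    show "\<bar>f p\<bar> \<le> (case p of (i, m) \<Rightarrow> (x i)\<^sup>2 * (x m)\<^sup>2) + (case p of (i, m) \<Rightarrow> (a i m)\<^sup>2)"
      using abs_mult_le_sum_squares[of "x i * x m" "a i m"]
      by (simp add: p f_def power_mult_distrib ac_simps)
  qed simp
  then have "f summable_on UNIV" using summable_on_iff_abs_summable_on_real[of f UNIV] unfolding real_norm_def UNIV_Times_UNIV by blast
  then obtain S where S: "(f has_sum S) UNIV" by (auto simp: summable_on_def)
  have "((\<lambda>i. c * (x i)\<^sup>2) has_sum S) UNIV"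
  proof (rule has_sum_SigmaD)
    show "(f has_sum S) (Sigma UNIV (\<lambda>_. UNIV))" using S by simp
    fix i :: nat
    have "(\<lambda>l. x i * (a i l * x l)) sums (x i * (c * x i))" by (intro sums_mult eig)
    moreover have "summable (\<lambda>l. norm (x i * (a i l * x l)))"
      using summable_mult[OF suminf_Cauchy_Schwarz(1)[OF row_summable[of i] x(1)], of "\<bar>x i\<bar>"]
      by (simp add: abs_mult)
    ultimately have "((\<lambda>l. x i * (a i l * x l)) has_sum (x i * (c * x i))) UNIV"
      by (intro norm_summable_imp_has_sum)
    then show "((\<lambda>l. f (i, l)) has_sum c * (x i)\<^sup>2) UNIV"
      by (simp add: f_def mult.assoc power2_eq_square mult.left_commute)
  qed
  then have "S = c * X"
    using has_sum_cmult_right[OF x_has_sum] has_sum_unique by blast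
  have "(\<Sum>i<N. \<Sum>l<N. f (i, l)) \<le> top_ev * X" if "0 < N" for N
  proof -
    define z where "z = (\<lambda>i. if i < N then x i else 0)"
    have "(\<Sum>i<N. \<Sum>l<N. f (i, l)) = dotp N z (appl N a z)"
      unfolding dotp_appl by (intro sum.cong refl) (simp add: f_def z_def)
    also have "\<dots> \<le> lam N 0 * dotp N z z"
      by (rule ev_rayleigh[OF that]) (simp add: fvec_def z_def)
    also have "\<dots> \<le> top_ev * dotp N z z"
      by (intro mult_right_mono ev_le_top that dotp_self_nonneg)
    also have "dotp N z z = (\<Sum>i<N. (x i)\<^sup>2)"
      by (simp add: dotp_def z_def power2_eq_square)
    also have "top_ev * \<dots> \<le> top_ev * X"
      unfolding X_def using top_ev_pos by (intro mult_left_mono sum_le_suminf x(1)) auto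
    finally show ?thesis .
  qed
  then have "S \<le> top_ev * X"
    by (intro LIMSEQ_le_const2[OF has_sum_box2[OF S]]) (auto intro!: exI[of _ 1])
  then show ?thesis using \<open>S = c * X\<close> \<open>0 < X\<close> by simp
qed

text \<open>
  The eigenvector is a coordinatewise limit of unit top eigenvectors of the compressions. It satisfies
  the eigenvalue equation by weak convergence. It does not vanish because the sequence
  \<open>\<theta> n * z (r n)\<close> is dominated by the norms of the rows, so no mass is lost in the limit.
\<close>

lemma top_ev_eigenvector:
  obtains y j where "summable (\<lambda>i. (y i)\<^sup>2)" "y j \<noteq> 0"
    "\<And>i. (\<lambda>l. a i l * y l) sums (top_ev * y i)"
proof -
  have "\<exists>z. z \<in> fvec (Suc N) \<and> appl (Suc N) a z = (\<lambda>i. lam (Suc N) 0 * z i) \<and> dotp (Suc N) z z = 1" for N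
  proof -
    obtain v where sys: "spectral_system (Suc N) a (Suc N) (lam (Suc N)) v" by (rule ev_system)
    show ?thesis using spectral_systemD(1-3)[OF sys, of 0] by (intro exI[of _ "v 0"]) auto
  qed
  then obtain z where z: "\<And>N. z N \<in> fvec (Suc N)"
    "\<And>N. appl (Suc N) a (z N) = (\<lambda>i. lam (Suc N) 0 * z N i)" "\<And>N. dotp (Suc N) (z N) (z N) = 1"
    by metis
  have z_sums: "(\<lambda>i. f i * z N i) sums (\<Sum>i<Suc N. f i * z N i)" for f N
    using z(1)[of N] by (intro sums_finite) (auto simp: fvec_def)
  have z_sq: "(\<lambda>i. (z N i)\<^sup>2) sums 1" for N
    using z_sums[of "z N" N] z(3)[of N] by (simp add: dotp_def power2_eq_square)
  have z_part: "(\<Sum>i\<in>I. (z N i)\<^sup>2) \<le> 1" if "finite I" for I N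
    using sum_le_suminf[of "\<lambda>i. (z N i)\<^sup>2" I] z_sq[of N] that by (simp add: sums_iff)
  \<comment> \<open>a cube, compact in the topology of coordinatewise convergence\<close>
  define B where "B = PiE (UNIV::nat set) (\<lambda>_. {-1..1::real})"
  have "compact B"
  proof -
    have "compactin (product_topology (\<lambda>i::nat. euclidean) UNIV) B"
      unfolding B_def by (subst compactin_PiE) auto
    then show ?thesis by (simp add: euclidean_product_topology)
  qed
  then have "seq_compact B" by (simp add: compact_eq_seq_compact_metric)
  moreover have "\<forall>N. z N \<in> B"
  proof
    fix N
    have "\<bar>z N i\<bar> \<le> 1" for i using z_part[of "{i}" N] by (simp add: abs_square_le_1)
    then show "z N \<in> B" by (auto simp: B_def abs_le_iff minus_le_iff)
  qed
  ultimately obtain y r where r: "strict_mono r" and lim: "(z \<circ> r) \<longlonglongrightarrow> y"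
    unfolding seq_compact_def by blast
  have lim: "(\<lambda>n. z (r n) i) \<longlonglongrightarrow> y i" for i
  proof -
    have "isCont (\<lambda>x::nat \<Rightarrow> real. x i) y"
      using continuous_on_coordinate[of UNIV i]
        continuous_on_eq_continuous_at[OF open_UNIV, of "\<lambda>x::nat \<Rightarrow> real. x i"] by blast
    from isCont_tendsto_compose[OF this lim] show ?thesis by (simp add: o_def)
  qed
  have y_part: "(\<Sum>i<m. (y i)\<^sup>2) \<le> 1" for m
  proof (rule LIMSEQ_le_const2)
    show "(\<lambda>n. \<Sum>i<m. (z (r n) i)\<^sup>2) \<longlonglongrightarrow> (\<Sum>i<m. (y i)\<^sup>2)" by (intro tendsto_intros lim)
  qed (use z_part in auto)
  have y_sm: "summable (\<lambda>i. (y i)\<^sup>2)" by (rule summableI_nonneg_bounded[OF _ y_part]) simp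
  have y_le: "(\<Sum>i. (y i)\<^sup>2) \<le> 1" by (rule suminf_le_const[OF y_sm y_part])
  define \<theta> where "\<theta> n = lam (Suc (r n)) 0" for n
  have \<theta>: "\<theta> \<longlonglongrightarrow> top_ev"
  proof -
    have "(\<lambda>n. lam (Suc n) 0) \<longlonglongrightarrow> top_ev" by (rule LIMSEQ_Suc[OF ev_tendsto_top])
    from LIMSEQ_subseq_LIMSEQ[OF this r] show ?thesis by (simp add: \<theta>_def[abs_def] o_def)
  qed
  have row_z: "(\<Sum>l. a i l * z (r n) l) = \<theta> n * z (r n) i" if "i < Suc (r n)" for i n
  proof -
    have "(\<Sum>l. a i l * z (r n) l) = (\<Sum>l<Suc (r n). a i l * z (r n) l)"
      using z_sums[of "a i" "r n"] by (simp add: sums_iff)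
    also have "\<dots> = appl (Suc (r n)) a (z (r n)) i" using that by (simp add: appl_def)
    finally show ?thesis by (simp add: z(2) \<theta>_def)
  qed
  have ev_y: "(\<Sum>l. a i l * y l) = top_ev * y i" for i
  proof (rule LIMSEQ_unique)
    show "(\<lambda>n. \<Sum>l. a i l * z (r n) l) \<longlonglongrightarrow> (\<Sum>l. a i l * y l)"
      using z_sq by (intro weak_convergence row_summable y_sm y_le lim) (auto simp: sums_iff)
    have "\<forall>\<^sub>F n in sequentially. (\<Sum>l. a i l * z (r n) l) = \<theta> n * z (r n) i"
      using seq_suble[OF r] by (intro eventually_sequentiallyI[of i] row_z) (meson le_imp_less_Suc order_trans)
    moreover have "(\<lambda>n. \<theta> n * z (r n) i) \<longlonglongrightarrow> top_ev * y i" by (intro tendsto_intros \<theta> lim)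
    ultimately show "(\<lambda>n. \<Sum>l. a i l * z (r n) l) \<longlonglongrightarrow> top_ev * y i"
      by (simp add: tendsto_cong)
  qed
  have "(\<lambda>n. \<Sum>i. (\<theta> n * z (r n) i)\<^sup>2) \<longlonglongrightarrow> (\<Sum>i. (top_ev * y i)\<^sup>2)"
  proof (rule tannerys_theorem[where M = R and F = sequentially, THEN conjunct2, THEN conjunct2])
    show "((\<lambda>n. (\<theta> n * z (r n) i)\<^sup>2) \<longlongrightarrow> (top_ev * y i)\<^sup>2) sequentially" for i
      by (intro tendsto_intros \<theta> lim)
    have bound: "(\<theta> n * z (r n) i)\<^sup>2 \<le> R i" for n i
    proof (cases "i < Suc (r n)")
      case True
      note zs = sums_summable[OF z_sq[of "r n"]]
      have "\<bar>\<Sum>l. a i l * z (r n) l\<bar> \<le> (\<Sum>l. \<bar>a i l * z (r n) l\<bar>)"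
        by (rule summable_rabs) (rule suminf_Cauchy_Schwarz[OF row_summable zs])
      then have "(\<Sum>l. a i l * z (r n) l)\<^sup>2 \<le> (\<Sum>l. \<bar>a i l * z (r n) l\<bar>)\<^sup>2"
        by (metis abs_ge_zero power2_abs power_mono)
      also have "\<dots> \<le> R i"
        using suminf_Cauchy_Schwarz(2)[OF row_summable[of i] zs] z_sq[of "r n"]
        by (simp add: R_eq sums_iff)
      finally show ?thesis by (simp add: row_z[OF True])
    next
      case False
      then have "z (r n) i = 0" using z(1)[of "r n"] by (simp add: fvec_def)
      then show ?thesis by (simp add: R_nonneg)
    qed
    then show "\<forall>\<^sub>F (i, n) in at_top \<times>\<^sub>F sequentially. norm ((\<theta> n * z (r n) i)\<^sup>2) \<le> R i"
      by (intro always_eventually) auto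
    show "summable R" by (rule R_summable)
  qed auto
  moreover have "(\<Sum>i. (\<theta> n * z (r n) i)\<^sup>2) = (\<theta> n)\<^sup>2" for n
    using sums_mult[OF z_sq[of "r n"], of "(\<theta> n)\<^sup>2"] by (simp add: power_mult_distrib sums_iff)
  ultimately have "(\<lambda>n. (\<theta> n)\<^sup>2) \<longlonglongrightarrow> (\<Sum>i. (top_ev * y i)\<^sup>2)" by simp
  moreover have "(\<lambda>n. (\<theta> n)\<^sup>2) \<longlonglongrightarrow> top_ev\<^sup>2" by (intro tendsto_intros \<theta>)
  ultimately have "(\<Sum>i. (top_ev * y i)\<^sup>2) = top_ev\<^sup>2" using LIMSEQ_unique by blast
  moreover have "(\<Sum>i. (top_ev * y i)\<^sup>2) = 0" if "\<And>j. y j = 0" using that by simp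
  ultimately obtain j where "y j \<noteq> 0" using top_ev_pos by fastforce
  moreover have "(\<lambda>l. a i l * y l) sums (top_ev * y i)" for i
    using summable_rabs_cancel[OF suminf_Cauchy_Schwarz(1)[OF row_summable[of i] y_sm]] ev_y[of i]
    by (simp add: sums_iff)
  ultimately show thesis using that y_sm by blast
qed

end

section \<open>The Laguerre basis\<close>

lemma exponential_density_1: "exponential_density 1 x = (if x < 0 then 0 else exp (- x))"
  by (simp add: exponential_density_def)

lemma prob_space_nu: "prob_space nu"
  unfolding nu_def by (rule prob_space_exponential_density) simp

interpretation nu: prob_space nu by (rule prob_space_nu)

lemma sets_nu[measurable_cong]: "sets nu = sets borel"
  by (simp add: nu_def)

lemma space_nu[simp]: "space nu = UNIV"
  by (simp add: nu_def)

lemma measurable_nu[simp]: "borel_measurable nu = borel_measurable borel"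
  by (rule measurable_cong_sets) (simp_all add: sets_nu)

lemma nn_integral_nu:
  assumes "f \<in> borel_measurable borel"
  shows "(\<integral>\<^sup>+u. f u \<partial>nu) = (\<integral>\<^sup>+u. ennreal (exp (- u)) * f u * indicator {0..} u \<partial>lborel)"
  unfolding nu_def using assms
  by (subst nn_integral_density)
    (auto simp: exponential_density_1 intro!: nn_integral_cong split: split_indicator)

lemma AE_nu_pos: "AE u in nu. 0 < u"
proof -
  have "AE u in lborel. u \<noteq> (0::real)" by (rule AE_lborel_singleton)
  then have "AE u in lborel. 0 < ennreal (exponential_density 1 u) \<longrightarrow> 0 < u"
    by eventually_elim (auto simp: exponential_density_1 split: if_splits)
  then show ?thesis unfolding nu_def by (subst AE_density) auto
qed

lemma nu_power_integral:
  shows "integrable nu (\<lambda>u. u ^ n)" "(\<integral>u. u ^ n \<partial>nu) = fact n"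
proof -
  have "(\<integral>\<^sup>+u. ennreal (u ^ n) \<partial>nu) = (\<integral>\<^sup>+u. ennreal (u ^ n * exp (- u)) * indicator {0 ..} u \<partial>lborel)"
    by (subst nn_integral_nu) (auto intro!: nn_integral_cong simp: ennreal_mult' mult.commute split: split_indicator)
  also have "\<dots> = ennreal (fact n)"
    by (subst nn_intergal_power_times_exp_Ici) simp
  finally have eq: "(\<integral>\<^sup>+u. ennreal (u ^ n) \<partial>nu) = ennreal (fact n)" .
  have ae: "AE u in nu. 0 \<le> u ^ n" using AE_nu_pos by eventually_elim simp
  then show int: "integrable nu (\<lambda>u. u ^ n)"
    by (intro integrableI_nn_integral_finite[OF _ _ eq]) auto
  show "(\<integral>u. u ^ n \<partial>nu) = fact n"
    using eq ae by (subst integral_eq_nn_integral) auto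
qed

lemma nu_exp_integrable:
  assumes "c < 1"
  shows "integrable nu (\<lambda>u. exp (c * u))"
proof (rule integrableI_bounded)
  interpret p: prob_space "density lborel (exponential_density (1 - c))"
    using assms by (intro prob_space_exponential_density) simp
  have "(\<integral>\<^sup>+u. ennreal (norm (exp (c * u))) \<partial>nu)
      = (\<integral>\<^sup>+u. ennreal (1 / (1 - c)) * ennreal (exponential_density (1 - c) u) \<partial>lborel)"
  proof (subst nn_integral_nu)
    have "ennreal (exp (- u)) * ennreal (norm (exp (c * u))) * indicator {0..} u
        = ennreal (1 / (1 - c)) * ennreal (exponential_density (1 - c) u)" for u
    proof (cases "u < 0")
      case False
      have "exp (- u) * exp (c * u) = 1 / (1 - c) * ((1 - c) * exp (- u * (1 - c)))"
      proof -
        have "- u + c * u = - u * (1 - c)" by (simp add: algebra_simps)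
        then show ?thesis using assms by (simp flip: exp_add)
      qed
      then show ?thesis
        using False assms by (simp add: exponential_density_def ennreal_mult'[symmetric])
    qed (simp add: exponential_density_def)
    then show "(\<integral>\<^sup>+u. ennreal (exp (- u)) * ennreal (norm (exp (c * u))) * indicator {0..} u \<partial>lborel)
      = (\<integral>\<^sup>+u. ennreal (1 / (1 - c)) * ennreal (exponential_density (1 - c) u) \<partial>lborel)"
      by (simp only:)
  qed simp
  also have "\<dots> = ennreal (1 / (1 - c)) * (\<integral>\<^sup>+u. ennreal (exponential_density (1 - c) u) \<partial>lborel)"
    by (rule nn_integral_cmult) simp
  also have "(\<integral>\<^sup>+u. ennreal (exponential_density (1 - c) u) \<partial>lborel) = 1"
    using p.emeasure_space_1 by (simp add: emeasure_density)
  finally show "(\<integral>\<^sup>+u. ennreal (norm (exp (c * u))) \<partial>nu) < \<infinity>" by simp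
qed simp

lemma power_le_fact_exp: "x ^ n \<le> fact n * exp x" if "0 \<le> (x::real)"
proof -
  have "(\<Sum>k\<in>{n}. x ^ k /\<^sub>R fact k) \<le> (\<Sum>k. x ^ k /\<^sub>R fact k)"
    using that by (intro sum_le_suminf summable_exp_generic) auto
  then show ?thesis by (simp add: exp_def field_simps)
qed

lemma nu_power_exp_integrable:
  assumes "c < 1"
  shows "integrable nu (\<lambda>u. u ^ n * exp (c * u))"
proof -
  define d where "d = (1 - c) / 2"
  have d: "0 < d" "c + d < 1" using assms by (auto simp: d_def field_simps)
  show ?thesis
  proof (rule Bochner_Integration.integrable_bound)
    show "integrable nu (\<lambda>u. fact n / d ^ n * exp ((c + d) * u))"
      using nu_exp_integrable[OF d(2)] by simp
    show "AE u in nu. norm (u ^ n * exp (c * u)) \<le> norm (fact n / d ^ n * exp ((c + d) * u))"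
      using AE_nu_pos
    proof eventually_elim
      case (elim u)
      have "(d * u) ^ n \<le> fact n * exp (d * u)" using d elim by (intro power_le_fact_exp) simp
      then have "u ^ n \<le> fact n / d ^ n * exp (d * u)" using d by (simp add: power_mult_distrib field_simps)
      then have "u ^ n * exp (c * u) \<le> fact n / d ^ n * exp (d * u) * exp (c * u)" by (intro mult_right_mono) auto
      also have "\<dots> = fact n / d ^ n * exp ((c + d) * u)" by (simp add: exp_add[symmetric] algebra_simps)
      finally show ?case using elim d by simp
    qed
  qed simp
qed

lemma power_exp_L2_nu:
  assumes "c < 1 / 2"
  shows "(\<lambda>u. u ^ n * exp (c * u)) \<in> L2 nu"
proof -
  have "(u ^ n * exp (c * u))\<^sup>2 = u ^ (2 * n) * exp (2 * c * u)" for u :: real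
    by (simp add: power_mult_distrib power_mult[symmetric] mult.commute exp_double[symmetric] mult.assoc)
  then show ?thesis using nu_power_exp_integrable[of "2 * c" "2 * n"] assms by (simp add: L2_def)
qed

lemma power_L2_nu: "(\<lambda>u. u ^ n) \<in> L2 nu"
  using power_exp_L2_nu[of 0 n] by simp

lemma laguerre_altdef: "laguerre n = (\<lambda>x. \<Sum>k\<le>n. (real (n choose k) * (- 1) ^ k / fact k) * x ^ k)"
proof
  fix x :: real
  have "(- x) ^ k = (- 1) ^ k * x ^ k" for k using power_mult_distrib[of "-1" x k] by simp
  then show "laguerre n x = (\<Sum>k\<le>n. (real (n choose k) * (- 1) ^ k / fact k) * x ^ k)"
    unfolding laguerre_def by (intro sum.cong refl) simp
qed

lemma laguerre_L2: "laguerre n \<in> L2 nu"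
  unfolding laguerre_altdef by (intro L2_sum L2_scale power_L2_nu)

lemma laguerre_0: "laguerre 0 = (\<lambda>x. 1)"
  by (simp add: laguerre_altdef)

lemma L2_inner_laguerre:
  assumes "f \<in> L2 nu"
  shows "L2_inner nu f (laguerre n)
    = (\<Sum>k\<le>n. (real (n choose k) * (- 1) ^ k / fact k) * L2_inner nu f (\<lambda>x. x ^ k))"
proof -
  have "L2_inner nu f (laguerre n)
    = (\<Sum>k\<le>n. L2_inner nu f (\<lambda>x. (real (n choose k) * (- 1) ^ k / fact k) * x ^ k))"
    unfolding laguerre_altdef by (intro L2_inner_sum assms L2_scale power_L2_nu)
  then show ?thesis by (simp only: L2_inner_scale)
qed

lemma alternating_binomial_sum_Suc:
  fixes F :: "nat \<Rightarrow> real"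
  shows "(\<Sum>k\<le>Suc n. (- 1) ^ k * real (Suc n choose k) * F k)
    = (\<Sum>k\<le>n. (- 1) ^ k * real (n choose k) * (F k - F (Suc k)))"
proof -
  have "(\<Sum>k\<le>Suc n. (- 1) ^ k * real (Suc n choose k) * F k)
      = F 0 + (\<Sum>k\<le>n. (- 1) ^ Suc k * real (Suc n choose Suc k) * F (Suc k))"
    by (subst sum.atMost_Suc_shift) simp
  also have "(\<Sum>k\<le>n. (- 1) ^ Suc k * real (Suc n choose Suc k) * F (Suc k))
      = (\<Sum>k\<le>n. (- 1) ^ Suc k * real (n choose Suc k) * F (Suc k))
        - (\<Sum>k\<le>n. (- 1) ^ k * real (n choose k) * F (Suc k))"
    by (simp add: algebra_simps sum.distrib sum_negf sum_subtractf)
  also have "F 0 + (\<dots>) = (\<Sum>k\<le>Suc n. (- 1) ^ k * real (n choose k) * F k)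
        - (\<Sum>k\<le>n. (- 1) ^ k * real (n choose k) * F (Suc k))"
    unfolding sum.atMost_Suc_shift[of "\<lambda>k. (- 1) ^ k * real (n choose k) * F k" n] by simp
  also have "(\<Sum>k\<le>Suc n. (- 1) ^ k * real (n choose k) * F k) = (\<Sum>k\<le>n. (- 1) ^ k * real (n choose k) * F k)"
    by simp
  finally show ?thesis by (simp add: right_diff_distrib sum_subtractf)
qed

text \<open>
  An alternating binomial sum is an iterated finite difference, and by Pascal's rule the difference
  operator lowers the bottom index of a binomial coefficient.
\<close>

lemma binomial_finite_difference:
  "(\<Sum>k\<le>n. (- 1) ^ k * real (n choose k) * real ((p + k) choose r))
    = (if n \<le> r then (- 1) ^ n * real (p choose (r - n)) else 0)"
proof (induction n arbitrary: r)
  case (Suc n)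
  have "(\<Sum>k\<le>Suc n. (- 1) ^ k * real (Suc n choose k) * real ((p + k) choose r))
    = (\<Sum>k\<le>n. (- 1) ^ k * real (n choose k) * (real ((p + k) choose r) - real ((p + Suc k) choose r)))"
    by (rule alternating_binomial_sum_Suc)
  also have "\<dots> = (if Suc n \<le> r then (- 1) ^ Suc n * real (p choose (r - Suc n)) else 0)"
  proof (cases r)
    case (Suc q)
    then have "(\<Sum>k\<le>n. (- 1) ^ k * real (n choose k) * (real ((p + k) choose r) - real ((p + Suc k) choose r)))
      = - (\<Sum>k\<le>n. (- 1) ^ k * real (n choose k) * real ((p + k) choose q))"
      by (simp add: sum_negf)
    then show ?thesis using Suc.IH[of q] Suc by simp
  qed simp
  finally show ?case .
qed simp

lemma L2_inner_power_power: "L2_inner nu (\<lambda>x. x ^ m) (\<lambda>x. x ^ k) = fact (m + k)"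
  by (simp add: L2_inner_def power_add[symmetric] nu_power_integral)

lemma L2_inner_power_laguerre:
  "L2_inner nu (\<lambda>x. x ^ m) (laguerre n) = (if n \<le> m then (- 1) ^ n * fact m * real (m choose n) else 0)"
proof -
  have "L2_inner nu (\<lambda>x. x ^ m) (laguerre n)
    = (\<Sum>k\<le>n. (real (n choose k) * (- 1) ^ k / fact k) * fact (m + k))"
    by (subst L2_inner_laguerre[OF power_L2_nu]) (simp add: L2_inner_power_power)
  also have "\<dots> = (\<Sum>k\<le>n. fact m * ((- 1) ^ k * real (n choose k) * real ((m + k) choose m)))"
  proof (intro sum.cong refl)
    fix k
    have "real ((m + k) choose m) = fact (m + k) / (fact m * fact k)"
      by (simp add: binomial_fact)
    then show "(real (n choose k) * (- 1) ^ k / fact k) * fact (m + k)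
        = fact m * ((- 1) ^ k * real (n choose k) * real ((m + k) choose m))"
      by (simp add: field_simps)
  qed
  also have "\<dots> = fact m * (\<Sum>k\<le>n. (- 1) ^ k * real (n choose k) * real ((m + k) choose m))"
    by (simp only: sum_distrib_left)
  finally have eq: "L2_inner nu (\<lambda>x. x ^ m) (laguerre n)
    = fact m * (\<Sum>k\<le>n. (- 1) ^ k * real (n choose k) * real ((m + k) choose m))" .
  show ?thesis
    unfolding eq binomial_finite_difference using binomial_symmetric[of n m] by simp
qed

text \<open>
  \<open>laguerre j\<close> is orthogonal to the powers below \<open>j\<close>, so that only the leading coefficient of
  \<open>laguerre i\<close> can contribute when \<open>i \<le> j\<close>.
\<close>

lemma laguerre_orthonormal:
  "L2_inner nu (laguerre i) (laguerre j) = (if i = j then 1 else 0)"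
proof -
  have *: "L2_inner nu (laguerre i) (laguerre j) = (if i = j then 1 else 0)" if "i \<le> j" for i j
  proof -
    have "L2_inner nu (laguerre i) (laguerre j) = L2_inner nu (laguerre j) (laguerre i)"
      by (rule L2_inner_commute)
    also have "\<dots> = (\<Sum>k\<le>i. (real (i choose k) * (- 1) ^ k / fact k) * L2_inner nu (\<lambda>x. x ^ k) (laguerre j))"
      by (simp add: L2_inner_laguerre[OF laguerre_L2] L2_inner_commute[of nu "laguerre j"])
    also have "\<dots> = (\<Sum>k\<le>i. if k = i then (if i = j then 1 else 0) else 0)"
    proof (rule sum.cong[OF refl])
      fix k assume "k \<in> {..i}"
      then show "(real (i choose k) * (- 1) ^ k / fact k) * L2_inner nu (\<lambda>x. x ^ k) (laguerre j)
          = (if k = i then (if i = j then 1 else 0) else 0)"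
        using that by (auto simp: L2_inner_power_laguerre power_mult_distrib[symmetric])
    qed
    finally show ?thesis by simp
  qed
  show ?thesis
  proof (cases "i \<le> j")
    case False
    then show ?thesis using *[of j i] L2_inner_commute[of nu "laguerre i" "laguerre j"] by simp
  qed (rule *)
qed

lemma orthogonal_powers:
  assumes f: "f \<in> L2 nu" and orth: "\<And>i. L2_inner nu (laguerre i) f = 0"
  shows "L2_inner nu (\<lambda>u. u ^ n) f = 0"
proof (induction n rule: less_induct)
  case (less n)
  have "0 = L2_inner nu f (laguerre n)" using orth[of n] by (simp add: L2_inner_commute)
  also have "\<dots> = (\<Sum>k\<le>n. (real (n choose k) * (- 1) ^ k / fact k) * L2_inner nu f (\<lambda>x. x ^ k))"
    by (rule L2_inner_laguerre[OF f])
  also have "\<dots> = (\<Sum>k\<in>{n}. (real (n choose k) * (- 1) ^ k / fact k) * L2_inner nu f (\<lambda>x. x ^ k))"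
    using less by (intro sum.mono_neutral_right) (auto simp: L2_inner_commute[of nu f])
  finally show ?case by (simp add: L2_inner_commute[of nu f])
qed

text \<open>
  Expanding the extra factor \<open>exp (- u / 4)\<close> in its power series, every term vanishes. The exchange
  with the integral is legitimate since the series of absolute values sums to \<open>exp (u / 4)\<close>, which is
  still square-integrable against \<open>\<nu>\<close>; this limits the step in the exponent to less than \<open>1/2\<close>.
\<close>

lemma orthogonal_power_exp_step:
  assumes f: "f \<in> L2 nu" and s: "0 \<le> s"
    and orth: "\<And>n. (\<integral>u. f u * (u ^ n * exp (- s * u)) \<partial>nu) = 0"
  shows "(\<integral>u. f u * (u ^ n * exp (- (s + 1 / 4) * u)) \<partial>nu) = 0"
proof -
  define F where "F = (\<lambda>k u. f u * (u ^ n * exp (- s * u)) * ((- u / 4) ^ k / fact k))"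
  have F_alt: "F k = (\<lambda>u. ((- 1 / 4) ^ k / fact k) * (f u * (u ^ (n + k) * exp (- s * u))))" for k
  proof
    fix u :: real
    have "(- u / 4) ^ k = (- 1 / 4) ^ k * u ^ k" using power_mult_distrib[of "-1/4" u k] by simp
    then show "F k u = ((- 1 / 4) ^ k / fact k) * (f u * (u ^ (n + k) * exp (- s * u)))"
      by (simp add: F_def power_add ac_simps)
  qed
  have [measurable]: "f \<in> borel_measurable borel" using L2_measurable[OF f] by simp
  have F_int: "integrable nu (F k)" for k
    unfolding F_alt using power_exp_L2_nu[of "- s"] s
    by (intro integrable_mult_right L2_integrable_mult f) auto
  have F_0: "(\<integral>u. F k u \<partial>nu) = 0" for k
    unfolding F_alt using orth by simp
  define G where "G = (\<lambda>u. f u * (u ^ n * exp ((1 / 4 - s) * u)))"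
  have G: "integrable nu (\<lambda>u. norm (G u))"
    unfolding G_def using s by (intro integrable_norm L2_integrable_mult f power_exp_L2_nu) auto
  have exp_series: "(\<lambda>k. x ^ k / fact k) sums exp x" for x :: real
    using exp_converges[of x] by (simp add: divide_inverse mult.commute)
  have part: "(\<Sum>k<K. norm (F k u)) \<le> norm (G u)" if "0 < u" for K u
  proof -
    have "(\<Sum>k<K. norm (F k u)) = norm (f u * (u ^ n * exp (- s * u))) * (\<Sum>k<K. (u / 4) ^ k / fact k)"
      using that by (simp add: F_def sum_distrib_left abs_mult power_abs)
    also have "\<dots> \<le> norm (f u * (u ^ n * exp (- s * u))) * exp (u / 4)"
      using that sum_le_suminf[OF sums_summable[OF exp_series[of "u / 4"]], of "{..<K}"]
        sums_unique[OF exp_series[of "u / 4"]]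
      by (intro mult_left_mono) auto
    also have "\<dots> = norm (G u)"
    proof -
      have "exp (- s * u) * exp (u / 4) = exp ((1 / 4 - s) * u)"
        by (simp add: exp_add[symmetric] algebra_simps)
      then show ?thesis by (simp add: G_def abs_mult mult.assoc)
    qed
    finally show ?thesis .
  qed
  have "(\<Sum>k<K. \<integral>u. norm (F k u) \<partial>nu) \<le> (\<integral>u. norm (G u) \<partial>nu)" for K
  proof -
    have "(\<Sum>k<K. \<integral>u. norm (F k u) \<partial>nu) = (\<integral>u. (\<Sum>k<K. norm (F k u)) \<partial>nu)"
      using F_int by simp
    also have "\<dots> \<le> (\<integral>u. norm (G u) \<partial>nu)"
      using AE_nu_pos part
      by (intro integral_mono_AE G Bochner_Integration.integrable_sum integrable_norm F_int)
        (auto elim!: eventually_mono)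
    finally show ?thesis .
  qed
  then have sm: "summable (\<lambda>k. \<integral>u. norm (F k u) \<partial>nu)"
    by (intro summableI_nonneg_bounded) auto
  have "(\<lambda>k. \<integral>u. F k u \<partial>nu) sums (\<integral>u. (\<Sum>k. F k u) \<partial>nu)"
  proof (rule sums_integral[OF F_int _ sm])
    show "AE u in nu. summable (\<lambda>k. norm (F k u))"
      using AE_nu_pos
    proof eventually_elim
      case (elim u)
      then show ?case using part by (intro summableI_nonneg_bounded[where x = "norm (G u)"]) auto
    qed
  qed
  then have "(\<integral>u. (\<Sum>k. F k u) \<partial>nu) = 0"
    unfolding F_0 using sums_unique2 sums_zero by blast
  moreover have "(\<Sum>k. F k u) = f u * (u ^ n * exp (- (s + 1 / 4) * u))" for u
  proof -
    have "(\<lambda>k. F k u) sums (f u * (u ^ n * exp (- s * u)) * exp (- u / 4))"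
      unfolding F_def by (intro sums_mult exp_series)
    moreover have "exp (- s * u) * exp (- u / 4) = exp (- (s + 1 / 4) * u)"
      by (simp add: exp_add[symmetric] algebra_simps)
    ultimately show ?thesis by (simp add: sums_iff mult.assoc)
  qed
  ultimately show ?thesis by simp
qed

lemma orthogonal_exp:
  assumes f: "f \<in> L2 nu" and orth: "\<And>i. L2_inner nu (laguerre i) f = 0"
  shows "(\<integral>u. f u * exp (- u / 4) ^ m \<partial>nu) = 0"
proof -
  have "(\<integral>u. f u * (u ^ n * exp (- (real m / 4) * u)) \<partial>nu) = 0" for n
  proof (induction m arbitrary: n)
    case 0
    show ?case using orthogonal_powers[OF f orth, of n] by (simp add: L2_inner_def mult.commute)
  next
    case (Suc m)
    have "(\<integral>u. f u * (u ^ n * exp (- (real m / 4 + 1 / 4) * u)) \<partial>nu) = 0"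
      by (rule orthogonal_power_exp_step[OF f _ Suc.IH]) simp
    then show ?case by (simp add: add_divide_distrib algebra_simps)
  qed
  from this[of 0] show ?thesis by (simp add: exp_of_nat_mult[symmetric])
qed

text \<open>
  Orthogonality to all powers of \<open>exp (- u / 4)\<close> extends to continuous functions of it by the
  Weierstrass approximation theorem on \<open>[0, 1]\<close>.
\<close>

lemma orthogonal_continuous:
  assumes f: "f \<in> L2 nu" and orth: "\<And>i. L2_inner nu (laguerre i) f = 0"
    and g: "continuous_on UNIV g"
  shows "(\<integral>u. f u * g (exp (- u / 4)) \<partial>nu) = 0"
proof -
  have f1: "integrable nu f" using L2_integrable_mult[OF f power_L2_nu[of 0]] by simp
  have [measurable]: "f \<in> borel_measurable borel" using L2_measurable[OF f] by simp
  have [measurable]: "g \<in> borel_measurable borel" by (rule borel_measurable_continuous_onI[OF g])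
  have fb: "integrable nu (\<lambda>u. f u * h (exp (- u / 4)))"
    if h: "continuous_on UNIV h" for h :: "real \<Rightarrow> real"
  proof -
    have [measurable]: "h \<in> borel_measurable borel" by (rule borel_measurable_continuous_onI[OF h])
    have "compact (h ` {0..1})" using h by (intro compact_continuous_image continuous_on_subset[OF h]) auto
    then have "bounded (h ` {0..1})" by (rule compact_imp_bounded)
    then obtain B where "\<forall>x\<in>{0..1}. \<bar>h x\<bar> \<le> B" unfolding bounded_iff by auto
    then have B: "\<And>x. x \<in> {0..1} \<Longrightarrow> \<bar>h x\<bar> \<le> B" by blast
    show ?thesis
    proof (rule Bochner_Integration.integrable_bound)
      show "integrable nu (\<lambda>u. B * norm (f u))" using f1 by simp
      show "AE u in nu. norm (f u * h (exp (- u / 4))) \<le> norm (B * norm (f u))"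
        using AE_nu_pos
      proof eventually_elim
        case (elim u)
        then have "\<bar>h (exp (- u / 4))\<bar> \<le> B" by (intro B) auto
        then have "\<bar>f u\<bar> * \<bar>h (exp (- u / 4))\<bar> \<le> \<bar>f u\<bar> * B" by (intro mult_left_mono) auto
        also have "\<dots> \<le> \<bar>f u\<bar> * \<bar>B\<bar>" by (intro mult_left_mono) auto
        finally show ?case by (simp add: abs_mult mult.commute)
      qed
    qed measurable
  qed
  have "\<bar>\<integral>u. f u * g (exp (- u / 4)) \<partial>nu\<bar> \<le> \<epsilon> * (\<integral>u. norm (f u) \<partial>nu)" if "0 < \<epsilon>" for \<epsilon>
  proof -
    obtain p where p: "real_polynomial_function p" "\<And>x. x \<in> {0..1} \<Longrightarrow> \<bar>g x - p x\<bar> < \<epsilon>"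
      using Stone_Weierstrass_real_polynomial_function[of "{0..1::real}" g \<epsilon>]
        continuous_on_subset[OF g] \<open>0 < \<epsilon>\<close> by auto
    then obtain a n where a: "p = (\<lambda>x. \<Sum>i\<le>n. a i * x ^ i)"
      by (auto simp: real_polynomial_function_iff_sum)
    have p_cont: "continuous_on UNIV p" unfolding a by (intro continuous_intros)
    have "(\<integral>u. f u * p (exp (- u / 4)) \<partial>nu) = (\<Sum>i\<le>n. a i * (\<integral>u. f u * exp (- u / 4) ^ i \<partial>nu))"
    proof -
      have "integrable nu (\<lambda>u. f u * exp (- u / 4) ^ i)" for i
        using fb[of "\<lambda>x. x ^ i"] by (simp add: continuous_intros)
      then show ?thesis
        unfolding a sum_distrib_left
        by (subst Bochner_Integration.integral_sum) (auto simp: mult.left_commute)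
    qed
    also have "\<dots> = 0" using orthogonal_exp[OF f orth] by simp
    finally have "(\<integral>u. f u * g (exp (- u / 4)) \<partial>nu)
        = (\<integral>u. f u * g (exp (- u / 4)) - f u * p (exp (- u / 4)) \<partial>nu)"
      using Bochner_Integration.integral_diff[OF fb[OF g] fb[OF p_cont]] by simp
    also have "norm \<dots> \<le> (\<integral>u. norm (f u * g (exp (- u / 4)) - f u * p (exp (- u / 4))) \<partial>nu)"
      by (rule integral_norm_bound)
    also have "\<dots> \<le> (\<integral>u. \<epsilon> * norm (f u) \<partial>nu)"
    proof (intro integral_mono_AE integrable_norm Bochner_Integration.integrable_diff fb g p_cont)
      show "AE u in nu. norm (f u * g (exp (- u / 4)) - f u * p (exp (- u / 4))) \<le> \<epsilon> * norm (f u)"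
        using AE_nu_pos
      proof eventually_elim
        case (elim u)
        have "\<bar>g (exp (- u / 4)) - p (exp (- u / 4))\<bar> < \<epsilon>" using elim by (intro p) auto
        then have "\<bar>f u\<bar> * \<bar>g (exp (- u / 4)) - p (exp (- u / 4))\<bar> \<le> \<bar>f u\<bar> * \<epsilon>"
          by (intro mult_left_mono) auto
        then show ?case by (simp add: abs_mult[symmetric] right_diff_distrib mult.commute)
      qed
    qed (use f1 in simp)
    finally show ?thesis by simp
  qed
  then have "\<bar>\<integral>u. f u * g (exp (- u / 4)) \<partial>nu\<bar> \<le> 0"
  proof (rule_tac field_le_epsilon)
    fix e :: real assume e: "0 < e" and *: "\<And>\<epsilon>. 0 < \<epsilon> \<Longrightarrow> \<bar>\<integral>u. f u * g (exp (- u / 4)) \<partial>nu\<bar> \<le> \<epsilon> * (\<integral>u. norm (f u) \<partial>nu)"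
    define I where "I = (\<integral>u. norm (f u) \<partial>nu)"
    have I: "0 \<le> I" by (simp add: I_def)
    have pos: "0 < e / (I + 1)" using e I by simp
    have "\<bar>\<integral>u. f u * g (exp (- u / 4)) \<partial>nu\<bar> \<le> e / (I + 1) * I"
      unfolding I_def by (rule *[OF pos[unfolded I_def]])
    also have "\<dots> \<le> e" using e I by (simp add: field_simps)
    finally show "\<bar>\<integral>u. f u * g (exp (- u / 4)) \<partial>nu\<bar> \<le> 0 + e" by simp
  qed
  then show ?thesis by simp
qed

lemma orthogonal_half_line:
  assumes f: "f \<in> L2 nu" and orth: "\<And>i. L2_inner nu (laguerre i) f = 0"
  shows "(\<integral>u. f u * indicator {a<..} u \<partial>nu) = 0"
proof -
  have f1: "integrable nu f" using L2_integrable_mult[OF f power_L2_nu[of 0]] by simp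
  have [measurable]: "f \<in> borel_measurable borel" using L2_measurable[OF f] by simp
  define c where "c = exp (- a / 4)"
  \<comment> \<open>ramps that increase to the indicator of \<open>{..<c}\<close>\<close>
  define h where "h = (\<lambda>(n::nat) x. min 1 (max 0 (real n * (c - x))))"
  have h_cont: "continuous_on UNIV (h n)" for n
    unfolding h_def by (intro continuous_intros)
  have [measurable]: "h n \<in> borel_measurable borel" for n
    by (rule borel_measurable_continuous_onI[OF h_cont])
  have h01: "0 \<le> h n x" "h n x \<le> 1" for n x by (auto simp: h_def)
  have h_lim: "(\<lambda>n. h n (exp (- u / 4))) \<longlonglongrightarrow> indicator {a<..} u" for u
  proof (cases "a < u")
    case True
    then have pos: "0 < c - exp (- u / 4)" by (simp add: c_def)
    then obtain N where N: "1 < real N * (c - exp (- u / 4))" using reals_Archimedean3[OF pos] by auto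
    have "h n (exp (- u / 4)) = 1" if "N \<le> n" for n
    proof -
      have "real N * (c - exp (- u / 4)) \<le> real n * (c - exp (- u / 4))"
        using that pos by (intro mult_right_mono) auto
      then show ?thesis using N by (simp add: h_def)
    qed
    then show ?thesis using True by (intro tendsto_eventually eventually_sequentiallyI[of N]) simp
  next
    case False
    then have "c - exp (- u / 4) \<le> 0" by (simp add: c_def)
    then have "real n * (c - exp (- u / 4)) \<le> 0" for n by (simp add: mult_nonneg_nonpos)
    then have "h n (exp (- u / 4)) = 0" for n by (simp add: h_def max_absorb1)
    then show ?thesis using False by simp
  qed
  have "(\<lambda>n. \<integral>u. f u * h n (exp (- u / 4)) \<partial>nu) \<longlonglongrightarrow> (\<integral>u. f u * indicator {a<..} u \<partial>nu)"
  proof (rule integral_dominated_convergence[where w = "\<lambda>u. norm (f u)"])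
    show "AE u in nu. norm (f u * h n (exp (- u / 4))) \<le> norm (f u)" for n
      using h01 by (intro AE_I2) (simp add: abs_mult mult_left_le)
    show "AE u in nu. (\<lambda>n. f u * h n (exp (- u / 4))) \<longlonglongrightarrow> f u * indicator {a<..} u"
      by (intro AE_I2 tendsto_mult tendsto_const h_lim)
    show "integrable nu (\<lambda>u. norm (f u))" using f1 by simp
  qed simp_all
  then show ?thesis
    using orthogonal_continuous[OF f orth h_cont] by (simp add: LIMSEQ_const_iff)
qed

text \<open>
  The positive and the negative part of \<open>f\<close> define finite measures that agree on all half-lines, hence
  coincide.
\<close>

lemma laguerre_complete:
  assumes f: "f \<in> L2 nu" and orth: "\<And>i. L2_inner nu (laguerre i) f = 0"
  shows "AE u in nu. f u = 0"
proof -
  have f1: "integrable nu f" using L2_integrable_mult[OF f power_L2_nu[of 0]] by simp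
  have fM[measurable]: "f \<in> borel_measurable borel" using L2_measurable[OF f] by simp
  define P where "P = density nu (\<lambda>u. ennreal (f u))"
  define N where "N = density nu (\<lambda>u. ennreal (- f u))"
  have eP: "emeasure P {a<..} = ennreal (\<integral>u. max 0 (f u) * indicator {a<..} u \<partial>nu)" for a
  proof -
    have "emeasure P {a<..} = (\<integral>\<^sup>+u. ennreal (max 0 (f u) * indicator {a<..} u) \<partial>nu)"
      unfolding P_def by (subst emeasure_density)
        (auto simp: sets_nu intro!: nn_integral_cong split: split_indicator simp: max_def ennreal_neg)
    also have "\<dots> = ennreal (\<integral>u. max 0 (f u) * indicator {a<..} u \<partial>nu)"
      using f1 by (intro nn_integral_eq_integral integrable_real_mult_indicator integrable_max)
        (auto simp: sets_nu)
    finally show ?thesis .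
  qed
  have eN: "emeasure N {a<..} = ennreal (\<integral>u. max 0 (- f u) * indicator {a<..} u \<partial>nu)" for a
  proof -
    have "emeasure N {a<..} = (\<integral>\<^sup>+u. ennreal (max 0 (- f u) * indicator {a<..} u) \<partial>nu)"
      unfolding N_def by (subst emeasure_density)
        (auto simp: sets_nu intro!: nn_integral_cong split: split_indicator simp: max_def ennreal_neg)
    also have "\<dots> = ennreal (\<integral>u. max 0 (- f u) * indicator {a<..} u \<partial>nu)"
      using f1 by (intro nn_integral_eq_integral integrable_real_mult_indicator integrable_max)
        (auto simp: sets_nu)
    finally show ?thesis .
  qed
  have eq: "(\<integral>u. max 0 (f u) * indicator {a<..} u \<partial>nu) = (\<integral>u. max 0 (- f u) * indicator {a<..} u \<partial>nu)" for a
  proof -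
    have "(\<integral>u. max 0 (f u) * indicator {a<..} u \<partial>nu) - (\<integral>u. max 0 (- f u) * indicator {a<..} u \<partial>nu)
      = (\<integral>u. max 0 (f u) * indicator {a<..} u - max 0 (- f u) * indicator {a<..} u \<partial>nu)"
      using f1 by (intro Bochner_Integration.integral_diff[symmetric] integrable_real_mult_indicator integrable_max)
        (auto simp: sets_nu)
    also have "\<dots> = (\<integral>u. f u * indicator {a<..} u \<partial>nu)"
      by (intro Bochner_Integration.integral_cong refl) (auto split: split_indicator)
    also have "\<dots> = 0" by (rule orthogonal_half_line[OF f orth])
    finally show ?thesis by simp
  qed
  have "P = N"
    by (rule measure_eqI_lessThan) (auto simp: P_def N_def sets_nu, (simp add: eP[unfolded P_def] eN[unfolded N_def] eq)+)
  then have "AE u in nu. ennreal (f u) = ennreal (- f u)"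
    unfolding P_def N_def by (intro nu.density_unique) auto
  then show ?thesis
  proof eventually_elim
    case (elim u)
    then show ?case by (cases "0 \<le> f u") (auto simp: ennreal_neg ennreal_eq_0_iff)
  qed
qed

theorem laguerre_basis: "L2_orthonormal_basis nu laguerre"
  unfolding L2_orthonormal_basis_def
  using laguerre_L2 laguerre_orthonormal laguerre_complete by blast

section \<open>Dixon's summation of a well-poised series\<close>

lemma pochhammer_mono_real:
  fixes a b :: real
  assumes "0 \<le> a" "a \<le> b"
  shows "pochhammer a n \<le> pochhammer b n"
  unfolding pochhammer_prod using assms by (intro prod_mono) auto

lemma pochhammer_ratio_asymp:
  fixes a b :: real
  assumes "0 < a" "0 < b"
  shows "(\<lambda>n. pochhammer a n / pochhammer b n * real n powr (b - a)) \<longlonglongrightarrow> Gamma b / Gamma a"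
proof -
  have nz: "Gamma a \<noteq> 0" "Gamma b \<noteq> 0" using Gamma_real_pos[OF assms(1)] Gamma_real_pos[OF assms(2)] by auto
  have "(\<lambda>n. Gamma_series' b n / Gamma_series' a n) \<longlonglongrightarrow> Gamma b / Gamma a"
    by (intro tendsto_divide Gamma_series'_LIMSEQ nz)
  moreover have "\<forall>\<^sub>F n in sequentially. Gamma_series' b n / Gamma_series' a n
      = pochhammer a n / pochhammer b n * real n powr (b - a)"
  proof (rule eventually_sequentiallyI[of 1])
    fix n :: nat assume "1 \<le> n"
    then have "real n powr (b - a) = exp (b * ln (real n)) / exp (a * ln (real n))"
      by (simp add: powr_def left_diff_distrib exp_diff)
    then show "Gamma_series' b n / Gamma_series' a n
      = pochhammer a n / pochhammer b n * real n powr (b - a)"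
      by (simp add: Gamma_series'_def)
  qed
  ultimately show ?thesis by (rule Lim_transform_eventually)
qed

lemma Gamma_ratio_asymp:
  fixes a b :: real
  assumes "0 < a" "0 < b"
  shows "(\<lambda>n. Gamma (a + real n) / Gamma (b + real n) * real n powr (b - a)) \<longlonglongrightarrow> 1"
proof -
  have pos: "0 < Gamma a" "0 < Gamma b" using assms by (auto intro: Gamma_real_pos)
  have ni: "a \<notin> \<int>\<^sub>\<le>\<^sub>0" "b \<notin> \<int>\<^sub>\<le>\<^sub>0" using assms by (auto elim!: nonpos_Ints_cases)
  have sh: "Gamma (a + real n) = Gamma a * pochhammer a n" "Gamma (b + real n) = Gamma b * pochhammer b n" for n
    using pochhammer_Gamma[OF ni(1), of n] pochhammer_Gamma[OF ni(2), of n] pos by auto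
  have "(\<lambda>n. Gamma a / Gamma b * (pochhammer a n / pochhammer b n * real n powr (b - a)))
      \<longlonglongrightarrow> Gamma a / Gamma b * (Gamma b / Gamma a)"
    by (intro tendsto_mult tendsto_const pochhammer_ratio_asymp assms)
  then show ?thesis using pos by (simp add: sh mult.assoc)
qed

text \<open>
  \<open>dixon_term A B C n\<close> is the general term of the hypergeometric series
  \<open>\<^sub>3F\<^sub>2(A, B, C; 1 + A - B, 1 + A - C; 1)\<close>.
\<close>

definition dixon_term :: "real \<Rightarrow> real \<Rightarrow> real \<Rightarrow> nat \<Rightarrow> real" where
  "dixon_term A B C n = pochhammer A n * pochhammer B n * pochhammer C n /
     (fact n * pochhammer (1 + A - B) n * pochhammer (1 + A - C) n)"

definition dixon_value :: "real \<Rightarrow> real \<Rightarrow> real \<Rightarrow> real" where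
  "dixon_value A B C = Gamma (1 + A / 2) * Gamma (1 + A / 2 - B - C) * Gamma (1 + A - B) * Gamma (1 + A - C) /
     (Gamma (1 + A) * Gamma (1 + A - B - C) * Gamma (1 + A / 2 - B) * Gamma (1 + A / 2 - C))"

text \<open>
  Replacing \<open>A\<close> by \<open>A + 2\<close> multiplies the sum by a rational function of the parameters. This is shown by
  creative telescoping: a linear combination of the two terms is the difference in \<open>n\<close> of the
  certificate \<open>dixon_cert\<close>, a rational function of \<open>n\<close> times \<open>dixon_term\<close>. The coefficients of
  \<open>dixon_poly\<close> were found by solving the resulting linear equations.
\<close>

definition dixon_poly :: "real \<Rightarrow> real \<Rightarrow> real \<Rightarrow> real \<Rightarrow> real" where
  "dixon_poly A B C n = A * n\<^sup>2 + A * (3 * A + 3 - 2 * (B + C)) * n +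
     (2 * A^3 + 3 * A\<^sup>2 - 2 * A\<^sup>2 * (B + C) - A + A * (B + C) - A * B * C - 2 + 4 * (B + C)
       - 2 * (B\<^sup>2 + C\<^sup>2) - 6 * B * C + 2 * B * C\<^sup>2 + 2 * B\<^sup>2 * C)"

lemma dixon_poly_identity:
  "(A + n) * (A + n + 1) * (1 + A - B - C) * (2 + A - B - C) * (2 + A - 2 * B) * (2 + A - 2 * C)
     - A * (A + 2 - 2 * B - 2 * C) * ((1 + A - B + n) * (2 + A - B + n) * (1 + A - C + n) * (2 + A - C + n))
   = dixon_poly A B C (n + 1) * (A + n) * (B + n) * (C + n)
     - n * dixon_poly A B C n * (2 + A - B + n) * (2 + A - C + n)"
proof -
  \<comment> \<open>both sides are symmetric in \<open>B\<close> and \<open>C\<close>; in \<open>s\<close> and \<open>p\<close> the expanded polynomials are much shorter\<close>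
  define s p where "s = B + C" and "p = B * C"
  define P where "P n = A * n\<^sup>2 + A * (3 * A + 3 - 2 * s) * n +
     (2 * A^3 + 3 * A\<^sup>2 - 2 * A\<^sup>2 * s - A + A * s - A * p - 2 + 4 * s
       - 2 * s\<^sup>2 - 2 * p + 2 * s * p)" for n
  have P: "dixon_poly A B C n = P n" for n
    unfolding dixon_poly_def P_def s_def p_def by (simp add: algebra_simps power2_eq_square power3_eq_cube)
  have e: "(B + n) * (C + n) = p + s * n + n\<^sup>2"
    "(1 + A - B + n) * (1 + A - C + n) = (1 + A + n)\<^sup>2 - s * (1 + A + n) + p"
    "(2 + A - B + n) * (2 + A - C + n) = (2 + A + n)\<^sup>2 - s * (2 + A + n) + p"
    "(2 + A - 2 * B) * (2 + A - 2 * C) = (2 + A)\<^sup>2 - 2 * s * (2 + A) + 4 * p"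
    unfolding s_def p_def by (simp_all add: algebra_simps power2_eq_square)
  have "(A + n) * (A + n + 1) * (1 + A - s) * (2 + A - s) * ((2 + A)\<^sup>2 - 2 * s * (2 + A) + 4 * p)
     - A * (A + 2 - 2 * s) * (((1 + A + n)\<^sup>2 - s * (1 + A + n) + p) * ((2 + A + n)\<^sup>2 - s * (2 + A + n) + p))
   = P (n + 1) * (A + n) * (p + s * n + n\<^sup>2) - n * P n * ((2 + A + n)\<^sup>2 - s * (2 + A + n) + p)"
    unfolding P_def by (simp add: algebra_simps power2_eq_square power3_eq_cube)
  then have "(A + n) * (A + n + 1) * (1 + A - s) * (2 + A - s) * ((2 + A - 2 * B) * (2 + A - 2 * C))
     - A * (A + 2 - 2 * s) * (((1 + A - B + n) * (1 + A - C + n)) * ((2 + A - B + n) * (2 + A - C + n)))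
   = P (n + 1) * (A + n) * ((B + n) * (C + n)) - n * P n * ((2 + A - B + n) * (2 + A - C + n))"
    unfolding e .
  moreover have "1 + A - s = 1 + A - B - C" "2 + A - s = 2 + A - B - C" "A + 2 - 2 * s = A + 2 - 2 * B - 2 * C"
    by (simp_all add: s_def)
  ultimately show ?thesis unfolding P by (simp only: ac_simps)
qed

definition dixon_cert :: "real \<Rightarrow> real \<Rightarrow> real \<Rightarrow> nat \<Rightarrow> real" where
  "dixon_cert A B C n = real n * dixon_poly A B C (real n) /
     ((1 + A - B + real n) * (1 + A - C + real n)) * dixon_term A B C n"

definition dixon_step :: "real \<Rightarrow> real \<Rightarrow> real \<Rightarrow> real" where
  "dixon_step A B C = A * (A + 1) * (1 + A - B - C) * (2 + A - B - C) * (2 + A - 2 * B) * (2 + A - 2 * C) /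
     ((1 + A - B) * (2 + A - B) * (1 + A - C) * (2 + A - C))"

lemma dixon_term_Suc:
  assumes "0 < 1 + A - B" "0 < 1 + A - C"
  shows "dixon_term A B C (Suc n) = dixon_term A B C n *
    ((A + real n) * (B + real n) * (C + real n) / ((real n + 1) * (1 + A - B + real n) * (1 + A - C + real n)))"
  using pochhammer_pos[OF assms(1), of n] pochhammer_pos[OF assms(2), of n] assms
  unfolding dixon_term_def by (simp add: pochhammer_Suc field_simps)

lemma pochhammer_shift2:
  fixes a :: real
  assumes "0 < a"
  shows "pochhammer (a + 2) n = pochhammer a n * ((a + real n) * (a + 1 + real n) / (a * (a + 1)))"
proof -
  have "pochhammer a (Suc (Suc n)) = a * ((a + 1) * pochhammer (a + 1 + 1) n)"
    by (simp only: pochhammer_rec)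
  moreover have "pochhammer a (Suc (Suc n)) = pochhammer a n * (a + real n) * (a + 1 + real n)"
    by (simp add: pochhammer_Suc add.assoc add.commute)
  ultimately have "a * (a + 1) * pochhammer (a + 2) n = pochhammer a n * ((a + real n) * (a + 1 + real n))"
    by (simp add: add.assoc mult.assoc)
  then show ?thesis using assms by (simp add: divide_simps mult.commute)
qed

lemma dixon_term_shift:
  assumes "0 < A" "0 < 1 + A - B" "0 < 1 + A - C"
  shows "dixon_step A B C * dixon_term (A + 2) B C n =
    dixon_term A B C n * ((A + real n) * (A + real n + 1) * (1 + A - B - C) * (2 + A - B - C) * (2 + A - 2 * B) * (2 + A - 2 * C) /
      ((1 + A - B + real n) * (2 + A - B + real n) * (1 + A - C + real n) * (2 + A - C + real n)))"
proof -
  define x y where "x = 1 + A - B" and "y = 1 + A - C"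
  have xy: "0 < x" "0 < y" using assms by (simp_all add: x_def y_def)
  have e: "1 + (A + 2) - B = x + 2" "1 + (A + 2) - C = y + 2" "2 + A - B = x + 1" "2 + A - C = y + 1"
    "1 + A - B = x" "1 + A - C = y" by (simp_all add: x_def y_def)
  define K where "K = (1 + A - B - C) * (2 + A - B - C) * (2 + A - 2 * B) * (2 + A - 2 * C)"
  have step: "dixon_step A B C = A * (A + 1) * K / (x * (x + 1) * y * (y + 1))"
    unfolding dixon_step_def e K_def by (simp add: mult.assoc)
  have pos: "0 < pochhammer x n" "0 < pochhammer y n" "0 < x + real n" "0 < y + real n"
    using xy by (auto intro!: pochhammer_pos)
  have "dixon_step A B C * dixon_term (A + 2) B C n
    = dixon_term A B C n * ((A + real n) * (A + real n + 1) * K / ((x + real n) * (x + 1 + real n) * (y + real n) * (y + 1 + real n)))"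
    unfolding step dixon_term_def e pochhammer_shift2[OF xy(1)] pochhammer_shift2[OF xy(2)] pochhammer_shift2[OF assms(1)]
    using assms(1) xy pos by (simp add: divide_simps)
  then show ?thesis unfolding e K_def by (simp add: mult.assoc)
qed

lemma dixon_telescope:
  assumes "0 < A" "0 < 1 + A - B" "0 < 1 + A - C"
  shows "dixon_step A B C * dixon_term (A + 2) B C n - A * (A + 2 - 2 * B - 2 * C) * dixon_term A B C n
    = dixon_cert A B C (Suc n) - dixon_cert A B C n"
proof -
  define x y m where "x = 1 + A - B" and "y = 1 + A - C" and "m = real n"
  have pos: "0 < x + m" "0 < y + m" "0 < x + 1 + m" "0 < y + 1 + m" "0 < m + 1"
    using assms by (simp_all add: x_def y_def m_def)
  have e: "2 + A - B = x + 1" "2 + A - C = y + 1" "1 + A - B = x" "1 + A - C = y"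
    by (simp_all add: x_def y_def)
  define K where "K = (1 + A - B - C) * (2 + A - B - C) * (2 + A - 2 * B) * (2 + A - 2 * C)"
  define T where "T = dixon_term A B C n"
  define D where "D = (x + m) * (x + 1 + m) * (y + m) * (y + 1 + m)"
  have D: "0 < D" using pos by (simp add: D_def)
  define P P' where "P = dixon_poly A B C m" and "P' = dixon_poly A B C (m + 1)"
  have idn: "(A + m) * (A + m + 1) * K - A * (A + 2 - 2 * B - 2 * C) * D
      = P' * (A + m) * (B + m) * (C + m) - m * P * (x + 1 + m) * (y + 1 + m)"
    using dixon_poly_identity[of A m B C] unfolding e K_def D_def P_def P'_def by (simp add: mult.assoc)
  have "dixon_cert A B C (Suc n) = T * ((m + 1) * P' / ((x + (m + 1)) * (y + (m + 1)))
      * ((A + m) * (B + m) * (C + m) / ((m + 1) * (x + m) * (y + m))))"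
    unfolding dixon_cert_def dixon_term_Suc[OF assms(2,3)] T_def P'_def m_def x_def y_def
    by (simp add: ac_simps)
  also have "\<dots> = T * (P' * (A + m) * (B + m) * (C + m)) / D"
    using pos by (simp add: D_def divide_simps) (simp add: algebra_simps)
  finally have c1: "dixon_cert A B C (Suc n) = T * (P' * (A + m) * (B + m) * (C + m)) / D" .
  have c0: "dixon_cert A B C n = T * (m * P * (x + 1 + m) * (y + 1 + m)) / D"
    unfolding dixon_cert_def e T_def[symmetric] P_def[symmetric] m_def[symmetric] D_def
    using pos by (simp add: divide_simps)
  have s1: "dixon_step A B C * dixon_term (A + 2) B C n = T * ((A + m) * (A + m + 1) * K) / D"
    unfolding dixon_term_shift[OF assms] e T_def[symmetric] m_def[symmetric] D_def K_def by (simp add: mult.assoc)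
  have s0: "A * (A + 2 - 2 * B - 2 * C) * T = T * (A * (A + 2 - 2 * B - 2 * C) * D) / D"
    using D by simp
  have "dixon_step A B C * dixon_term (A + 2) B C n - A * (A + 2 - 2 * B - 2 * C) * T
    = T * ((A + m) * (A + m + 1) * K - A * (A + 2 - 2 * B - 2 * C) * D) / D"
    unfolding s1 s0 diff_divide_distrib[symmetric] by (simp only: right_diff_distrib)
  also have "\<dots> = dixon_cert A B C (Suc n) - dixon_cert A B C n"
    unfolding idn c1 c0 by (simp add: diff_divide_distrib[symmetric] right_diff_distrib)
  finally show ?thesis by (simp add: T_def)
qed

text \<open>
  Each of the three quotients of Pochhammer symbols is asymptotic to a power of \<open>n\<close>; the exponents add up
  to \<open>- (3 + A - 2 B - 2 C)\<close>.
\<close>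

lemma dixon_term_asymp:
  assumes "0 < A" "0 < B" "0 < C" "0 < 1 + A - B" "0 < 1 + A - C"
  obtains c where "(\<lambda>n. dixon_term A B C n * real n powr (3 + A - 2 * B - 2 * C)) \<longlonglongrightarrow> c"
proof -
  define x y where "x = 1 + A - B" and "y = 1 + A - C"
  have xy: "0 < x" "0 < y" using assms by (simp_all add: x_def y_def)
  have "(\<lambda>n. (pochhammer A n / pochhammer 1 n * real n powr (1 - A)) *
      (pochhammer B n / pochhammer x n * real n powr (x - B)) *
      (pochhammer C n / pochhammer y n * real n powr (y - C)))
    \<longlonglongrightarrow> Gamma 1 / Gamma A * (Gamma x / Gamma B) * (Gamma y / Gamma C)"
    using assms xy by (intro tendsto_mult pochhammer_ratio_asymp) auto
  moreover have "(pochhammer A n / pochhammer 1 n * real n powr (1 - A)) *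
      (pochhammer B n / pochhammer x n * real n powr (x - B)) *
      (pochhammer C n / pochhammer y n * real n powr (y - C))
    = dixon_term A B C n * real n powr (3 + A - 2 * B - 2 * C)" for n
  proof -
    have e: "3 + A - 2 * B - 2 * C = (1 - A) + (x - B) + (y - C)" by (simp add: x_def y_def)
    have "pochhammer (1::real) n = fact n" by (simp add: pochhammer_fact)
    then show ?thesis
      unfolding dixon_term_def e x_def[symmetric] y_def[symmetric] by (simp only: powr_add) simp
  qed
  ultimately show thesis using that by simp
qed

lemma dixon_term_summable:
  assumes "0 < A" "0 < B" "0 < C" "0 < 1 + A / 2 - B - C"
  shows "summable (dixon_term A B C)" "(\<lambda>n. real n * dixon_term A B C n) \<longlonglongrightarrow> 0"
proof -
  have xy: "0 < 1 + A - B" "0 < 1 + A - C" using assms by auto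
  define E where "E = 3 + A - 2 * B - 2 * C"
  have E: "1 < E" using assms by (simp add: E_def)
  obtain c where c: "(\<lambda>n. dixon_term A B C n * real n powr E) \<longlonglongrightarrow> c"
    using dixon_term_asymp[OF assms(1-3) xy] unfolding E_def by blast
  then obtain M where M: "\<And>n. \<bar>dixon_term A B C n * real n powr E\<bar> \<le> M"
    using convergent_imp_Bseq[of "\<lambda>n. dixon_term A B C n * real n powr E"]
    unfolding convergent_def Bseq_def real_norm_def by blast
  have "summable (\<lambda>n. M * real n powr (- E))"
    using E by (intro summable_mult) (simp add: summable_real_powr_iff)
  then show "summable (dixon_term A B C)"
  proof (rule summable_comparison_test'[where N = 1])
    fix n :: nat assume n: "1 \<le> n"
    have "\<bar>dixon_term A B C n\<bar> * real n powr E \<le> M" using M[of n] by (simp add: abs_mult)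
    then show "norm (dixon_term A B C n) \<le> M * real n powr (- E)"
      using n by (simp add: powr_minus field_simps)
  qed
  have "(\<lambda>n. real n powr (1 - E)) \<longlonglongrightarrow> 0"
    using E by (intro tendsto_neg_powr filterlim_real_sequentially) simp
  with c have "(\<lambda>n. dixon_term A B C n * real n powr E * real n powr (1 - E)) \<longlonglongrightarrow> c * 0"
    by (rule tendsto_mult)
  moreover have "\<forall>\<^sub>F n in sequentially. dixon_term A B C n * real n powr E * real n powr (1 - E)
    = real n * dixon_term A B C n"
  proof (rule eventually_sequentiallyI[of 1])
    fix n :: nat assume "1 \<le> n"
    then have "real n powr E * real n powr (1 - E) = real n" by (simp add: powr_add[symmetric])
    then show "dixon_term A B C n * real n powr E * real n powr (1 - E) = real n * dixon_term A B C n"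
      by (metis mult.assoc mult.commute)
  qed
  ultimately show "(\<lambda>n. real n * dixon_term A B C n) \<longlonglongrightarrow> 0"
    by (simp add: tendsto_cong)
qed

lemma dixon_cert_tendsto_0:
  assumes "0 < A" "0 < B" "0 < C" "0 < 1 + A / 2 - B - C"
  shows "dixon_cert A B C \<longlonglongrightarrow> 0"
proof -
  define c0 c1 x y where "c0 = dixon_poly A B C 0" and "c1 = A * (3 * A + 3 - 2 * (B + C))"
    and "x = 1 + A - B" and "y = 1 + A - C"
  have "(\<lambda>n. (A * (real n)\<^sup>2 + c1 * real n + c0) / ((x + real n) * (y + real n))) \<longlonglongrightarrow> A"
    using assms(1) by real_asymp
  then have "(\<lambda>n. (A * (real n)\<^sup>2 + c1 * real n + c0) / ((x + real n) * (y + real n)) * (real n * dixon_term A B C n)) \<longlonglongrightarrow> A * 0"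
    by (rule tendsto_mult[OF _ dixon_term_summable(2)[OF assms]])
  moreover have "dixon_cert A B C = (\<lambda>n. (A * (real n)\<^sup>2 + c1 * real n + c0) / ((x + real n) * (y + real n)) * (real n * dixon_term A B C n))"
    by (rule ext) (simp add: dixon_cert_def x_def y_def c0_def c1_def dixon_poly_def)
  ultimately show ?thesis by simp
qed

lemma dixon_sum_step:
  assumes "0 < A" "0 < B" "0 < C" "0 < 1 + A / 2 - B - C"
  shows "dixon_step A B C * suminf (dixon_term (A + 2) B C)
    = A * (A + 2 - 2 * B - 2 * C) * suminf (dixon_term A B C)"
proof -
  have "(\<lambda>n. dixon_cert A B C (Suc n) - dixon_cert A B C n) sums (0 - dixon_cert A B C 0)"
    by (rule telescope_sums[OF dixon_cert_tendsto_0[OF assms]])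
  then have "(\<lambda>n. dixon_step A B C * dixon_term (A + 2) B C n - A * (A + 2 - 2 * B - 2 * C) * dixon_term A B C n) sums 0"
    using assms by (subst dixon_telescope) (auto simp: dixon_cert_def)
  moreover have "(\<lambda>n. dixon_step A B C * dixon_term (A + 2) B C n - A * (A + 2 - 2 * B - 2 * C) * dixon_term A B C n)
    sums (dixon_step A B C * suminf (dixon_term (A + 2) B C) - A * (A + 2 - 2 * B - 2 * C) * suminf (dixon_term A B C))"
    using assms by (intro sums_diff sums_mult summable_sums dixon_term_summable) (auto simp: add_divide_distrib)
  ultimately have "dixon_step A B C * suminf (dixon_term (A + 2) B C) - A * (A + 2 - 2 * B - 2 * C) * suminf (dixon_term A B C) = 0"
    by (rule sums_unique2[symmetric])
  then show ?thesis by simp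
qed

lemma Gamma_plus1_real: "0 < z \<Longrightarrow> Gamma (z + 1) = z * Gamma z" for z :: real
  by (rule Gamma_plus1) (auto elim!: nonpos_Ints_cases)

lemma dixon_value_step:
  assumes "0 < A" "0 < B" "0 < C" "0 < 1 + A / 2 - B - C"
  shows "dixon_step A B C * dixon_value (A + 2) B C
    = A * (A + 2 - 2 * B - 2 * C) * dixon_value A B C" "0 < dixon_step A B C" "0 < dixon_value A B C"
proof -
  define p q r s t u v w where "p = 1 + A / 2" and "q = 1 + A / 2 - B - C" and "r = 1 + A - B" and "s = 1 + A - C"
    and "t = 1 + A" and "u = 1 + A - B - C" and "v = 1 + A / 2 - B" and "w = 1 + A / 2 - C"
  have pos: "0 < p" "0 < q" "0 < r" "0 < s" "0 < t" "0 < u" "0 < v" "0 < w"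
    using assms by (auto simp: p_def q_def r_def s_def t_def u_def v_def w_def)
  have g2: "Gamma (z + 2) = (z + 1) * (z * Gamma z)" if "0 < z" for z :: real
    using Gamma_plus1_real[of "z + 1"] Gamma_plus1_real[of z] that by (simp add: add.commute)
  have G: "Gamma p > 0" "Gamma q > 0" "Gamma r > 0" "Gamma s > 0" "Gamma t > 0" "Gamma u > 0" "Gamma v > 0" "Gamma w > 0"
    using pos by (auto intro: Gamma_real_pos)
  have val: "dixon_value A B C = Gamma p * Gamma q * Gamma r * Gamma s / (Gamma t * Gamma u * Gamma v * Gamma w)"
    by (simp add: dixon_value_def p_def q_def r_def s_def t_def u_def v_def w_def)
  then show "0 < dixon_value A B C" using G by simp
  have "dixon_value (A + 2) B C = Gamma (p + 1) * Gamma (q + 1) * Gamma (r + 2) * Gamma (s + 2) /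
      (Gamma (t + 2) * Gamma (u + 2) * Gamma (v + 1) * Gamma (w + 1))"
    unfolding dixon_value_def p_def q_def r_def s_def t_def u_def v_def w_def by (simp add: add_divide_distrib algebra_simps)
  also have "\<dots> = p * q * (r * (r + 1)) * (s * (s + 1)) / (t * (t + 1) * (u * (u + 1)) * v * w) * dixon_value A B C"
    using pos G unfolding val by (simp add: g2 Gamma_plus1_real divide_simps)
  finally have v2: "dixon_value (A + 2) B C
    = p * q * (r * (r + 1)) * (s * (s + 1)) / (t * (t + 1) * (u * (u + 1)) * v * w) * dixon_value A B C" .
  have e: "1 + A - B = r" "2 + A - B = r + 1" "1 + A - C = s" "2 + A - C = s + 1" "A + 1 = t" "r - C = u"
    "r + 1 - C = u + 1" "2 + A - 2 * B = 2 * v" "2 + A - 2 * C = 2 * w" "A + 2 - 2 * B - 2 * C = 2 * q"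
    by (simp_all add: r_def s_def t_def u_def v_def w_def q_def)
  have st: "dixon_step A B C = A * t * u * (u + 1) * (2 * v) * (2 * w) / (r * (r + 1) * s * (s + 1))"
    unfolding dixon_step_def e by simp
  show "0 < dixon_step A B C" unfolding st using pos assms(1) by simp
  have "t + 1 = 2 * p" by (simp add: t_def p_def)
  show "dixon_step A B C * dixon_value (A + 2) B C = A * (A + 2 - 2 * B - 2 * C) * dixon_value A B C"
    unfolding st v2 e \<open>t + 1 = 2 * p\<close> using pos assms(1) by (simp add: divide_simps)
qed

text \<open>
  As \<open>A\<close> grows only the term \<open>n = 0\<close> survives. For \<open>A \<ge> 2 C + 1\<close> the term is dominated by
  \<open>pochhammer C n / pochhammer (C + 2) n\<close>, which is of order \<open>1 / n\<^sup>2\<close>.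
\<close>

lemma dixon_sum_limit:
  assumes "0 < A" "0 < B" "B \<le> 1" "0 < C"
  shows "(\<lambda>m. suminf (dixon_term (A + 2 * real m) B C)) \<longlonglongrightarrow> 1"
proof -
  define h where "h n = C * (C + 1) / ((C + real n) * (C + real n + 1))" for n
  have h_eq: "pochhammer C n / pochhammer (C + 2) n = h n" for n
    using assms(4) pochhammer_pos[OF assms(4), of n]
    unfolding pochhammer_shift2[OF assms(4)] h_def by (simp add: divide_simps)
  have h_sum: "summable h"
  proof -
    have "(\<lambda>n. C * (C + 1) * (1 / (C + real n) - 1 / (C + real (Suc n)))) sums (C * (C + 1) * (1 / (C + real 0) - 0))"
      by (intro sums_mult telescope_sums') real_asymp
    moreover have "(\<lambda>n. C * (C + 1) * (1 / (C + real n) - 1 / (C + real (Suc n)))) = h"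
      using assms(4) by (auto simp: h_def field_simps fun_eq_iff)
    ultimately show ?thesis by (metis sums_summable)
  qed
  have bound: "0 \<le> dixon_term A' B C n \<and> dixon_term A' B C n \<le> pochhammer C n / pochhammer (1 + A' - C) n"
    if A': "2 * C + 1 \<le> A'" for A' n
  proof -
    have pos: "0 < pochhammer (1 + A' - B) n" "0 < pochhammer (1 + A' - C) n" "0 < pochhammer A' n"
        "0 < pochhammer B n" "0 < pochhammer C n"
      using A' assms by (auto intro!: pochhammer_pos)
    have a: "pochhammer A' n / pochhammer (1 + A' - B) n \<le> 1"
      using pos A' assms by (simp add: pochhammer_mono_real)
    have b: "pochhammer B n / fact n \<le> 1"
      using pochhammer_mono_real[of B 1 n] assms by (simp add: pochhammer_fact[symmetric])
    have eq: "dixon_term A' B C n = (pochhammer A' n / pochhammer (1 + A' - B) n) * (pochhammer B n / fact n)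
        * (pochhammer C n / pochhammer (1 + A' - C) n)"
      by (simp add: dixon_term_def)
    have "(pochhammer A' n / pochhammer (1 + A' - B) n) * (pochhammer B n / fact n) \<le> 1 * 1"
      using pos by (intro mult_mono a b) auto
    then have "dixon_term A' B C n \<le> 1 * (pochhammer C n / pochhammer (1 + A' - C) n)"
      unfolding eq using pos by (intro mult_right_mono) auto
    moreover have "0 \<le> dixon_term A' B C n" unfolding eq using pos by auto
    ultimately show ?thesis by simp
  qed
  obtain m0 where m0: "\<And>m. m \<ge> m0 \<Longrightarrow> 2 * C + 1 \<le> A + 2 * real m"
  proof -
    obtain m0 :: nat where "C \<le> real m0" using real_arch_simple by blast
    then show thesis using assms(1) by (intro that[of "m0 + 1"]) auto
  qed
  have "(\<lambda>m. suminf (\<lambda>n. dixon_term (A + 2 * real m) B C n)) \<longlonglongrightarrow> suminf (\<lambda>n. if n = 0 then 1 else 0)"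
  proof (rule tannerys_theorem[where M = h and F = sequentially, THEN conjunct2, THEN conjunct2])
    fix n :: nat
    show "((\<lambda>m. dixon_term (A + 2 * real m) B C n) \<longlongrightarrow> (if n = 0 then 1 else 0)) sequentially"
    proof (cases n)
      case 0
      then show ?thesis by (simp add: dixon_term_def)
    next
      case (Suc k)
      have lim: "(\<lambda>m. pochhammer C n / (1 + (A + 2 * real m) - C)) \<longlonglongrightarrow> 0"
        by real_asymp
      have le: "norm (dixon_term (A + 2 * real m) B C n) \<le> pochhammer C n / (1 + (A + 2 * real m) - C)"
        if m: "m0 \<le> m" for m
      proof -
        note A' = m0[OF m]
        have ge1: "1 \<le> 1 + (A + 2 * real m) - C" using A' assms(4) by linarith
        have "1 \<le> pochhammer (1 + (1 + (A + 2 * real m) - C)) k"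
          using pochhammer_mono_real[of 1 "1 + (1 + (A + 2 * real m) - C)" k] ge1
          by (simp add: pochhammer_fact[symmetric]) (meson fact_ge_1 order_trans)
        then have "(1 + (A + 2 * real m) - C) * 1 \<le> (1 + (A + 2 * real m) - C) * pochhammer (1 + (1 + (A + 2 * real m) - C)) k"
          using ge1 by (intro mult_left_mono) auto
        then have "1 + (A + 2 * real m) - C \<le> pochhammer (1 + (A + 2 * real m) - C) n"
          unfolding Suc pochhammer_rec by (simp add: add.commute)
        then have "pochhammer C n / pochhammer (1 + (A + 2 * real m) - C) n \<le> pochhammer C n / (1 + (A + 2 * real m) - C)"
          using ge1 pochhammer_pos[OF assms(4), of n] by (intro divide_left_mono mult_pos_pos) auto
        then show ?thesis using bound[OF A', of n] by simp
      qed
      have "(\<lambda>m. dixon_term (A + 2 * real m) B C n) \<longlonglongrightarrow> 0"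
        by (rule Lim_null_comparison[OF _ lim]) (use le in \<open>auto intro!: eventually_sequentiallyI[of m0]\<close>)
      then show ?thesis using Suc by simp
    qed
  next
    have "norm (dixon_term (A + 2 * real m) B C n) \<le> h n" if m: "m0 \<le> m" for n m
    proof -
      note A' = m0[OF m]
      have "pochhammer C n / pochhammer (1 + (A + 2 * real m) - C) n \<le> pochhammer C n / pochhammer (C + 2) n"
        using A' assms(4) pochhammer_pos[OF assms(4), of n]
        by (intro divide_left_mono pochhammer_mono_real mult_pos_pos pochhammer_pos) auto
      then show ?thesis using bound[OF A', of n] by (simp add: h_eq)
    qed
    then show "\<forall>\<^sub>F (n, m) in at_top \<times>\<^sub>F sequentially. norm (dixon_term (A + 2 * real m) B C n) \<le> h n"
      by (intro eventually_prodI[OF eventually_True eventually_ge_at_top[of m0], THEN eventually_mono]) auto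
    show "summable h" by (rule h_sum)
  qed auto
  moreover have "(\<Sum>n. if n = 0 then 1 else 0 :: real) = 1"
    by (subst suminf_finite[of "{0}"]) auto
  ultimately show ?thesis by simp
qed

text \<open>
  The eight Gamma factors pair off so that the powers in their asymptotics cancel.
\<close>

lemma dixon_value_limit:
  assumes "0 < A" "0 < B" "0 < C" "0 < 1 + A / 2 - B - C"
  shows "(\<lambda>m. dixon_value (A + 2 * real m) B C) \<longlonglongrightarrow> 1"
proof -
  define g where "g a b m = Gamma (a + real m) / Gamma (b + real m) * real m powr (b - a)" for a b and m :: nat
  have g: "g a b \<longlonglongrightarrow> 1" if "0 < a" "0 < b" for a b :: real
    unfolding g_def[abs_def] by (rule Gamma_ratio_asymp[OF that])
  have g2: "(\<lambda>m. g a b (2 * m)) \<longlonglongrightarrow> 1" if "0 < a" "0 < b" for a b :: real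
    using LIMSEQ_subseq_LIMSEQ[OF g[OF that], of "\<lambda>m. 2 * m"] by (simp add: strict_mono_def o_def)
  have "(\<lambda>m. g (1 + A / 2) (1 + A / 2 - B) m * g (1 + A / 2 - B - C) (1 + A / 2 - C) m
      * (g (1 + A - B) (1 + A) (2 * m) * g (1 + A - C) (1 + A - B - C) (2 * m))) \<longlonglongrightarrow> 1 * 1 * (1 * 1)"
    using assms by (intro tendsto_mult g g2) auto
  moreover have "\<forall>\<^sub>F m in sequentially. g (1 + A / 2) (1 + A / 2 - B) m * g (1 + A / 2 - B - C) (1 + A / 2 - C) m
      * (g (1 + A - B) (1 + A) (2 * m) * g (1 + A - C) (1 + A - B - C) (2 * m)) = dixon_value (A + 2 * real m) B C"
  proof (rule eventually_sequentiallyI[of 1])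
    fix m :: nat assume m: "1 \<le> m"
    have p: "real m powr (- B) * real m powr B = 1" "real (2 * m) powr B * real (2 * m) powr (- B) = 1"
      using m by (simp_all add: powr_add[symmetric])
    have "g (1 + A / 2) (1 + A / 2 - B) m * g (1 + A / 2 - B - C) (1 + A / 2 - C) m
      * (g (1 + A - B) (1 + A) (2 * m) * g (1 + A - C) (1 + A - B - C) (2 * m))
      = dixon_value (A + 2 * real m) B C * ((real m powr (- B) * real m powr B) * (real (2 * m) powr B * real (2 * m) powr (- B)))"
      unfolding g_def dixon_value_def by (simp add: add_divide_distrib algebra_simps)
    then show "g (1 + A / 2) (1 + A / 2 - B) m * g (1 + A / 2 - B - C) (1 + A / 2 - C) m
      * (g (1 + A - B) (1 + A) (2 * m) * g (1 + A - C) (1 + A - B - C) (2 * m)) = dixon_value (A + 2 * real m) B C"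
      unfolding p by simp
  qed
  ultimately show ?thesis by (simp add: tendsto_cong)
qed

text \<open>
  The quotient of the sum and the proposed value is unchanged by \<open>A \<mapsto> A + 2\<close> and tends to \<open>1\<close> under
  iteration, so it equals \<open>1\<close>.
\<close>

theorem dixon_sum:
  assumes "0 < A" "0 < B" "B \<le> 1" "0 < C" "0 < 1 + A / 2 - B - C"
  shows "dixon_term A B C sums dixon_value A B C"
proof -
  define q where "q m = suminf (dixon_term (A + 2 * real m) B C) / dixon_value (A + 2 * real m) B C" for m
  have step: "q (Suc m) = q m" for m
  proof -
    define A' where "A' = A + 2 * real m"
    have A': "0 < A'" "0 < 1 + A' / 2 - B - C" using assms by (auto simp: A'_def add_divide_distrib)
    have A2: "0 < A' + 2" "0 < 1 + (A' + 2) / 2 - B - C" using A' by (auto simp: add_divide_distrib)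
    have c: "0 < A' * (A' + 2 - 2 * B - 2 * C)" using A' by simp
    note s = dixon_sum_step[OF A'(1) assms(2,4) A'(2)]
    note v = dixon_value_step[OF A'(1) assms(2,4) A'(2)]
    note v2 = dixon_value_step[OF A2(1) assms(2,4) A2(2)]
    have "suminf (dixon_term (A' + 2) B C) / dixon_value (A' + 2) B C
      = (dixon_step A' B C * suminf (dixon_term (A' + 2) B C)) / (dixon_step A' B C * dixon_value (A' + 2) B C)"
      using v(2) by simp
    also have "\<dots> = suminf (dixon_term A' B C) / dixon_value A' B C"
      unfolding s v(1) by (rule mult_divide_mult_cancel_left) (rule less_imp_neq[OF c, symmetric])
    finally show ?thesis by (simp add: q_def A'_def algebra_simps)
  qed
  have "q m = q 0" for m by (induction m) (simp_all add: step)
  moreover have "q \<longlonglongrightarrow> 1 / 1"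
    unfolding q_def[abs_def] using assms by (intro tendsto_divide dixon_sum_limit dixon_value_limit) auto
  ultimately have "q 0 = 1" by (metis LIMSEQ_const_iff LIMSEQ_unique div_by_1 ext)
  then have "suminf (dixon_term A B C) = dixon_value A B C"
    using dixon_value_step(3)[OF assms(1,2,4,5)] by (simp add: q_def)
  then show ?thesis using dixon_term_summable(1)[OF assms(1,2,4,5)] by (simp add: sums_iff)
qed

section \<open>Integrals of the kernel against the exponential distribution\<close>

definition kfun :: "real \<Rightarrow> ereal \<Rightarrow> real \<Rightarrow> real" where
  "kfun \<alpha> \<kappa> r = (if \<kappa> = \<infinity> then r powr (- \<alpha>)
     else (2 * real_of_ereal \<kappa> * sinh (r / (2 * real_of_ereal \<kappa>))) powr (- \<alpha>))"

lemma kern_eq_kfun: "kern \<alpha> \<kappa> u v = kfun \<alpha> \<kappa> \<bar>u - v\<bar>"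
  by (simp add: kern_def kfun_def Let_def)

lemma kfun_nonneg: "0 \<le> kfun \<alpha> \<kappa> r"
  by (simp add: kfun_def)

lemma kfun_square: "(kfun \<alpha> \<kappa> r)\<^sup>2 = kfun (2 * \<alpha>) \<kappa> r"
proof -
  have "(x powr (- \<alpha>))\<^sup>2 = x powr (- (2 * \<alpha>))" for x :: real
    by (simp add: power2_eq_square powr_add[symmetric])
  then show ?thesis by (simp add: kfun_def)
qed

lemma sinh_measurable[measurable]: "(sinh :: real \<Rightarrow> real) \<in> borel_measurable borel"
  by (intro borel_measurable_continuous_onI continuous_intros)

lemma kfun_measurable[measurable]: "kfun \<alpha> \<kappa> \<in> borel_measurable borel"
proof (cases "\<kappa> = \<infinity>")
  case True
  then show ?thesis unfolding kfun_def[abs_def] by simp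
next
  case False
  then show ?thesis unfolding kfun_def[abs_def] by simp
qed

lemma has_integral_indicator_UNIV:
  fixes f :: "real \<Rightarrow> real"
  assumes "(f has_integral I) S"
  shows "((\<lambda>x. f x * indicator S x) has_integral I) UNIV"
proof -
  have "(\<lambda>x. f x * indicator S x) = (\<lambda>x. if x \<in> S then f x else 0)"
    by (auto simp: fun_eq_iff)
  then show ?thesis using assms by (simp only: has_integral_restrict_UNIV)
qed

lemma nu_tail: "emeasure nu {a<..} = ennreal (if a < 0 then 1 else exp (- a))"
proof (cases "a < 0")
  case True
  have "emeasure nu {a<..} = emeasure nu (space nu)"
    using True AE_nu_pos by (intro emeasure_eq_AE) (auto simp: sets_nu elim!: eventually_mono)
  then show ?thesis using True nu.emeasure_space_1 by simp
next
  case False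
  have "emeasure nu {a<..} = (\<integral>\<^sup>+u. indicator {a<..} u \<partial>nu)" by (simp add: sets_nu)
  also have "\<dots> = (\<integral>\<^sup>+u. ennreal (exp (- u)) * indicator {a<..} u * indicator {0..} u \<partial>lborel)"
    by (rule nn_integral_nu) simp
  also have "\<dots> = (\<integral>\<^sup>+u. ennreal (exp (- 1 * u) * indicator {a..} u) \<partial>lborel)"
    using False AE_lborel_singleton[of a]
    by (intro nn_integral_cong_AE) (auto split: split_indicator elim!: eventually_mono)
  also have "\<dots> = ennreal (exp (- 1 * a) / 1)"
  proof (rule nn_integral_has_integral_lborel)
    show "((\<lambda>u. exp (- 1 * u) * indicator {a..} u) has_integral exp (- 1 * a) / 1) UNIV"
      by (intro has_integral_indicator_UNIV has_integral_exp_minus_to_infinity) simp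
  qed auto
  finally show ?thesis using False by simp
qed

text \<open>The law of \<open>exp (- U / k)\<close> for an exponential variable \<open>U\<close>.\<close>

definition unit_density :: "real \<Rightarrow> real measure" where
  "unit_density k = density lborel (\<lambda>x. ennreal (k * x powr (k - 1) * indicator {0<..<1} x))"

lemma unit_density_tail:
  assumes k: "0 < k" and c: "0 \<le> c" "c \<le> 1"
  shows "emeasure (unit_density k) {0<..<c} = ennreal (c powr k)"
proof -
  have "emeasure (unit_density k) {0<..<c}
      = (\<integral>\<^sup>+x. ennreal (k * x powr (k - 1) * indicator {0<..<1} x) * indicator {0<..<c} x \<partial>lborel)"
    unfolding unit_density_def by (subst emeasure_density) auto
  also have "\<dots> = (\<integral>\<^sup>+x. ennreal (k * x powr (k - 1) * indicator {0..c} x) \<partial>lborel)"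
    using c AE_lborel_singleton[of 0] AE_lborel_singleton[of c]
    by (intro nn_integral_cong_AE) (auto split: split_indicator elim!: eventually_elim2)
  also have "\<dots> = ennreal (k * (c powr (k - 1 + 1) / (k - 1 + 1)))"
  proof (rule nn_integral_has_integral_lborel)
    have "((\<lambda>x. k * x powr (k - 1)) has_integral k * (c powr (k - 1 + 1) / (k - 1 + 1))) {0..c}"
      using k c by (intro has_integral_mult_right has_integral_powr_from_0) auto
    then show "((\<lambda>x. k * x powr (k - 1) * indicator {0..c} x) has_integral k * (c powr (k - 1 + 1) / (k - 1 + 1))) UNIV"
      by (rule has_integral_indicator_UNIV)
  qed (use k in auto)
  finally show ?thesis using k by simp
qed

lemma nu_eq_distr:
  assumes k: "0 < k"
  shows "nu = distr (unit_density k) borel (\<lambda>x. - k * ln x)"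
proof (rule measure_eqI_lessThan)
  show "sets nu = sets borel" by (rule sets_nu)
  show "emeasure nu {a<..} < \<infinity>" for a by (simp add: nu_tail)
  fix a :: real
  have [measurable_cong]: "sets (unit_density k) = sets borel" by (simp add: unit_density_def)
  have AE01: "AE x in unit_density k. x \<in> {0<..<1}"
    unfolding unit_density_def by (subst AE_density) (auto split: split_indicator)
  define c where "c = (if a < 0 then 1 else exp (- a / k))"
  have c: "0 \<le> c" "c \<le> 1" using k by (auto simp: c_def)
  have "emeasure (distr (unit_density k) borel (\<lambda>x. - k * ln x)) {a<..}
      = emeasure (unit_density k) ((\<lambda>x. - k * ln x) -` {a<..})"
    by (subst emeasure_distr) (auto simp: unit_density_def)
  also have "\<dots> = emeasure (unit_density k) {0<..<c}"
  proof (rule emeasure_eq_AE)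
    show "AE x in unit_density k. x \<in> (\<lambda>x. - k * ln x) -` {a<..} \<longleftrightarrow> x \<in> {0<..<c}"
      using AE01
    proof eventually_elim
      case (elim x)
      then have x: "0 < x" "x < 1" by auto
      show ?case
      proof (cases "a < 0")
        case True
        have "0 < - k * ln x" using k x by (simp add: mult_pos_neg)
        then show ?thesis using True x by (simp add: c_def)
      next
        case False
        have "a < - k * ln x \<longleftrightarrow> ln x * k < - a" by (auto simp: mult.commute)
        also have "\<dots> \<longleftrightarrow> ln x < - a / k" by (rule pos_less_divide_eq[OF k, symmetric])
        also have "\<dots> \<longleftrightarrow> x < exp (- a / k)" using x by (metis exp_less_cancel_iff exp_ln)
        finally show ?thesis using False x by (simp add: c_def)
      qed
    qed
    show "(\<lambda>x. - k * ln x) -` {a<..} \<in> sets (unit_density k)"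
      using measurable_sets[of "\<lambda>x. - k * ln x" borel borel "{a<..}"] by (simp add: unit_density_def)
  qed (simp add: unit_density_def)
  also have "\<dots> = ennreal (c powr k)" by (rule unit_density_tail[OF k c])
  also have "c powr k = (if a < 0 then 1 else exp (- a))"
    using k by (simp add: c_def powr_def)
  finally show "emeasure nu {a<..} = emeasure (distr (unit_density k) borel (\<lambda>x. - k * ln x)) {a<..}"
    by (simp add: nu_tail)
qed (simp add: unit_density_def)

lemma nn_integral_nu_substitution:
  assumes k: "0 < k" and [measurable]: "F \<in> borel_measurable borel"
  shows "(\<integral>\<^sup>+u. F u \<partial>nu) = (\<integral>\<^sup>+x. ennreal (k * x powr (k - 1) * indicator {0<..<1} x) * F (- k * ln x) \<partial>lborel)"
proof -
  have "(\<integral>\<^sup>+u. F u \<partial>nu) = (\<integral>\<^sup>+x. F (- k * ln x) \<partial>unit_density k)"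
    unfolding nu_eq_distr[OF k] by (rule nn_integral_distr) (auto simp: unit_density_def)
  also have "\<dots> = (\<integral>\<^sup>+x. ennreal (k * x powr (k - 1) * indicator {0<..<1} x) * F (- k * ln x) \<partial>lborel)"
    unfolding unit_density_def by (rule nn_integral_density) auto
  finally show ?thesis .
qed

lemma two_sinh_half: "0 < x \<Longrightarrow> 2 * sinh (- ln x / 2) = x powr (- 1 / 2) * (1 - x)" for x :: real
proof -
  assume x: "0 < x"
  have "2 * sinh (- ln x / 2) = x powr (- 1 / 2) - x powr (1 / 2)"
    using x by (simp add: sinh_def powr_def)
  also have "x powr (1 / 2) = x powr (- 1 / 2) * x powr 1" using x by (simp only: powr_add[symmetric]) simp
  finally show ?thesis using x by (simp add: algebra_simps)
qed

text \<open>
  With \<open>x = exp (- u / k)\<close> the hyperbolic sine becomes algebraic, which turns exponential integrals of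
  the kernel into Beta integrals.
\<close>

lemma kfun_substitution:
  assumes k: "0 < k" and x: "0 < x" "x < 1"
  shows "kfun p (ereal k) (- k * ln x) = k powr (- p) * x powr (p / 2) * (1 - x) powr (- p)"
proof -
  have "2 * k * sinh (- k * ln x / (2 * k)) = k * (x powr (- 1 / 2) * (1 - x))"
    using k two_sinh_half[OF x(1)] by (simp add: field_simps)
  then show ?thesis using k x by (simp add: kfun_def powr_mult powr_powr mult.assoc)
qed

lemma kfun_laplace:
  assumes k: "0 < k" and p: "p < 1" and c: "0 < k * c + p / 2"
  shows "(\<integral>\<^sup>+r. ennreal (kfun p (ereal k) r * exp (- (c - 1) * r)) \<partial>nu)
    = ennreal (k powr (1 - p) * Beta (k * c + p / 2) (1 - p))"
proof -
  have "(\<integral>\<^sup>+r. ennreal (kfun p (ereal k) r * exp (- (c - 1) * r)) \<partial>nu)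
    = (\<integral>\<^sup>+x. ennreal (k * x powr (k - 1) * indicator {0<..<1} x) *
        ennreal (kfun p (ereal k) (- k * ln x) * exp (- (c - 1) * (- k * ln x))) \<partial>lborel)"
    by (rule nn_integral_nu_substitution[OF k]) measurable
  also have "\<dots> = (\<integral>\<^sup>+x. ennreal (k powr (1 - p) * (x powr (k * c + p / 2 - 1) * (1 - x) powr (1 - p - 1)) * indicator {0..1} x) \<partial>lborel)"
  proof (rule nn_integral_cong_AE)
    show "AE x in lborel. ennreal (k * x powr (k - 1) * indicator {0<..<1} x) *
        ennreal (kfun p (ereal k) (- k * ln x) * exp (- (c - 1) * (- k * ln x)))
      = ennreal (k powr (1 - p) * (x powr (k * c + p / 2 - 1) * (1 - x) powr (1 - p - 1)) * indicator {0..1} x)"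
      using AE_lborel_singleton[of 0] AE_lborel_singleton[of 1]
    proof eventually_elim
      case (elim x)
      show ?case
      proof (cases "0 < x \<and> x < 1")
        case True
        then have x: "0 < x" "x < 1" by auto
        have e: "exp (- (c - 1) * (- k * ln x)) = x powr (k * (c - 1))"
          using x by (simp add: powr_def algebra_simps)
        have "k * x powr (k - 1) * (kfun p (ereal k) (- k * ln x) * exp (- (c - 1) * (- k * ln x)))
          = (k powr 1 * k powr (- p)) * (x powr (k - 1) * x powr (p / 2) * x powr (k * (c - 1))) * (1 - x) powr (- p)"
          unfolding kfun_substitution[OF k x] e using k by simp
        also have "\<dots> = k powr (1 - p) * (x powr (k * c + p / 2 - 1) * (1 - x) powr (1 - p - 1))"
          by (simp only: powr_add[symmetric]) (simp add: algebra_simps)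
        finally show ?thesis using x k by (simp add: ennreal_mult'[symmetric] kfun_nonneg)
      next
        case False
        then show ?thesis using elim by (auto split: split_indicator)
      qed
    qed
  qed
  also have "\<dots> = ennreal (k powr (1 - p) * Beta (k * c + p / 2) (1 - p))"
  proof (rule nn_integral_has_integral_lborel)
    have "((\<lambda>x. k powr (1 - p) * (x powr (k * c + p / 2 - 1) * (1 - x) powr (1 - p - 1)))
        has_integral k powr (1 - p) * Beta (k * c + p / 2) (1 - p)) {0..1}"
      using p c by (intro has_integral_mult_right has_integral_Beta_real) auto
    then show "((\<lambda>x. k powr (1 - p) * (x powr (k * c + p / 2 - 1) * (1 - x) powr (1 - p - 1)) * indicator {0..1} x)
        has_integral k powr (1 - p) * Beta (k * c + p / 2) (1 - p)) UNIV"
      by (rule has_integral_indicator_UNIV)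
  qed auto
  finally show ?thesis .
qed

lemma kfun_integral_inf:
  assumes "p < 1"
  shows "(\<integral>\<^sup>+r. ennreal (kfun p \<infinity> r) \<partial>nu) = ennreal (Gamma (1 - p))"
proof -
  have "(\<integral>\<^sup>+r. ennreal (kfun p \<infinity> r) \<partial>nu)
    = (\<integral>\<^sup>+r. ennreal (exp (- r)) * ennreal (kfun p \<infinity> r) * indicator {0..} r \<partial>lborel)"
    by (rule nn_integral_nu) measurable
  also have "\<dots> = (\<integral>\<^sup>+r. ennreal (r powr (1 - p - 1) / exp r * indicator {0..} r) \<partial>lborel)"
    by (intro nn_integral_cong)
      (auto simp: kfun_def ennreal_mult'[symmetric] exp_minus field_simps split: split_indicator)
  also have "\<dots> = ennreal (Gamma (1 - p))"
  proof (rule nn_integral_has_integral_lborel)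
    have "((\<lambda>r. r powr (1 - p - 1) / exp r) has_integral Gamma (1 - p)) {0..}"
      using assms by (intro Gamma_integral_real) simp
    then show "((\<lambda>r. r powr (1 - p - 1) / exp r * indicator {0..} r) has_integral Gamma (1 - p)) UNIV"
      by (rule has_integral_indicator_UNIV)
  qed auto
  finally show ?thesis .
qed

lemma kfun_integral_Q2:
  assumes "0 < \<alpha>" "\<alpha> < 1 / 2" "ereal (1 / 2) < \<kappa>"
  shows "(\<integral>\<^sup>+r. ennreal (kfun (2 * \<alpha>) \<kappa> r) \<partial>nu) = ennreal (Q2 \<alpha> \<kappa>)"
proof (cases "\<kappa> = \<infinity>")
  case True
  then show ?thesis using kfun_integral_inf[of "2 * \<alpha>"] assms by (simp add: Q2_def)
next
  case False
  then obtain k where k: "\<kappa> = ereal k" "1 / 2 < k" using assms by (cases \<kappa>) auto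
  then show ?thesis
    using kfun_laplace[of k "2 * \<alpha>" 1] assms by (simp add: Q2_def Let_def)
qed

lemma Q2_pos:
  assumes "0 < \<alpha>" "\<alpha> < 1 / 2" "ereal (1 / 2) < \<kappa>"
  shows "0 < Q2 \<alpha> \<kappa>"
proof (cases "\<kappa> = \<infinity>")
  case True
  then show ?thesis using assms by (simp add: Q2_def Gamma_real_pos)
next
  case False
  then obtain k where k: "\<kappa> = ereal k" "1 / 2 < k" using assms by (cases \<kappa>) auto
  then show ?thesis using assms by (simp add: Q2_def Let_def Beta_def Gamma_real_pos)
qed

text \<open>
  Lack of memory of the exponential distribution.
\<close>

lemma nu_shift:
  assumes u: "0 \<le> u" and [measurable]: "H \<in> borel_measurable borel"
  shows "(\<integral>\<^sup>+v. H v * indicator {u<..} v \<partial>nu) = ennreal (exp (- u)) * (\<integral>\<^sup>+r. H (u + r) \<partial>nu)"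
proof -
  have "(\<integral>\<^sup>+v. H v * indicator {u<..} v \<partial>nu)
      = (\<integral>\<^sup>+v. ennreal (exp (- v)) * (H v * indicator {u<..} v) * indicator {0..} v \<partial>lborel)"
    by (rule nn_integral_nu) measurable
  also have "\<dots> = (\<integral>\<^sup>+r. ennreal (exp (- (u + r))) * (H (u + r) * indicator {u<..} (u + r)) * indicator {0..} (u + r) \<partial>lborel)"
    by (subst nn_integral_real_affine[where c = 1 and t = u]) auto
  also have "\<dots> = (\<integral>\<^sup>+r. ennreal (exp (- u)) * (ennreal (exp (- r)) * H (u + r) * indicator {0..} r) \<partial>lborel)"
  proof (rule nn_integral_cong_AE)
    show "AE r in lborel. ennreal (exp (- (u + r))) * (H (u + r) * indicator {u<..} (u + r)) * indicator {0..} (u + r)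
      = ennreal (exp (- u)) * (ennreal (exp (- r)) * H (u + r) * indicator {0..} r)"
      using AE_lborel_singleton[of 0]
    proof eventually_elim
      case (elim r)
      have "ennreal (exp (- (u + r))) = ennreal (exp (- u)) * ennreal (exp (- r))"
        by (simp add: ennreal_mult'[symmetric] exp_add[symmetric])
      then show ?case using u elim by (auto split: split_indicator simp: mult.assoc)
    qed
  qed
  also have "\<dots> = ennreal (exp (- u)) * (\<integral>\<^sup>+r. ennreal (exp (- r)) * H (u + r) * indicator {0..} r \<partial>lborel)"
    by (rule nn_integral_cmult) measurable
  also have "(\<integral>\<^sup>+r. ennreal (exp (- r)) * H (u + r) * indicator {0..} r \<partial>lborel) = (\<integral>\<^sup>+r. H (u + r) \<partial>nu)"
    by (rule nn_integral_nu[symmetric]) measurable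
  finally show ?thesis .
qed

lemma AE_nu_neq: "AE v in nu. v \<noteq> (u::real)"
proof -
  have "AE v in lborel. v \<noteq> u" by (rule AE_lborel_singleton)
  then have "AE v in lborel. 0 < ennreal (exponential_density 1 v) \<longrightarrow> v \<noteq> u"
    by eventually_elim auto
  then show ?thesis unfolding nu_def by (subst AE_density) auto
qed

interpretation nu2: pair_sigma_finite nu nu ..

lemma nu_pair_sets: "sets (nu \<Otimes>\<^sub>M nu) = sets (borel \<Otimes>\<^sub>M borel)"
  by (rule sets_pair_measure_cong) (simp_all add: sets_nu)

text \<open>Splitting a double integral of a symmetric function according to the smaller argument.\<close>

lemma nu_double_symmetric:
  assumes F[measurable]: "(\<lambda>(u, v). F u v) \<in> borel_measurable (borel \<Otimes>\<^sub>M borel)"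
    and sym: "\<And>u v. F u v = F v u"
  shows "(\<integral>\<^sup>+u. \<integral>\<^sup>+v. F u v \<partial>nu \<partial>nu) = 2 * (\<integral>\<^sup>+u. ennreal (exp (- u)) * (\<integral>\<^sup>+r. F u (u + r) \<partial>nu) \<partial>nu)"
proof -
  have FM[measurable]: "(\<lambda>(u, v). F u v) \<in> borel_measurable (nu \<Otimes>\<^sub>M nu)"
    using F measurable_cong_sets[OF nu_pair_sets refl] by blast
  have Fu[measurable]: "F u \<in> borel_measurable borel" for u by measurable
  define A where "A u v = (if u < v then F u v else 0)" for u v
  define B where "B u v = (if v < u then F u v else 0)" for u v
  have [measurable]: "(\<lambda>(u, v). A u v) \<in> borel_measurable (nu \<Otimes>\<^sub>M nu)"
    "(\<lambda>(u, v). B u v) \<in> borel_measurable (nu \<Otimes>\<^sub>M nu)"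
    unfolding A_def B_def by measurable
  have "(\<integral>\<^sup>+u. \<integral>\<^sup>+v. F u v \<partial>nu \<partial>nu) = (\<integral>\<^sup>+u. (\<integral>\<^sup>+v. A u v \<partial>nu) + (\<integral>\<^sup>+v. B u v \<partial>nu) \<partial>nu)"
  proof (rule nn_integral_cong)
    fix u
    have "(\<integral>\<^sup>+v. F u v \<partial>nu) = (\<integral>\<^sup>+v. A u v + B u v \<partial>nu)"
      using AE_nu_neq[of u] by (intro nn_integral_cong_AE)
        (auto simp: A_def B_def split: split_indicator elim!: eventually_mono)
    also have "\<dots> = (\<integral>\<^sup>+v. A u v \<partial>nu) + (\<integral>\<^sup>+v. B u v \<partial>nu)"
      unfolding A_def B_def by (intro nn_integral_add) simp_all
    finally show "(\<integral>\<^sup>+v. F u v \<partial>nu) = (\<integral>\<^sup>+v. A u v \<partial>nu) + (\<integral>\<^sup>+v. B u v \<partial>nu)" .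
  qed
  also have "\<dots> = (\<integral>\<^sup>+u. \<integral>\<^sup>+v. A u v \<partial>nu \<partial>nu) + (\<integral>\<^sup>+u. \<integral>\<^sup>+v. B u v \<partial>nu \<partial>nu)"
    by (intro nn_integral_add) measurable
  also have "(\<integral>\<^sup>+u. \<integral>\<^sup>+v. B u v \<partial>nu \<partial>nu) = (\<integral>\<^sup>+v. \<integral>\<^sup>+u. B u v \<partial>nu \<partial>nu)"
    by (rule nu2.Fubini') measurable
  also have "(\<integral>\<^sup>+v. \<integral>\<^sup>+u. B u v \<partial>nu \<partial>nu) = (\<integral>\<^sup>+u. \<integral>\<^sup>+v. A u v \<partial>nu \<partial>nu)"
    using sym by (intro nn_integral_cong) (auto simp: A_def B_def split: split_indicator)
  also have "(\<integral>\<^sup>+u. \<integral>\<^sup>+v. A u v \<partial>nu \<partial>nu) = (\<integral>\<^sup>+u. ennreal (exp (- u)) * (\<integral>\<^sup>+r. F u (u + r) \<partial>nu) \<partial>nu)"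
  proof (rule nn_integral_cong_AE, use AE_nu_pos in eventually_elim)
    case (elim u)
    have "(\<integral>\<^sup>+v. A u v \<partial>nu) = (\<integral>\<^sup>+v. F u v * indicator {u<..} v \<partial>nu)"
      by (intro nn_integral_cong) (simp add: A_def)
    then show ?case using nu_shift[OF _ Fu[of u], of u] elim by simp
  qed
  finally show ?thesis by (simp add: mult_2)
qed

lemma nu_exp_moment:
  assumes "0 < c"
  shows "(\<integral>\<^sup>+u. ennreal (exp (- c * u)) \<partial>nu) = ennreal (1 / (1 + c))"
proof -
  have "(\<integral>\<^sup>+u. ennreal (exp (- c * u)) \<partial>nu) = (\<integral>\<^sup>+u. ennreal (exp (- u)) * ennreal (exp (- c * u)) * indicator {0..} u \<partial>lborel)"
    by (rule nn_integral_nu) measurable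
  also have "\<dots> = (\<integral>\<^sup>+u. ennreal (exp (- (1 + c) * u) * indicator {0..} u) \<partial>lborel)"
    by (intro nn_integral_cong)
      (auto simp: ennreal_mult'[symmetric] exp_add[symmetric] algebra_simps split: split_indicator)
  also have "\<dots> = ennreal (exp (- (1 + c) * 0) / (1 + c))"
  proof (rule nn_integral_has_integral_lborel)
    show "((\<lambda>u. exp (- (1 + c) * u) * indicator {0..} u) has_integral exp (- (1 + c) * 0) / (1 + c)) UNIV"
      using assms by (intro has_integral_indicator_UNIV has_integral_exp_minus_to_infinity) simp
  qed auto
  finally show ?thesis by simp
qed

text \<open>
  By lack of memory the excess of the larger of two independent exponential variables over the smaller
  one is again exponential; the factor \<open>2 \<integral> e\<^sup>-\<^sup>u \<nu>(du) = 1\<close> is the total weight of the two orderings.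
\<close>

lemma nu_abs_difference:
  assumes [measurable]: "\<phi> \<in> borel_measurable borel"
  shows "(\<integral>\<^sup>+u. \<integral>\<^sup>+v. \<phi> \<bar>u - v\<bar> \<partial>nu \<partial>nu) = (\<integral>\<^sup>+r. \<phi> r \<partial>nu)"
proof -
  have inner: "(\<integral>\<^sup>+r. \<phi> \<bar>u - (u + r)\<bar> \<partial>nu) = (\<integral>\<^sup>+r. \<phi> r \<partial>nu)" for u
    using AE_nu_pos by (intro nn_integral_cong_AE) (auto elim!: eventually_mono)
  have "(\<integral>\<^sup>+u. \<integral>\<^sup>+v. \<phi> \<bar>u - v\<bar> \<partial>nu \<partial>nu)
    = 2 * (\<integral>\<^sup>+u. ennreal (exp (- u)) * (\<integral>\<^sup>+r. \<phi> \<bar>u - (u + r)\<bar> \<partial>nu) \<partial>nu)"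
    by (rule nu_double_symmetric) (measurable, simp add: abs_minus_commute)
  also have "\<dots> = 2 * ((\<integral>\<^sup>+u. ennreal (exp (- 1 * u)) \<partial>nu) * (\<integral>\<^sup>+r. \<phi> r \<partial>nu))"
    unfolding inner by (subst nn_integral_multc) auto
  also have "\<dots> = (\<integral>\<^sup>+r. \<phi> r \<partial>nu)"
  proof -
    have "ennreal 2 * ennreal (1 / (1 + 1)) = 1" by (subst ennreal_mult[symmetric]) auto
    moreover have "(\<integral>\<^sup>+u. ennreal (exp (- 1 * u)) \<partial>nu) = ennreal (1 / (1 + 1))"
      by (rule nu_exp_moment) simp
    ultimately show ?thesis by (simp only: mult.assoc[symmetric] ennreal_numeral[symmetric] mult_1)
  qed
  finally show ?thesis .
qed

section \<open>The triple integral of the kernel\<close>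

text \<open>
  Relative to the least of three independent exponential variables, the other two are again exponential
  and independent, by lack of memory. The three choices of the least variable contribute equally, and
  \<open>3 \<integral> e\<^sup>-\<^sup>2\<^sup>u \<nu>(du) = 1\<close>.
\<close>

lemma nu_triple_min:
  assumes [measurable]: "\<phi> \<in> borel_measurable borel"
  shows "(\<integral>\<^sup>+u. \<integral>\<^sup>+v. \<integral>\<^sup>+w. \<phi> \<bar>u - v\<bar> * \<phi> \<bar>v - w\<bar> * \<phi> \<bar>u - w\<bar> \<partial>nu \<partial>nu \<partial>nu)
    = (\<integral>\<^sup>+r. \<integral>\<^sup>+s. \<phi> \<bar>r\<bar> * \<phi> \<bar>r - s\<bar> * \<phi> \<bar>s\<bar> \<partial>nu \<partial>nu)"
proof -
  define F where "F u v w = \<phi> \<bar>u - v\<bar> * \<phi> \<bar>v - w\<bar> * \<phi> \<bar>u - w\<bar>" for u v w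
  define A where "A u v w = (if u < v \<and> u < w then F u v w else 0)" for u v w
  have F_swap: "F v u w = F u v w" "F w u v = F u v w" for u v w
    unfolding F_def by (simp_all add: abs_minus_commute mult.commute mult.left_commute)
  define J where "J = (\<integral>\<^sup>+u. \<integral>\<^sup>+v. \<integral>\<^sup>+w. A u v w \<partial>nu \<partial>nu \<partial>nu)"
  have split3: "(\<integral>\<^sup>+w. F u v w \<partial>nu) = (\<integral>\<^sup>+w. A u v w \<partial>nu) + ((\<integral>\<^sup>+w. A v u w \<partial>nu) + (\<integral>\<^sup>+w. A w u v \<partial>nu))"
    if "v \<noteq> u" for u v
  proof -
    have "(\<integral>\<^sup>+w. F u v w \<partial>nu) = (\<integral>\<^sup>+w. A u v w + (A v u w + A w u v) \<partial>nu)"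
    proof (rule nn_integral_cong_AE)
      show "AE w in nu. F u v w = A u v w + (A v u w + A w u v)"
        using AE_nu_neq[of u] AE_nu_neq[of v]
      proof eventually_elim
        case (elim w)
        then show ?case using that unfolding A_def F_swap[of v u w] F_swap(2)[of w u v] by auto
      qed
    qed
    also have "\<dots> = (\<integral>\<^sup>+w. A u v w \<partial>nu) + (\<integral>\<^sup>+w. A v u w + A w u v \<partial>nu)"
      unfolding A_def F_def by (rule nn_integral_add) measurable
    also have "(\<integral>\<^sup>+w. A v u w + A w u v \<partial>nu) = (\<integral>\<^sup>+w. A v u w \<partial>nu) + (\<integral>\<^sup>+w. A w u v \<partial>nu)"
      unfolding A_def F_def by (rule nn_integral_add) measurable
    finally show ?thesis .
  qed
  have "(\<integral>\<^sup>+u. \<integral>\<^sup>+v. \<integral>\<^sup>+w. F u v w \<partial>nu \<partial>nu \<partial>nu)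
    = (\<integral>\<^sup>+u. \<integral>\<^sup>+v. (\<integral>\<^sup>+w. A u v w \<partial>nu) + ((\<integral>\<^sup>+w. A v u w \<partial>nu) + (\<integral>\<^sup>+w. A w u v \<partial>nu)) \<partial>nu \<partial>nu)"
  proof (rule nn_integral_cong)
    fix u
    show "(\<integral>\<^sup>+v. \<integral>\<^sup>+w. F u v w \<partial>nu \<partial>nu)
      = (\<integral>\<^sup>+v. (\<integral>\<^sup>+w. A u v w \<partial>nu) + ((\<integral>\<^sup>+w. A v u w \<partial>nu) + (\<integral>\<^sup>+w. A w u v \<partial>nu)) \<partial>nu)"
      using AE_nu_neq[of u] by (intro nn_integral_cong_AE) (auto elim!: eventually_mono simp: split3)
  qed
  also have "\<dots> = (\<integral>\<^sup>+u. (\<integral>\<^sup>+v. \<integral>\<^sup>+w. A u v w \<partial>nu \<partial>nu) + (\<integral>\<^sup>+v. (\<integral>\<^sup>+w. A v u w \<partial>nu) + (\<integral>\<^sup>+w. A w u v \<partial>nu) \<partial>nu) \<partial>nu)"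
    unfolding A_def F_def by (rule nn_integral_cong, rule nn_integral_add) measurable
  also have "\<dots> = (\<integral>\<^sup>+u. (\<integral>\<^sup>+v. \<integral>\<^sup>+w. A u v w \<partial>nu \<partial>nu) + ((\<integral>\<^sup>+v. \<integral>\<^sup>+w. A v u w \<partial>nu \<partial>nu) + (\<integral>\<^sup>+v. \<integral>\<^sup>+w. A w u v \<partial>nu \<partial>nu)) \<partial>nu)"
    unfolding A_def F_def by (rule nn_integral_cong, rule arg_cong2[where f = "(+)", OF refl], rule nn_integral_add) measurable
  also have "\<dots> = J + (\<integral>\<^sup>+u. (\<integral>\<^sup>+v. \<integral>\<^sup>+w. A v u w \<partial>nu \<partial>nu) + (\<integral>\<^sup>+v. \<integral>\<^sup>+w. A w u v \<partial>nu \<partial>nu) \<partial>nu)"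
    unfolding J_def A_def F_def by (rule nn_integral_add) measurable
  also have "(\<integral>\<^sup>+u. (\<integral>\<^sup>+v. \<integral>\<^sup>+w. A v u w \<partial>nu \<partial>nu) + (\<integral>\<^sup>+v. \<integral>\<^sup>+w. A w u v \<partial>nu \<partial>nu) \<partial>nu)
    = (\<integral>\<^sup>+u. \<integral>\<^sup>+v. \<integral>\<^sup>+w. A v u w \<partial>nu \<partial>nu \<partial>nu) + (\<integral>\<^sup>+u. \<integral>\<^sup>+v. \<integral>\<^sup>+w. A w u v \<partial>nu \<partial>nu \<partial>nu)"
    unfolding A_def F_def by (rule nn_integral_add) measurable
  also have "(\<integral>\<^sup>+u. \<integral>\<^sup>+v. \<integral>\<^sup>+w. A w u v \<partial>nu \<partial>nu \<partial>nu) = (\<integral>\<^sup>+u. \<integral>\<^sup>+w. \<integral>\<^sup>+v. A w u v \<partial>nu \<partial>nu \<partial>nu)"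
    unfolding A_def F_def by (rule nn_integral_cong, rule nu2.Fubini') measurable
  also have "(\<integral>\<^sup>+u. \<integral>\<^sup>+v. \<integral>\<^sup>+w. A v u w \<partial>nu \<partial>nu \<partial>nu) = (\<integral>\<^sup>+v. \<integral>\<^sup>+u. \<integral>\<^sup>+w. A v u w \<partial>nu \<partial>nu \<partial>nu)"
    unfolding A_def F_def by (rule nu2.Fubini') measurable
  also have "(\<integral>\<^sup>+v. \<integral>\<^sup>+u. \<integral>\<^sup>+w. A v u w \<partial>nu \<partial>nu \<partial>nu) = J" by (simp add: J_def)
  also have "J + (J + J) = (1 + 1 + 1) * J" by (simp only: distrib_right mult_1 add.assoc)
  finally have T3: "(\<integral>\<^sup>+u. \<integral>\<^sup>+v. \<integral>\<^sup>+w. F u v w \<partial>nu \<partial>nu \<partial>nu) = 3 * J" by simp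
  define C where "C = (\<integral>\<^sup>+r. \<integral>\<^sup>+s. \<phi> \<bar>r\<bar> * \<phi> \<bar>r - s\<bar> * \<phi> \<bar>s\<bar> \<partial>nu \<partial>nu)"
  have "J = (\<integral>\<^sup>+u. ennreal (exp (- 2 * u)) * C \<partial>nu)"
    unfolding J_def
  proof (rule nn_integral_cong_AE, use AE_nu_pos in eventually_elim)
    case (elim u)
    have "(\<integral>\<^sup>+v. \<integral>\<^sup>+w. A u v w \<partial>nu \<partial>nu)
      = (\<integral>\<^sup>+v. (\<integral>\<^sup>+w. F u v w * indicator {u<..} w \<partial>nu) * indicator {u<..} v \<partial>nu)"
      by (intro nn_integral_cong) (auto simp: A_def split: split_indicator intro!: nn_integral_cong)
    also have "\<dots> = (\<integral>\<^sup>+v. (ennreal (exp (- u)) * (\<integral>\<^sup>+s. F u v (u + s) \<partial>nu)) * indicator {u<..} v \<partial>nu)"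
      using elim unfolding F_def by (subst nu_shift) auto
    also have "\<dots> = ennreal (exp (- u)) * (\<integral>\<^sup>+r. ennreal (exp (- u)) * (\<integral>\<^sup>+s. F u (u + r) (u + s) \<partial>nu) \<partial>nu)"
      using elim unfolding F_def by (subst nu_shift) auto
    also have "\<dots> = ennreal (exp (- u)) * (ennreal (exp (- u)) * (\<integral>\<^sup>+r. \<integral>\<^sup>+s. F u (u + r) (u + s) \<partial>nu \<partial>nu))"
      unfolding F_def by (subst nn_integral_cmult) auto
    also have "(\<integral>\<^sup>+r. \<integral>\<^sup>+s. F u (u + r) (u + s) \<partial>nu \<partial>nu) = C"
      unfolding F_def C_def by simp
    also have "ennreal (exp (- u)) * (ennreal (exp (- u)) * C) = ennreal (exp (- 2 * u)) * C"
      by (simp add: mult.assoc[symmetric] ennreal_mult'[symmetric] exp_add[symmetric])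
    finally show ?case .
  qed
  also have "\<dots> = (\<integral>\<^sup>+u. ennreal (exp (- 2 * u)) \<partial>nu) * C"
    by (rule nn_integral_multc) measurable
  also have "(\<integral>\<^sup>+u. ennreal (exp (- 2 * u)) \<partial>nu) = ennreal (1 / (1 + 2))"
    by (rule nu_exp_moment) simp
  finally have "3 * J = (ennreal 3 * ennreal (1 / (1 + 2))) * C"
    by (simp only: mult.assoc ennreal_numeral)
  also have "ennreal 3 * ennreal (1 / (1 + 2)) = 1" by (subst ennreal_mult[symmetric]) auto
  finally show ?thesis using T3 by (simp add: F_def C_def)
qed

lemma nu_triple:
  assumes [measurable]: "\<phi> \<in> borel_measurable borel"
  shows "(\<integral>\<^sup>+u. \<integral>\<^sup>+v. \<integral>\<^sup>+w. \<phi> \<bar>u - v\<bar> * \<phi> \<bar>v - w\<bar> * \<phi> \<bar>u - w\<bar> \<partial>nu \<partial>nu \<partial>nu)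
    = 2 * (\<integral>\<^sup>+r. \<integral>\<^sup>+t. ennreal (exp (- r)) * (\<phi> r * \<phi> t * \<phi> (r + t)) \<partial>nu \<partial>nu)"
proof -
  have "(\<integral>\<^sup>+r. \<integral>\<^sup>+s. \<phi> \<bar>r\<bar> * \<phi> \<bar>r - s\<bar> * \<phi> \<bar>s\<bar> \<partial>nu \<partial>nu)
    = 2 * (\<integral>\<^sup>+r. ennreal (exp (- r)) * (\<integral>\<^sup>+t. \<phi> \<bar>r\<bar> * \<phi> \<bar>r - (r + t)\<bar> * \<phi> \<bar>r + t\<bar> \<partial>nu) \<partial>nu)"
    by (rule nu_double_symmetric) (measurable, simp add: abs_minus_commute mult.commute mult.left_commute)
  also have "(\<integral>\<^sup>+r. ennreal (exp (- r)) * (\<integral>\<^sup>+t. \<phi> \<bar>r\<bar> * \<phi> \<bar>r - (r + t)\<bar> * \<phi> \<bar>r + t\<bar> \<partial>nu) \<partial>nu)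
    = (\<integral>\<^sup>+r. \<integral>\<^sup>+t. ennreal (exp (- r)) * (\<phi> r * \<phi> t * \<phi> (r + t)) \<partial>nu \<partial>nu)"
  proof (rule nn_integral_cong_AE, use AE_nu_pos in eventually_elim)
    case (elim r)
    have "(\<integral>\<^sup>+t. \<phi> \<bar>r\<bar> * \<phi> \<bar>r - (r + t)\<bar> * \<phi> \<bar>r + t\<bar> \<partial>nu) = (\<integral>\<^sup>+t. \<phi> r * \<phi> t * \<phi> (r + t) \<partial>nu)"
      using AE_nu_pos elim by (intro nn_integral_cong_AE) (auto elim!: eventually_mono)
    then show ?case by (simp add: nn_integral_cmult)
  qed
  finally show ?thesis using nu_triple_min[OF assms] by simp
qed

lemma one_minus_powr_series:
  fixes p y :: real
  assumes "\<bar>y\<bar> < 1"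
  shows "(\<lambda>n. pochhammer p n / fact n * y ^ n) sums (1 - y) powr (- p)"
proof -
  have "(\<lambda>n. ((- p) gchoose n) * (- y) ^ n) sums (1 + (- y)) powr (- p)"
    by (rule gen_binomial_real) (use assms in simp)
  moreover have "((- p) gchoose n) * (- y) ^ n = pochhammer p n / fact n * y ^ n" for n
  proof -
    have "(- 1) ^ n * (- y) ^ n = y ^ n" by (simp add: power_mult_distrib[symmetric])
    then show ?thesis by (simp add: gbinomial_pochhammer)
  qed
  ultimately show ?thesis by simp
qed

lemma kfun_series:
  assumes k: "0 < k" and x: "0 < x"
  shows "(\<lambda>n. k powr (- p) * (pochhammer p n / fact n) * exp (- ((p / 2 + real n) / k) * x)) sums kfun p (ereal k) x"
proof -
  define y where "y = exp (- x / k)"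
  have y: "0 < y" "y < 1" using k x by (auto simp: y_def)
  have xy: "x = - k * ln y" using k by (simp add: y_def)
  have "(\<lambda>n. k powr (- p) * y powr (p / 2) * (pochhammer p n / fact n * y ^ n))
      sums (k powr (- p) * y powr (p / 2) * (1 - y) powr (- p))"
    using y by (intro sums_mult one_minus_powr_series) auto
  moreover have "k powr (- p) * y powr (p / 2) * (pochhammer p n / fact n * y ^ n)
    = k powr (- p) * (pochhammer p n / fact n) * exp (- ((p / 2 + real n) / k) * x)" for n
  proof -
    have "y powr (p / 2) * y ^ n = y powr (p / 2 + real n)"
      using y by (simp add: powr_add powr_realpow)
    also have "\<dots> = exp (- ((p / 2 + real n) / k) * x)"
      using y k by (simp add: powr_def y_def)
    finally have e: "y powr (p / 2) * y ^ n = exp (- ((p / 2 + real n) / k) * x)" .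
    show ?thesis unfolding e[symmetric] by simp
  qed
  moreover have "kfun p (ereal k) x = k powr (- p) * y powr (p / 2) * (1 - y) powr (- p)"
    using kfun_substitution[OF k y, of p] unfolding xy[symmetric] .
  ultimately show ?thesis by (simp only:)
qed

lemma Beta_shift:
  fixes x y :: real
  assumes "0 < x" "0 < y"
  shows "Beta (x + real n) y = Beta x y * (pochhammer x n / pochhammer (x + y) n)"
proof -
  have ni: "x \<notin> \<int>\<^sub>\<le>\<^sub>0" "x + y \<notin> \<int>\<^sub>\<le>\<^sub>0" using assms by (auto elim!: nonpos_Ints_cases)
  have pos: "0 < Gamma x" "0 < Gamma (x + y)" "0 < pochhammer (x + y) n"
    using assms by (auto intro: Gamma_real_pos pochhammer_pos)
  have "Gamma (x + real n) = Gamma x * pochhammer x n" "Gamma (x + real n + y) = Gamma (x + y) * pochhammer (x + y) n"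
    using pochhammer_Gamma[OF ni(1), of n] pochhammer_Gamma[OF ni(2), of n] pos by (auto simp: add_ac)
  then show ?thesis by (simp add: Beta_def)
qed

lemma Q3_eq_dixon:
  assumes \<alpha>: "0 < \<alpha>" "\<alpha> < 1 / 2" and k: "1 / 2 < k"
  shows "2 * (k powr (- \<alpha>) * (k powr (1 - \<alpha>) * Beta (2 * k + \<alpha>) (1 - \<alpha>)) * (k powr (1 - \<alpha>) * Beta (k + \<alpha>) (1 - \<alpha>))
      * dixon_value (2 * k + \<alpha>) \<alpha> (k + \<alpha>)) = Q3 \<alpha> (ereal k)"
proof -
  have kp: "0 < k" using k by simp
  have d: "dixon_value (2 * k + \<alpha>) \<alpha> (k + \<alpha>)
    = Gamma (k + \<alpha> / 2 + 1) * Gamma (1 - 3 * \<alpha> / 2) * Gamma (2 * k + 1) * Gamma (k + 1)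
      / (Gamma (2 * k + \<alpha> + 1) * Gamma (k + 1 - \<alpha>) * Gamma (k + 1 - \<alpha> / 2) * Gamma (1 - \<alpha> / 2))"
  proof -
    have e: "1 + (2 * k + \<alpha>) / 2 = k + \<alpha> / 2 + 1" "1 + (2 * k + \<alpha>) = 2 * k + \<alpha> + 1"
      "k + \<alpha> / 2 + 1 - \<alpha> = k + 1 - \<alpha> / 2" "k + 1 - \<alpha> / 2 - (k + \<alpha>) = 1 - 3 * \<alpha> / 2"
      "2 * k + \<alpha> + 1 - \<alpha> = 2 * k + 1" "2 * k + \<alpha> + 1 - (k + \<alpha>) = k + 1"
      "2 * k + 1 - (k + \<alpha>) = k + 1 - \<alpha>" "k + \<alpha> / 2 + 1 - (k + \<alpha>) = 1 - \<alpha> / 2"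
      by (simp_all add: field_simps)
    show ?thesis unfolding dixon_value_def by (simp only: e)
  qed
  have g: "Gamma (k + \<alpha> / 2 + 1) = (k + \<alpha> / 2) * Gamma (k + \<alpha> / 2)"
    "Gamma (2 * k + \<alpha> + 1) = (2 * k + \<alpha>) * Gamma (2 * k + \<alpha>)" "Gamma (k + 1) = k * Gamma k"
    using \<alpha> kp by (auto intro!: Gamma_plus1_real)
  have b: "Beta (2 * k + \<alpha>) (1 - \<alpha>) = Gamma (2 * k + \<alpha>) * Gamma (1 - \<alpha>) / Gamma (2 * k + 1)"
    "Beta (k + \<alpha>) (1 - \<alpha>) = Gamma (k + \<alpha>) * Gamma (1 - \<alpha>) / Gamma (k + 1)"
    by (simp_all add: Beta_def)
  have pos: "0 < Gamma (2 * k + \<alpha>)" "0 < Gamma (2 * k + 1)" "0 < Gamma k" "0 < Gamma (k + 1 - \<alpha>)"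
    "0 < Gamma (k + 1 - \<alpha> / 2)" "0 < Gamma (1 - \<alpha> / 2)"
    using \<alpha> kp by (auto intro!: Gamma_real_pos)
  have pw: "k powr (3 - 3 * \<alpha>) = k * (k powr (- \<alpha>) * k powr (1 - \<alpha>) * k powr (1 - \<alpha>))"
  proof -
    have "k powr (3 - 3 * \<alpha>) = k powr 1 * (k powr (- \<alpha>) * k powr (1 - \<alpha>) * k powr (1 - \<alpha>))"
      by (simp only: powr_add[symmetric]) simp
    then show ?thesis using kp by simp
  qed
  have P: "(\<Prod>j = 0..2::nat. Gamma (k + (1 - real j / 2) * \<alpha>) / Gamma (k + 1 - real j * \<alpha> / 2))
    = (Gamma (k + \<alpha>) / Gamma (k + 1)) * (Gamma (k + \<alpha> / 2) / Gamma (k + 1 - \<alpha> / 2)) * (Gamma k / Gamma (k + 1 - \<alpha>))"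
    by (simp add: numeral_2_eq_2)
  have Q3: "Q3 \<alpha> (ereal k) = Q3_inf \<alpha> * k powr (3 - 3 * \<alpha>) *
    ((Gamma (k + \<alpha>) / Gamma (k + 1)) * (Gamma (k + \<alpha> / 2) / Gamma (k + 1 - \<alpha> / 2)) * (Gamma k / Gamma (k + 1 - \<alpha>)))"
    by (simp add: Q3_def Let_def P)
  have algebra: "2 * (p * (q * (X * g1 / Y)) * (q * (V * g1 / (k * Gk)))
      * ((k + \<alpha> / 2) * H * S * Y * (k * Gk) / ((2 * k + \<alpha>) * X * M * R * T)))
    = g1\<^sup>2 * S / T * (k * (p * q * q)) * (V / (k * Gk) * (H / R) * (Gk / M))"
    if "0 < X" "0 < Y" "0 < Gk" "0 < M" "0 < R" "0 < T" for p q X Y V g1 Gk H S M R T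
  proof -
    have "2 * (k + \<alpha> / 2) = 2 * k + \<alpha>" "0 < 2 * k + \<alpha>" using \<alpha> kp by auto
    then show ?thesis using that kp by (simp add: divide_simps power2_eq_square)
  qed
  show ?thesis
    unfolding Q3 Q3_inf_def d b pw g by (rule algebra) (fact pos)+
qed

text \<open>
  The series for \<open>kfun \<alpha> (ereal k) (r + t)\<close> consists of nonnegative products of a function of \<open>r\<close> and a
  function of \<open>t\<close>. Integrating term by term gives products of two Beta values, which are multiples of
  the terms in Dixon's sum with \<open>A = 2 k + \<alpha>\<close>, \<open>B = \<alpha>\<close> and \<open>C = k + \<alpha>\<close>.
\<close>

lemma nu_triple_kfun_finite:
  assumes \<alpha>: "0 < \<alpha>" "\<alpha> < 1 / 2" and k: "1 / 2 < k"
  defines "\<phi> \<equiv> \<lambda>r. ennreal (kfun \<alpha> (ereal k) r)"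
  shows "2 * (\<integral>\<^sup>+r. \<integral>\<^sup>+t. ennreal (exp (- r)) * (\<phi> r * \<phi> t * \<phi> (r + t)) \<partial>nu \<partial>nu) = ennreal (Q3 \<alpha> (ereal k))"
proof -
  have kp: "0 < k" using k by simp
  have [measurable]: "\<phi> \<in> borel_measurable borel" unfolding \<phi>_def by measurable
  define c where "c n = k powr (- \<alpha>) * (pochhammer \<alpha> n / fact n)" for n
  define l where "l n = (\<alpha> / 2 + real n) / k" for n
  have c_nonneg: "0 \<le> c n" for n unfolding c_def using \<alpha> by (simp add: pochhammer_nonneg)
  have \<phi>_sum: "\<phi> (r + t) = (\<Sum>n. ennreal (c n) * ennreal (exp (- l n * r)) * ennreal (exp (- l n * t)))"
    if "0 < r" "0 < t" for r t
  proof -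
    have "(\<lambda>n. c n * exp (- l n * (r + t))) sums kfun \<alpha> (ereal k) (r + t)"
      using kfun_series[OF kp, of "r + t" \<alpha>] that by (simp add: c_def l_def)
    then have "(\<Sum>n. ennreal (c n * exp (- l n * (r + t)))) = \<phi> (r + t)"
      unfolding \<phi>_def by (subst suminf_ennreal2) (auto simp: sums_iff c_nonneg)
    moreover have "ennreal (c n * exp (- l n * (r + t))) = ennreal (c n) * ennreal (exp (- l n * r)) * ennreal (exp (- l n * t))" for n
      by (simp add: c_nonneg ennreal_mult'[symmetric] mult.assoc exp_add[symmetric] algebra_simps)
    ultimately show ?thesis by simp
  qed
  define G where "G b n = (\<integral>\<^sup>+r. ennreal (kfun \<alpha> (ereal k) r * exp (- ((b + l n) - 1) * r)) \<partial>nu)" for b n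
  have G: "G b n = ennreal (k powr (1 - \<alpha>) * Beta (b * k + \<alpha> + real n) (1 - \<alpha>))" if "0 < b" for b n
  proof -
    have "k * (b + l n) + \<alpha> / 2 = b * k + \<alpha> + real n" using kp by (simp add: l_def field_simps)
    moreover have "0 < b * k + \<alpha> + real n" using kp \<alpha> that by (simp add: add_pos_nonneg)
    ultimately show ?thesis
      unfolding G_def using \<alpha> by (subst kfun_laplace[OF kp]) auto
  qed
  have "(\<integral>\<^sup>+r. \<integral>\<^sup>+t. ennreal (exp (- r)) * (\<phi> r * \<phi> t * \<phi> (r + t)) \<partial>nu \<partial>nu)
    = (\<integral>\<^sup>+r. \<integral>\<^sup>+t. (\<Sum>n. ennreal (c n) * (ennreal (exp (- r)) * ennreal (exp (- l n * r)) * \<phi> r) * (ennreal (exp (- l n * t)) * \<phi> t)) \<partial>nu \<partial>nu)"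
  proof (rule nn_integral_cong_AE, use AE_nu_pos in eventually_elim, rule nn_integral_cong_AE, use AE_nu_pos in eventually_elim)
    case (elim r t)
    then show ?case
      unfolding \<phi>_sum[OF elim] ennreal_suminf_cmult[symmetric] by (simp add: ac_simps)
  qed
  also have "\<dots> = (\<integral>\<^sup>+r. (\<Sum>n. \<integral>\<^sup>+t. ennreal (c n) * (ennreal (exp (- r)) * ennreal (exp (- l n * r)) * \<phi> r) * (ennreal (exp (- l n * t)) * \<phi> t) \<partial>nu) \<partial>nu)"
    by (rule nn_integral_cong, rule nn_integral_suminf) measurable
  also have "\<dots> = (\<Sum>n. \<integral>\<^sup>+r. \<integral>\<^sup>+t. ennreal (c n) * (ennreal (exp (- r)) * ennreal (exp (- l n * r)) * \<phi> r) * (ennreal (exp (- l n * t)) * \<phi> t) \<partial>nu \<partial>nu)"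
    by (rule nn_integral_suminf) measurable
  also have "\<dots> = (\<Sum>n. ennreal (c n) * G 2 n * G 1 n)"
  proof (rule arg_cong[where f = suminf], rule ext)
    fix n
    have g1: "(\<integral>\<^sup>+t. ennreal (exp (- l n * t)) * \<phi> t \<partial>nu) = G 1 n"
      unfolding G_def \<phi>_def by (intro nn_integral_cong) (simp add: ennreal_mult'[symmetric] kfun_nonneg mult.commute)
    have g2: "(\<integral>\<^sup>+r. ennreal (exp (- r)) * ennreal (exp (- l n * r)) * \<phi> r \<partial>nu) = G 2 n"
      unfolding G_def \<phi>_def
      by (intro nn_integral_cong) (simp add: ennreal_mult'[symmetric] kfun_nonneg mult.commute exp_add[symmetric] algebra_simps)
    have "(\<integral>\<^sup>+r. \<integral>\<^sup>+t. ennreal (c n) * (ennreal (exp (- r)) * ennreal (exp (- l n * r)) * \<phi> r) * (ennreal (exp (- l n * t)) * \<phi> t) \<partial>nu \<partial>nu)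
      = (\<integral>\<^sup>+r. ennreal (c n) * (ennreal (exp (- r)) * ennreal (exp (- l n * r)) * \<phi> r) * G 1 n \<partial>nu)"
      by (rule nn_integral_cong) (subst nn_integral_cmult, measurable, simp only: g1)
    also have "\<dots> = ennreal (c n) * G 2 n * G 1 n"
      by (subst nn_integral_multc, measurable, subst nn_integral_cmult, measurable, simp only: g2)
    finally show "(\<integral>\<^sup>+r. \<integral>\<^sup>+t. ennreal (c n) * (ennreal (exp (- r)) * ennreal (exp (- l n * r)) * \<phi> r) * (ennreal (exp (- l n * t)) * \<phi> t) \<partial>nu \<partial>nu)
      = ennreal (c n) * G 2 n * G 1 n" .
  qed
  also have "\<dots> = ennreal (k powr (- \<alpha>) * (k powr (1 - \<alpha>) * Beta (2 * k + \<alpha>) (1 - \<alpha>)) * (k powr (1 - \<alpha>) * Beta (k + \<alpha>) (1 - \<alpha>))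
      * dixon_value (2 * k + \<alpha>) \<alpha> (k + \<alpha>))"
  proof -
    define W where "W = k powr (- \<alpha>) * (k powr (1 - \<alpha>) * Beta (2 * k + \<alpha>) (1 - \<alpha>)) * (k powr (1 - \<alpha>) * Beta (k + \<alpha>) (1 - \<alpha>))"
    have W: "0 \<le> W" unfolding W_def using kp \<alpha> by (simp add: Beta_def Gamma_real_pos less_imp_le)
    have summand: "ennreal (c n) * G 2 n * G 1 n = ennreal (W * dixon_term (2 * k + \<alpha>) \<alpha> (k + \<alpha>) n)" for n
    proof -
      have e: "1 + (2 * k + \<alpha>) - \<alpha> = 2 * k + \<alpha> + (1 - \<alpha>)" "1 + (2 * k + \<alpha>) - (k + \<alpha>) = k + \<alpha> + (1 - \<alpha>)" by simp_all
      have B: "0 \<le> Beta (2 * k + \<alpha> + real n) (1 - \<alpha>)" "0 \<le> Beta (k + \<alpha> + real n) (1 - \<alpha>)"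
        using kp \<alpha> by (auto simp: Beta_def add_pos_nonneg intro!: divide_nonneg_nonneg mult_nonneg_nonneg Gamma_real_nonneg)
      have "ennreal (c n) * G 2 n * G 1 n = ennreal (c n * (k powr (1 - \<alpha>) * Beta (2 * k + \<alpha> + real n) (1 - \<alpha>)) * (k powr (1 - \<alpha>) * Beta (k + \<alpha> + real n) (1 - \<alpha>)))"
        using B c_nonneg[of n] by (simp add: G ennreal_mult'[symmetric])
      also have "c n * (k powr (1 - \<alpha>) * Beta (2 * k + \<alpha> + real n) (1 - \<alpha>)) * (k powr (1 - \<alpha>) * Beta (k + \<alpha> + real n) (1 - \<alpha>))
        = W * dixon_term (2 * k + \<alpha>) \<alpha> (k + \<alpha>) n"
        using Beta_shift[of "2 * k + \<alpha>" "1 - \<alpha>" n] Beta_shift[of "k + \<alpha>" "1 - \<alpha>" n] kp \<alpha>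
        unfolding dixon_term_def e W_def c_def by simp
      finally show ?thesis .
    qed
    have "dixon_term (2 * k + \<alpha>) \<alpha> (k + \<alpha>) sums dixon_value (2 * k + \<alpha>) \<alpha> (k + \<alpha>)"
      using kp \<alpha> by (intro dixon_sum) (auto simp: field_simps)
    then have s: "(\<lambda>n. W * dixon_term (2 * k + \<alpha>) \<alpha> (k + \<alpha>) n) sums (W * dixon_value (2 * k + \<alpha>) \<alpha> (k + \<alpha>))"
      by (rule sums_mult)
    have "0 \<le> dixon_term (2 * k + \<alpha>) \<alpha> (k + \<alpha>) n" for n
      unfolding dixon_term_def using kp \<alpha>
      by (intro divide_nonneg_nonneg mult_nonneg_nonneg pochhammer_nonneg) auto
    then show ?thesis
      unfolding summand W_def[symmetric] using s W by (subst suminf_ennreal2) (auto simp: sums_iff)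
  qed
  finally show ?thesis
    using Q3_eq_dixon[OF \<alpha> k] by (simp add: ennreal_mult'[symmetric] flip: ennreal_numeral)
qed

lemma kfun_le_inf:
  assumes "0 < k" "0 < r" "0 < \<alpha>"
  shows "kfun \<alpha> (ereal k) r \<le> kfun \<alpha> \<infinity> r"
proof -
  have "r / (2 * k) \<le> sinh (r / (2 * k))"
    using assms real_le_x_sinh[of "r / (2 * k)"] by (simp add: sinh_field_def exp_minus)
  then have "r \<le> 2 * k * sinh (r / (2 * k))" using assms by (simp add: field_simps)
  then show ?thesis using assms by (simp add: kfun_def powr_mono2')
qed

lemma kfun_tendsto_inf:
  assumes "0 < r"
  shows "(\<lambda>n. kfun \<alpha> (ereal (real (Suc n))) r) \<longlonglongrightarrow> kfun \<alpha> \<infinity> r"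
proof -
  have "(\<lambda>n. 2 * real (Suc n) * sinh (r / (2 * real (Suc n)))) \<longlonglongrightarrow> r"
    unfolding sinh_field_def by real_asymp
  then show ?thesis
    unfolding kfun_def using assms by (auto intro!: tendsto_powr)
qed

text \<open>
  The last factor of the product contains \<open>Gamma k\<close>. Indexing by \<open>k = Suc m\<close> keeps all arguments of the
  form \<open>a + m\<close> with \<open>a > 0\<close>.
\<close>

lemma Q3_tendsto_inf:
  assumes \<alpha>: "0 < \<alpha>" "\<alpha> < 1 / 2"
  shows "(\<lambda>n. Q3 \<alpha> (ereal (real (Suc n)))) \<longlonglongrightarrow> Q3 \<alpha> \<infinity>"
proof -
  define g where "g a b m = Gamma (a + real m) / Gamma (b + real m) * real m powr (b - a)" for a b and m :: nat
  have g: "g a b \<longlonglongrightarrow> 1" if "0 < a" "0 < b" for a b :: real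
    unfolding g_def[abs_def] by (rule Gamma_ratio_asymp[OF that])
  have "(\<lambda>m. real (Suc m) powr (3 - 3 * \<alpha>) / real m powr (3 - 3 * \<alpha>)) \<longlonglongrightarrow> 1" by real_asymp
  then have "(\<lambda>m. Q3_inf \<alpha> * ((real (Suc m) powr (3 - 3 * \<alpha>) / real m powr (3 - 3 * \<alpha>)) *
      (g (1 + \<alpha>) 2 m * g (1 + \<alpha> / 2) (2 - \<alpha> / 2) m * g 1 (2 - \<alpha>) m))) \<longlonglongrightarrow> Q3_inf \<alpha> * (1 * (1 * 1 * 1))"
    using \<alpha> by (intro tendsto_mult tendsto_const g) auto
  moreover have "\<forall>\<^sub>F m in sequentially. Q3_inf \<alpha> * ((real (Suc m) powr (3 - 3 * \<alpha>) / real m powr (3 - 3 * \<alpha>)) *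
      (g (1 + \<alpha>) 2 m * g (1 + \<alpha> / 2) (2 - \<alpha> / 2) m * g 1 (2 - \<alpha>) m)) = Q3 \<alpha> (ereal (real (Suc m)))"
  proof (rule eventually_sequentiallyI[of 1])
    fix m :: nat assume m: "1 \<le> m"
    define k where "k = real (Suc m)"
    define M where "M = real m powr (1 - \<alpha>)"
    have "real m powr (3 - 3 * \<alpha>) = M * M * M"
      unfolding M_def powr_add[symmetric] by simp
    moreover have "M \<noteq> 0" using m by (simp add: M_def)
    moreover have "g (1 + \<alpha>) 2 m = Gamma (k + \<alpha>) / Gamma (k + 1) * M"
      "g (1 + \<alpha> / 2) (2 - \<alpha> / 2) m = Gamma (k + \<alpha> / 2) / Gamma (k + 1 - \<alpha> / 2) * M"
      "g 1 (2 - \<alpha>) m = Gamma k / Gamma (k + 1 - \<alpha>) * M"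
      unfolding g_def k_def M_def by (simp_all add: algebra_simps)
    moreover have P: "(\<Prod>j = 0..2::nat. Gamma (k + (1 - real j / 2) * \<alpha>) / Gamma (k + 1 - real j * \<alpha> / 2))
      = (Gamma (k + \<alpha>) / Gamma (k + 1)) * (Gamma (k + \<alpha> / 2) / Gamma (k + 1 - \<alpha> / 2)) * (Gamma k / Gamma (k + 1 - \<alpha>))"
      by (simp add: numeral_2_eq_2)
    ultimately show "Q3_inf \<alpha> * ((real (Suc m) powr (3 - 3 * \<alpha>) / real m powr (3 - 3 * \<alpha>)) *
      (g (1 + \<alpha>) 2 m * g (1 + \<alpha> / 2) (2 - \<alpha> / 2) m * g 1 (2 - \<alpha>) m)) = Q3 \<alpha> (ereal (real (Suc m)))"
      unfolding k_def[symmetric] by (simp add: Q3_def Let_def P)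
  qed
  ultimately show ?thesis by (simp add: tendsto_cong Q3_def)
qed

text \<open>
  The kernels with finite parameter lie below the limiting kernel and converge to it. One inequality
  is monotonicity of the integral, the other is Fatou's lemma, so that integrability of the limit need
  not be known beforehand.
\<close>

lemma nu_triple_kfun_inf:
  assumes \<alpha>: "0 < \<alpha>" "\<alpha> < 1 / 2"
  defines "\<phi> \<equiv> \<lambda>\<kappa> r. ennreal (kfun \<alpha> \<kappa> r)"
  shows "2 * (\<integral>\<^sup>+r. \<integral>\<^sup>+t. ennreal (exp (- r)) * (\<phi> \<infinity> r * \<phi> \<infinity> t * \<phi> \<infinity> (r + t)) \<partial>nu \<partial>nu) = ennreal (Q3 \<alpha> \<infinity>)"
proof -
  define f where "f \<kappa> = (\<lambda>(r, t). ennreal (exp (- r)) * (\<phi> \<kappa> r * \<phi> \<kappa> t * \<phi> \<kappa> (r + t)))" for \<kappa>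
  have [measurable]: "\<phi> \<kappa> \<in> borel_measurable borel" for \<kappa> unfolding \<phi>_def by measurable
  have fM[measurable]: "f \<kappa> \<in> borel_measurable (nu \<Otimes>\<^sub>M nu)" for \<kappa> unfolding f_def by measurable
  have iter: "(\<integral>\<^sup>+r. \<integral>\<^sup>+t. ennreal (exp (- r)) * (\<phi> \<kappa> r * \<phi> \<kappa> t * \<phi> \<kappa> (r + t)) \<partial>nu \<partial>nu) = (\<integral>\<^sup>+p. f \<kappa> p \<partial>(nu \<Otimes>\<^sub>M nu))" for \<kappa>
    using nu.nn_integral_fst[OF fM, of \<kappa>] by (simp add: f_def)
  have pos: "AE p in nu \<Otimes>\<^sub>M nu. 0 < fst p \<and> 0 < snd p"
  proof (rule nu2.AE_pair_measure)
    show "{x \<in> space (nu \<Otimes>\<^sub>M nu). 0 < fst x \<and> 0 < snd x} \<in> sets (nu \<Otimes>\<^sub>M nu)" by measurable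
    show "AE x in nu. AE y in nu. 0 < fst (x, y) \<and> 0 < snd (x, y)"
      using AE_nu_pos by eventually_elim (use AE_nu_pos in \<open>auto elim!: eventually_mono\<close>)
  qed
  define D where "D n = (\<integral>\<^sup>+p. f (ereal (real (Suc n))) p \<partial>(nu \<Otimes>\<^sub>M nu))" for n
  have D: "2 * D n = ennreal (Q3 \<alpha> (ereal (real (Suc n))))" for n
    unfolding D_def iter[symmetric] \<phi>_def by (rule nu_triple_kfun_finite[OF \<alpha>]) simp
  have lim: "(\<lambda>n. 2 * D n) \<longlonglongrightarrow> ennreal (Q3 \<alpha> \<infinity>)"
    unfolding D by (intro tendsto_ennrealI Q3_tendsto_inf \<alpha>)
  have le: "D n \<le> (\<integral>\<^sup>+p. f \<infinity> p \<partial>(nu \<Otimes>\<^sub>M nu))" for n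
    unfolding D_def
  proof (rule nn_integral_mono_AE, use pos in eventually_elim)
    case (elim p)
    then show ?case
      unfolding f_def \<phi>_def using \<alpha>
      by (auto simp: case_prod_unfold intro!: mult_mono ennreal_leI kfun_le_inf)
  qed
  have "(\<integral>\<^sup>+p. f \<infinity> p \<partial>(nu \<Otimes>\<^sub>M nu)) = (\<integral>\<^sup>+p. liminf (\<lambda>n. f (ereal (real (Suc n))) p) \<partial>(nu \<Otimes>\<^sub>M nu))"
  proof (rule nn_integral_cong_AE, use pos in eventually_elim)
    case (elim p)
    have "(\<lambda>n. ennreal (exp (- fst p) * (kfun \<alpha> (ereal (real (Suc n))) (fst p) * kfun \<alpha> (ereal (real (Suc n))) (snd p) * kfun \<alpha> (ereal (real (Suc n))) (fst p + snd p))))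
      \<longlonglongrightarrow> ennreal (exp (- fst p) * (kfun \<alpha> \<infinity> (fst p) * kfun \<alpha> \<infinity> (snd p) * kfun \<alpha> \<infinity> (fst p + snd p)))"
      using elim by (intro tendsto_ennrealI tendsto_mult tendsto_const kfun_tendsto_inf) auto
    moreover have "ennreal (exp (- fst p) * (kfun \<alpha> \<kappa> (fst p) * kfun \<alpha> \<kappa> (snd p) * kfun \<alpha> \<kappa> (fst p + snd p))) = f \<kappa> p" for \<kappa>
      by (simp add: f_def \<phi>_def case_prod_unfold ennreal_mult'[symmetric] kfun_nonneg)
    ultimately have "(\<lambda>n. f (ereal (real (Suc n))) p) \<longlonglongrightarrow> f \<infinity> p" by simp
    then show ?case by (intro lim_imp_Liminf[symmetric]) auto
  qed
  also have "\<dots> \<le> liminf D"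
    unfolding D_def by (rule nn_integral_liminf) measurable
  finally have ge: "(\<integral>\<^sup>+p. f \<infinity> p \<partial>(nu \<Otimes>\<^sub>M nu)) \<le> liminf D" .
  have "2 * (\<integral>\<^sup>+p. f \<infinity> p \<partial>(nu \<Otimes>\<^sub>M nu)) = ennreal (Q3 \<alpha> \<infinity>)"
  proof (rule antisym)
    have "2 * (\<integral>\<^sup>+p. f \<infinity> p \<partial>(nu \<Otimes>\<^sub>M nu)) \<le> 2 * liminf D" by (rule mult_left_mono[OF ge]) simp
    also have "\<dots> = liminf (\<lambda>n. 2 * D n)"
      by (rule Liminf_compose_continuous_mono[symmetric, where f = "\<lambda>x. 2 * x"])
        (auto intro!: ennreal_continuous_on_cmult continuous_on_id monoI mult_left_mono)
    also have "\<dots> = ennreal (Q3 \<alpha> \<infinity>)"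
      by (rule lim_imp_Liminf[OF _ lim]) simp
    finally show "2 * (\<integral>\<^sup>+p. f \<infinity> p \<partial>(nu \<Otimes>\<^sub>M nu)) \<le> ennreal (Q3 \<alpha> \<infinity>)" .
    show "ennreal (Q3 \<alpha> \<infinity>) \<le> 2 * (\<integral>\<^sup>+p. f \<infinity> p \<partial>(nu \<Otimes>\<^sub>M nu))"
      by (rule LIMSEQ_le_const2[OF lim]) (auto intro!: exI[of _ 0] mult_left_mono le)
  qed
  then show ?thesis unfolding iter .
qed

lemma nu_triple_kfun:
  assumes "0 < \<alpha>" "\<alpha> < 1 / 2" "ereal (1 / 2) < \<kappa>"
  shows "(\<integral>\<^sup>+u. \<integral>\<^sup>+v. \<integral>\<^sup>+w. ennreal (kfun \<alpha> \<kappa> \<bar>u - v\<bar>) * ennreal (kfun \<alpha> \<kappa> \<bar>v - w\<bar>) * ennreal (kfun \<alpha> \<kappa> \<bar>u - w\<bar>) \<partial>nu \<partial>nu \<partial>nu)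
    = ennreal (Q3 \<alpha> \<kappa>)"
proof -
  have "(\<integral>\<^sup>+u. \<integral>\<^sup>+v. \<integral>\<^sup>+w. ennreal (kfun \<alpha> \<kappa> \<bar>u - v\<bar>) * ennreal (kfun \<alpha> \<kappa> \<bar>v - w\<bar>) * ennreal (kfun \<alpha> \<kappa> \<bar>u - w\<bar>) \<partial>nu \<partial>nu \<partial>nu)
    = 2 * (\<integral>\<^sup>+r. \<integral>\<^sup>+t. ennreal (exp (- r)) * (ennreal (kfun \<alpha> \<kappa> r) * ennreal (kfun \<alpha> \<kappa> t) * ennreal (kfun \<alpha> \<kappa> (r + t))) \<partial>nu \<partial>nu)"
    by (rule nu_triple) measurable
  also have "\<dots> = ennreal (Q3 \<alpha> \<kappa>)"
  proof (cases "\<kappa> = \<infinity>")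
    case True
    then show ?thesis using nu_triple_kfun_inf[OF assms(1,2)] by simp
  next
    case False
    then obtain k where k: "\<kappa> = ereal k" "1 / 2 < k" using assms by (cases \<kappa>) auto
    then show ?thesis using nu_triple_kfun_finite[OF assms(1,2) k(2)] by simp
  qed
  finally show ?thesis .
qed

section \<open>Positivity\<close>

text \<open>
  For fixed \<open>(a, b)\<close> this is a nonnegative multiple of the product of the indicators of \<open>(a, b)\<close> at \<open>x\<close> and
  at \<open>y\<close>; the weight is chosen such that integration over all intervals yields \<open>|x - y|\<^sup>-\<^sup>\<alpha>\<close>.
\<close>

definition interval_weight :: "real \<Rightarrow> real \<Rightarrow> real \<Rightarrow> real \<times> real \<Rightarrow> real" where
  "interval_weight \<alpha> x y = (\<lambda>(a, b). if a < x \<and> a < y \<and> x < b \<and> y < b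
     then \<alpha> * (1 + \<alpha>) * (b - a) powr (- \<alpha> - 2) else 0)"

lemma interval_weight_measurable[measurable]:
  "(\<lambda>((x, y), p). interval_weight \<alpha> x y p) \<in> borel_measurable ((borel \<Otimes>\<^sub>M borel) \<Otimes>\<^sub>M borel)"
proof -
  have "(\<lambda>((x, y), p). interval_weight \<alpha> x y p) \<in> borel_measurable ((borel \<Otimes>\<^sub>M borel) \<Otimes>\<^sub>M (borel \<Otimes>\<^sub>M borel))"
    unfolding interval_weight_def case_prod_unfold by measurable
  then show ?thesis by (simp add: borel_prod)
qed

lemma interval_weight_measurable_snd[measurable]: "interval_weight \<alpha> x y \<in> borel_measurable borel"
proof -
  have "interval_weight \<alpha> x y \<in> borel_measurable (borel \<Otimes>\<^sub>M borel)"
    unfolding interval_weight_def by measurable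
  then show ?thesis by (simp add: borel_prod)
qed

lemma nn_integral_powr_tail:
  assumes "p < - 1" "0 < c"
  shows "(\<integral>\<^sup>+t. ennreal (t powr p * indicator {c..} t) \<partial>lborel) = ennreal (- (c powr (p + 1)) / (p + 1))"
  using assms by (intro nn_integral_has_integral_lborel has_integral_indicator_UNIV has_integral_powr_to_inf) auto

lemma nn_integral_interval_weight:
  assumes \<alpha>: "0 < \<alpha>" and xy: "x \<noteq> y"
  shows "(\<integral>\<^sup>+p. ennreal (interval_weight \<alpha> x y p) \<partial>lborel) = ennreal (\<bar>x - y\<bar> powr (- \<alpha>))"
proof -
  define m M where "m = min x y" and "M = max x y"
  have mM: "m < M" "\<bar>x - y\<bar> = M - m" using xy by (auto simp: m_def M_def)
  have cond: "a < x \<and> a < y \<and> x < b \<and> y < b \<longleftrightarrow> a < m \<and> M < b" for a b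
    by (auto simp: m_def M_def)
  have [measurable]: "(\<lambda>p. interval_weight \<alpha> x y p) \<in> borel_measurable (borel \<Otimes>\<^sub>M borel)"
    unfolding interval_weight_def by measurable
  have "(\<integral>\<^sup>+p. ennreal (interval_weight \<alpha> x y p) \<partial>lborel)
      = (\<integral>\<^sup>+a. \<integral>\<^sup>+b. ennreal (interval_weight \<alpha> x y (a, b)) \<partial>lborel \<partial>lborel)"
    unfolding lborel_prod[symmetric] by (subst lborel.nn_integral_fst[symmetric]) auto
  also have "\<dots> = (\<integral>\<^sup>+a. ennreal (\<alpha> * (M - a) powr (- \<alpha> - 1)) * indicator {..<m} a \<partial>lborel)"
  proof (rule nn_integral_cong)
    fix a
    show "(\<integral>\<^sup>+b. ennreal (interval_weight \<alpha> x y (a, b)) \<partial>lborel) = ennreal (\<alpha> * (M - a) powr (- \<alpha> - 1)) * indicator {..<m} a"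
    proof (cases "a < m")
      case True
      then have Ma: "0 < M - a" using mM by simp
      have "(\<integral>\<^sup>+b. ennreal (interval_weight \<alpha> x y (a, b)) \<partial>lborel)
        = (\<integral>\<^sup>+t. ennreal (interval_weight \<alpha> x y (a, a + 1 * t)) \<partial>lborel)"
        by (subst nn_integral_real_affine[where c = 1 and t = a]) auto
      also have "\<dots> = (\<integral>\<^sup>+t. ennreal (\<alpha> * (1 + \<alpha>)) * ennreal (t powr (- \<alpha> - 2) * indicator {M - a..} t) \<partial>lborel)"
      proof (rule nn_integral_cong_AE, use AE_lborel_singleton[of "M - a"] in eventually_elim)
        case (elim t)
        then show ?case
          using True \<alpha> unfolding interval_weight_def cond
          by (auto simp: ennreal_mult'[symmetric] split: split_indicator)
      qed
      also have "\<dots> = ennreal (\<alpha> * (1 + \<alpha>)) * ennreal (- ((M - a) powr (- \<alpha> - 2 + 1)) / (- \<alpha> - 2 + 1))"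
        using \<alpha> Ma by (subst nn_integral_cmult) (auto simp: nn_integral_powr_tail)
      also have "\<dots> = ennreal (\<alpha> * (M - a) powr (- \<alpha> - 1))"
      proof -
        define P where "P = (M - a) powr (- \<alpha> - 1)"
        have "- \<alpha> - 2 + 1 = - \<alpha> - 1" "- \<alpha> - 1 = - (1 + \<alpha>)" by simp_all
        then have "\<alpha> * (1 + \<alpha>) * (- ((M - a) powr (- \<alpha> - 2 + 1)) / (- \<alpha> - 2 + 1)) = \<alpha> * (1 + \<alpha>) * (- P / - (1 + \<alpha>))"
          unfolding P_def by metis
        also have "\<dots> = \<alpha> * P" unfolding minus_divide_divide using \<alpha> by simp
        finally have "\<alpha> * (1 + \<alpha>) * (- ((M - a) powr (- \<alpha> - 2 + 1)) / (- \<alpha> - 2 + 1)) = \<alpha> * (M - a) powr (- \<alpha> - 1)"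
          unfolding P_def .
        then show ?thesis using \<alpha> by (subst ennreal_mult'[symmetric]) auto
      qed
      finally show ?thesis using True by simp
    next
      case False
      then show ?thesis unfolding interval_weight_def cond by simp
    qed
  qed
  also have "\<dots> = (\<integral>\<^sup>+t. ennreal (\<alpha> * (M - (M + (- 1) * t)) powr (- \<alpha> - 1)) * indicator {..<m} (M + (- 1) * t) \<partial>lborel)"
    by (subst nn_integral_real_affine[where c = "-1" and t = M]) auto
  also have "\<dots> = (\<integral>\<^sup>+t. ennreal \<alpha> * ennreal (t powr (- \<alpha> - 1) * indicator {M - m..} t) \<partial>lborel)"
  proof (rule nn_integral_cong_AE, use AE_lborel_singleton[of "M - m"] in eventually_elim)
    case (elim t)
    then show ?case using \<alpha> by (auto simp: ennreal_mult'[symmetric] split: split_indicator)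
  qed
  also have "\<dots> = ennreal \<alpha> * ennreal (- ((M - m) powr (- \<alpha> - 1 + 1)) / (- \<alpha> - 1 + 1))"
    using \<alpha> mM by (subst nn_integral_cmult) (auto simp: nn_integral_powr_tail)
  also have "\<dots> = ennreal (\<bar>x - y\<bar> powr (- \<alpha>))"
    using \<alpha> mM by (subst ennreal_mult'[symmetric]) auto
  finally show ?thesis .
qed

lemma interval_weight_nonneg: "0 < \<alpha> \<Longrightarrow> 0 \<le> interval_weight \<alpha> x y p"
  by (auto simp: interval_weight_def split: prod.split)

lemma interval_weight_integral:
  assumes \<alpha>: "0 < \<alpha>" and xy: "x \<noteq> y"
  shows "(\<integral>p. interval_weight \<alpha> x y p \<partial>lborel) = \<bar>x - y\<bar> powr (- \<alpha>)"
proof -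
  show ?thesis
    using nn_integral_interval_weight[OF \<alpha> xy] interval_weight_nonneg[OF \<alpha>]
    by (subst integral_eq_nn_integral) auto
qed

text \<open>
  Integrating over \<open>u\<close> and \<open>v\<close> first, each interval contributes a nonnegative multiple of the square of
  the integral of \<open>h * w\<close> over the preimage of the interval. Fubini's theorem applies because the absolute
  values integrate to the quadratic form of \<open>|h|\<close>. The formula for \<open>k\<close> is required off the diagonal
  only, which is a null set for \<open>\<nu> \<otimes> \<nu>\<close>.
\<close>

lemma hs_kernel_positive:
  assumes hs: "hs_kernel nu k" and \<alpha>: "0 < \<alpha>"
    and w[measurable]: "w \<in> borel_measurable borel" and \<psi>[measurable]: "\<psi> \<in> borel_measurable borel"
    and inj: "\<And>u v. \<psi> u = \<psi> v \<Longrightarrow> u = v"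
    and k: "\<And>u v. u \<noteq> v \<Longrightarrow> k u v = w u * w v * \<bar>\<psi> u - \<psi> v\<bar> powr (- \<alpha>)"
    and h: "h \<in> L2 nu"
  shows "0 \<le> L2_inner nu h (integral_op nu k h)"
proof -
  interpret hs_kernel nu k by (rule hs)
  interpret q: pair_sigma_finite "nu \<Otimes>\<^sub>M nu" "lborel :: (real \<times> real) measure" ..
  have [measurable]: "h \<in> borel_measurable borel" using L2_measurable[OF h] by simp
  define g where "g u = h u * w u" for u
  have [measurable]: "g \<in> borel_measurable borel" unfolding g_def by measurable
  define \<Phi> where "\<Phi> = (\<lambda>((u, v), p). g u * g v * interval_weight \<alpha> (\<psi> u) (\<psi> v) p)"
  have \<Phi>M[measurable]: "\<Phi> \<in> borel_measurable ((nu \<Otimes>\<^sub>M nu) \<Otimes>\<^sub>M lborel)"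
  proof -
    have "(\<lambda>x. ((\<psi> (fst (fst x)), \<psi> (snd (fst x))), snd x)) \<in> measurable ((nu \<Otimes>\<^sub>M nu) \<Otimes>\<^sub>M lborel) ((borel \<Otimes>\<^sub>M borel) \<Otimes>\<^sub>M borel)"
      by measurable
    from measurable_compose[OF this interval_weight_measurable[of \<alpha>]]
    have [measurable]: "(\<lambda>x. interval_weight \<alpha> (\<psi> (fst (fst x))) (\<psi> (snd (fst x))) (snd x)) \<in> borel_measurable ((nu \<Otimes>\<^sub>M nu) \<Otimes>\<^sub>M lborel)"
      by simp
    show ?thesis unfolding \<Phi>_def case_prod_unfold by measurable
  qed
  have neq: "AE p in nu \<Otimes>\<^sub>M nu. fst p \<noteq> snd p"
  proof (rule nu2.AE_pair_measure)
    show "{x \<in> space (nu \<Otimes>\<^sub>M nu). fst x \<noteq> snd x} \<in> sets (nu \<Otimes>\<^sub>M nu)" by measurable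
    show "AE x in nu. AE y in nu. fst (x, y) \<noteq> snd (x, y)"
    proof (rule AE_I2)
      fix x show "AE y in nu. fst (x, y) \<noteq> snd (x, y)"
        using AE_nu_neq[of x] by eventually_elim auto
    qed
  qed
  have inner: "(\<integral>p. \<Phi> ((u, v), p) \<partial>lborel) = h u * k u v * h v" if "u \<noteq> v" for u v
  proof -
    have "\<psi> u \<noteq> \<psi> v" using that inj by blast
    then show ?thesis
      unfolding \<Phi>_def using interval_weight_integral[OF \<alpha>] k[OF that] by (simp add: g_def ac_simps)
  qed
  have quad: "integrable (nu \<Otimes>\<^sub>M nu) (\<lambda>(u, v). h u * k u v * h v)"
    by (rule quadratic_integrable[OF h h])
  have \<Phi>_int: "integrable ((nu \<Otimes>\<^sub>M nu) \<Otimes>\<^sub>M lborel) \<Phi>"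
  proof (rule integrableI_bounded[OF \<Phi>M])
    have "(\<integral>\<^sup>+z. ennreal (norm (\<Phi> z)) \<partial>((nu \<Otimes>\<^sub>M nu) \<Otimes>\<^sub>M lborel))
      = (\<integral>\<^sup>+z. \<integral>\<^sup>+p. ennreal (norm (\<Phi> (z, p))) \<partial>lborel \<partial>(nu \<Otimes>\<^sub>M nu))"
      by (subst lborel.nn_integral_fst[symmetric]) auto
    also have "\<dots> = (\<integral>\<^sup>+z. ennreal (norm (case z of (u, v) \<Rightarrow> h u * k u v * h v)) \<partial>(nu \<Otimes>\<^sub>M nu))"
    proof (rule nn_integral_cong_AE, use neq in eventually_elim)
      case (elim z)
      obtain u v where z: "z = (u, v)" by (cases z)
      then have uv: "u \<noteq> v" using elim by simp
      then have \<psi>uv: "\<psi> u \<noteq> \<psi> v" using inj by blast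
      have "(\<integral>\<^sup>+p. ennreal (norm (\<Phi> (z, p))) \<partial>lborel)
        = (\<integral>\<^sup>+p. ennreal \<bar>g u * g v\<bar> * ennreal (interval_weight \<alpha> (\<psi> u) (\<psi> v) p) \<partial>lborel)"
        using interval_weight_nonneg[OF \<alpha>]
        by (intro nn_integral_cong) (simp add: z \<Phi>_def abs_mult ennreal_mult')
      also have "\<dots> = ennreal \<bar>g u * g v\<bar> * ennreal (\<bar>\<psi> u - \<psi> v\<bar> powr (- \<alpha>))"
        by (subst nn_integral_cmult) (auto simp: nn_integral_interval_weight[OF \<alpha> \<psi>uv])
      also have "\<dots> = ennreal (norm (h u * k u v * h v))"
        unfolding k[OF uv] by (subst ennreal_mult'[symmetric]) (auto simp: g_def abs_mult ac_simps)
      finally show ?case by (simp add: z)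
    qed
    also have "\<dots> < \<infinity>" using quad by (simp add: integrable_iff_bounded)
    finally show "(\<integral>\<^sup>+z. ennreal (norm (\<Phi> z)) \<partial>((nu \<Otimes>\<^sub>M nu) \<Otimes>\<^sub>M lborel)) < \<infinity>" .
  qed
  have "L2_inner nu h (integral_op nu k h) = (\<integral>z. (case z of (u, v) \<Rightarrow> h u * k u v * h v) \<partial>(nu \<Otimes>\<^sub>M nu))"
    by (rule K_inner_eq_double[OF h h])
  also have "\<dots> = (\<integral>z. (\<integral>p. \<Phi> (z, p) \<partial>lborel) \<partial>(nu \<Otimes>\<^sub>M nu))"
  proof (rule integral_cong_AE)
    show "(\<lambda>z. case z of (u, v) \<Rightarrow> h u * k u v * h v) \<in> borel_measurable (nu \<Otimes>\<^sub>M nu)"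
      using quad by (rule borel_measurable_integrable)
    show "AE z in nu \<Otimes>\<^sub>M nu. (case z of (u, v) \<Rightarrow> h u * k u v * h v) = (\<integral>p. \<Phi> (z, p) \<partial>lborel)"
      using neq by eventually_elim (auto simp: inner split: prod.split)
  qed measurable
  also have "\<dots> = (\<integral>p. (\<integral>z. \<Phi> (z, p) \<partial>(nu \<Otimes>\<^sub>M nu)) \<partial>lborel)"
    using q.Fubini_integral[of "\<lambda>z p. \<Phi> (z, p)"] \<Phi>_int by simp
  also have "\<dots> \<ge> 0"
  proof (rule Bochner_Integration.integral_nonneg)
    fix p :: "real \<times> real"
    obtain a b where p: "p = (a, b)" by (cases p)
    define G where "G u = (if a < \<psi> u \<and> \<psi> u < b then g u else 0)" for u
    define c where "c = \<alpha> * (1 + \<alpha>) * (b - a) powr (- \<alpha> - 2)"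
    have "0 \<le> c" using \<alpha> by (simp add: c_def)
    have eq: "\<Phi> (z, p) = c * (G (fst z) * G (snd z))" for z
      by (auto simp: \<Phi>_def p interval_weight_def G_def c_def split: prod.split)
    have "0 \<le> (\<integral>z. G (fst z) * G (snd z) \<partial>(nu \<Otimes>\<^sub>M nu))"
    proof (cases "integrable (nu \<Otimes>\<^sub>M nu) (\<lambda>z. G (fst z) * G (snd z))")
      case True
      have "(\<integral>z. G (fst z) * G (snd z) \<partial>(nu \<Otimes>\<^sub>M nu)) = (\<integral>u. (\<integral>v. G u * G v \<partial>nu) \<partial>nu)"
        using nu2.integral_fst'[OF True] by simp
      also have "\<dots> = (\<integral>u. G u \<partial>nu) * (\<integral>v. G v \<partial>nu)" by simp
      finally show ?thesis by simp
    qed (simp add: not_integrable_integral_eq)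
    then show "0 \<le> (\<integral>z. \<Phi> (z, p) \<partial>(nu \<Otimes>\<^sub>M nu))"
      unfolding eq using \<open>0 \<le> c\<close> by simp
  qed
  finally show ?thesis .
qed

section \<open>The operators with exponential reference measure\<close>

lemma S_op_eq_integral_op: "S_op \<alpha> \<kappa> = integral_op nu (kern \<alpha> \<kappa>)"
  by (simp add: S_op_def integral_op_def fun_eq_iff)

locale exponential_kernel =
  fixes \<alpha> :: real and \<kappa> :: ereal
  assumes \<alpha>: "0 < \<alpha>" "\<alpha> < 1 / 2" and \<kappa>: "ereal (1 / 2) < \<kappa>"
begin

abbreviation "k \<equiv> kern \<alpha> \<kappa>"

lemma kern_measurable[measurable]: "(\<lambda>(u, v). k u v) \<in> borel_measurable (nu \<Otimes>\<^sub>M nu)"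
  unfolding kern_eq_kfun by measurable

lemma kern_nonneg: "0 \<le> k u v"
  by (simp add: kern_eq_kfun kfun_nonneg)

lemma kern_sym: "k u v = k v u"
  by (simp add: kern_eq_kfun abs_minus_commute)

lemma nn_square: "(\<integral>\<^sup>+z. ennreal (case z of (u, v) \<Rightarrow> (k u v)\<^sup>2) \<partial>(nu \<Otimes>\<^sub>M nu)) = ennreal (Q2 \<alpha> \<kappa>)"
proof -
  have "(\<integral>\<^sup>+z. ennreal (case z of (u, v) \<Rightarrow> (k u v)\<^sup>2) \<partial>(nu \<Otimes>\<^sub>M nu))
    = (\<integral>\<^sup>+u. \<integral>\<^sup>+v. ennreal (kfun (2 * \<alpha>) \<kappa> \<bar>u - v\<bar>) \<partial>nu \<partial>nu)"
    by (subst nu.nn_integral_fst[symmetric]) (auto simp: kern_eq_kfun kfun_square)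
  also have "\<dots> = (\<integral>\<^sup>+r. ennreal (kfun (2 * \<alpha>) \<kappa> r) \<partial>nu)"
    by (rule nu_abs_difference) measurable
  also have "\<dots> = ennreal (Q2 \<alpha> \<kappa>)"
    by (rule kfun_integral_Q2[OF \<alpha> \<kappa>])
  finally show ?thesis .
qed

sublocale hs: hs_kernel nu k
proof
  show "k u v = k v u" for u v by (rule kern_sym)
  show "integrable (nu \<Otimes>\<^sub>M nu) (\<lambda>(u, v). (k u v)\<^sup>2)"
    using nn_square by (intro integrableI_nn_integral_finite[where x = "Q2 \<alpha> \<kappa>"]) (auto simp: case_prod_unfold)
qed measurable

lemma hs2_eq: "hs.hs2 = Q2 \<alpha> \<kappa>"
proof -
  have "hs.hs2 = (\<integral>z. (case z of (u, v) \<Rightarrow> (k u v)\<^sup>2) \<partial>(nu \<Otimes>\<^sub>M nu))"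
    using nu2.integral_fst'[OF hs.k_square] by (simp add: hs.hs2_def hs.row_def[abs_def])
  also have "\<dots> = Q2 \<alpha> \<kappa>"
    using nn_square Q2_pos[OF \<alpha> \<kappa>] by (subst integral_eq_nn_integral) (auto simp: case_prod_unfold)
  finally show ?thesis .
qed

lemma trace_cube_eq: "(\<integral>u. L2_inner nu (k u) (hs.K (k u)) \<partial>nu) = Q3 \<alpha> \<kappa>"
proof -
  have K_nonneg: "0 \<le> hs.K (k u) w" for u w
    unfolding integral_op_def by (intro Bochner_Integration.integral_nonneg mult_nonneg_nonneg kern_nonneg)
  have nonneg: "0 \<le> L2_inner nu (k u) (hs.K (k u))" for u
    unfolding L2_inner_def by (intro Bochner_Integration.integral_nonneg mult_nonneg_nonneg kern_nonneg K_nonneg)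
  have inner: "AE u in nu. ennreal (L2_inner nu (k u) (hs.K (k u)))
      = (\<integral>\<^sup>+w. \<integral>\<^sup>+v. ennreal (k u w) * ennreal (k w v) * ennreal (k u v) \<partial>nu \<partial>nu)"
    using hs.AE_row_L2
  proof eventually_elim
    case (elim u)
    have "ennreal (L2_inner nu (k u) (hs.K (k u))) = (\<integral>\<^sup>+w. ennreal (k u w * hs.K (k u) w) \<partial>nu)"
      unfolding L2_inner_def using elim hs.K_L2[OF elim] kern_nonneg K_nonneg
      by (intro nn_integral_eq_integral[symmetric] L2_integrable_mult) auto
    also have "\<dots> = (\<integral>\<^sup>+w. \<integral>\<^sup>+v. ennreal (k u w) * ennreal (k w v) * ennreal (k u v) \<partial>nu \<partial>nu)"
    proof (rule nn_integral_cong_AE, use hs.AE_row_L2 in eventually_elim)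
      case (elim w)
      have [measurable]: "k u \<in> borel_measurable borel" "k w \<in> borel_measurable borel"
        unfolding kern_eq_kfun[abs_def] by measurable
      have "ennreal (hs.K (k u) w) = (\<integral>\<^sup>+v. ennreal (k w v * k u v) \<partial>nu)"
        unfolding integral_op_def using elim \<open>k u \<in> L2 nu\<close> kern_nonneg
        by (intro nn_integral_eq_integral[symmetric] L2_integrable_mult) auto
      then have "ennreal (k u w * hs.K (k u) w) = ennreal (k u w) * (\<integral>\<^sup>+v. ennreal (k w v) * ennreal (k u v) \<partial>nu)"
        by (simp add: ennreal_mult' kern_nonneg K_nonneg)
      also have "\<dots> = (\<integral>\<^sup>+v. ennreal (k u w) * (ennreal (k w v) * ennreal (k u v)) \<partial>nu)"
        by (rule nn_integral_cmult[symmetric]) measurable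
      finally show ?case by (simp add: mult.assoc)
    qed
    finally show ?case .
  qed
  have "(\<integral>\<^sup>+u. ennreal (L2_inner nu (k u) (hs.K (k u))) \<partial>nu)
    = (\<integral>\<^sup>+u. \<integral>\<^sup>+w. \<integral>\<^sup>+v. ennreal (k u w) * ennreal (k w v) * ennreal (k u v) \<partial>nu \<partial>nu \<partial>nu)"
    by (rule nn_integral_cong_AE[OF inner])
  also have "\<dots> = ennreal (Q3 \<alpha> \<kappa>)"
    unfolding kern_eq_kfun by (rule nu_triple_kfun[OF \<alpha> \<kappa>])
  finally have "(\<integral>\<^sup>+u. ennreal (L2_inner nu (k u) (hs.K (k u))) \<partial>nu) = ennreal (Q3 \<alpha> \<kappa>)" .
  moreover have "0 \<le> Q3 \<alpha> \<kappa>"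
  proof (cases "\<kappa> = \<infinity>")
    case True
    then show ?thesis using \<alpha>
      by (auto simp: Q3_def Q3_inf_def intro!: divide_nonneg_nonneg mult_nonneg_nonneg Gamma_real_nonneg)
  next
    case False
    then obtain c where c: "\<kappa> = ereal c" "1 / 2 < c" using \<kappa> by (cases \<kappa>) auto
    have "0 \<le> Gamma (c + (1 - real j / 2) * \<alpha>) / Gamma (c + 1 - real j * \<alpha> / 2)" if "j \<in> {0..2}" for j :: nat
    proof -
      have "0 \<le> (1 - real j / 2) * \<alpha>" using that \<alpha> by (intro mult_nonneg_nonneg) auto
      moreover have "real j * \<alpha> \<le> 2 * \<alpha>" using that \<alpha> by (intro mult_right_mono) auto
      ultimately have "0 < c + (1 - real j / 2) * \<alpha>" "0 < c + 1 - real j * \<alpha> / 2"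
        using c \<alpha> by linarith+
      then show ?thesis by (intro divide_nonneg_nonneg Gamma_real_nonneg)
    qed
    then have "0 \<le> (\<Prod>j = 0..2::nat. Gamma (c + (1 - real j / 2) * \<alpha>) / Gamma (c + 1 - real j * \<alpha> / 2))"
      by (rule prod_nonneg)
    moreover have "0 \<le> Q3_inf \<alpha>"
      unfolding Q3_inf_def using \<alpha>
      by (intro divide_nonneg_nonneg mult_nonneg_nonneg Gamma_real_nonneg) auto
    ultimately show ?thesis
      by (simp only: Q3_def Let_def c(1)) (simp del: prod.atLeast0_atMost_Suc)
  qed
  moreover have "(\<lambda>u. L2_inner nu (k u) (hs.K (k u))) \<in> borel_measurable nu"
    unfolding L2_inner_def integral_op_def by measurable
  ultimately show ?thesis using nonneg by (subst integral_eq_nn_integral) auto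
qed

lemma op_nonneg:
  assumes h: "h \<in> L2 nu"
  shows "0 \<le> L2_inner nu h (hs.K h)"
proof (cases "\<kappa> = \<infinity>")
  case True
  show ?thesis
    by (rule hs_kernel_positive[OF hs.hs_kernel_axioms \<alpha>(1), where w = "\<lambda>_. 1" and \<psi> = "\<lambda>u. u"])
      (auto simp: kern_def True h)
next
  case False
  then obtain c where c: "\<kappa> = ereal c" "1 / 2 < c" using \<kappa> by (cases \<kappa>) auto
  \<comment> \<open>\<open>2 c sinh (|u - v| / (2 c)) = c exp ((u + v) / (2 c)) |exp (- u / c) - exp (- v / c)|\<close>\<close>
  define w where "w u = (c * exp (u / c)) powr (- \<alpha> / 2)" for u
  show ?thesis
  proof (rule hs_kernel_positive[OF hs.hs_kernel_axioms \<alpha>(1), where w = w and \<psi> = "\<lambda>u. exp (- u / c)"])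
    show "w \<in> borel_measurable borel" unfolding w_def by measurable
    show "u = v" if "exp (- u / c) = exp (- v / c)" for u v using that c by simp
    show "k u v = w u * w v * \<bar>exp (- u / c) - exp (- v / c)\<bar> powr (- \<alpha>)" if uv: "u \<noteq> v" for u v
    proof -
      have *: "2 * c * sinh (\<bar>u - v\<bar> / (2 * c)) = sqrt (c * exp (u / c)) * sqrt (c * exp (v / c)) * \<bar>exp (- u / c) - exp (- v / c)\<bar>"
        if "u < v" for u v
      proof -
        have ex: "exp (- v / c) < exp (- u / c)" using that c by (simp add: divide_strict_right_mono)
        have s: "sqrt (c * exp (u / c)) * sqrt (c * exp (v / c)) = c * exp ((u + v) / (2 * c))"
        proof -
          have "sqrt (c * exp (u / c)) * sqrt (c * exp (v / c)) = sqrt ((c * exp ((u + v) / (2 * c)))\<^sup>2)"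
            using c by (simp add: real_sqrt_mult[symmetric] power2_eq_square exp_add[symmetric] field_simps)
          then show ?thesis using c by simp
        qed
        have "c * exp ((u + v) / (2 * c)) * (exp (- u / c) - exp (- v / c)) = c * (exp ((v - u) / (2 * c)) - exp (- ((v - u) / (2 * c))))"
        proof -
          have "exp ((u + v) / (2 * c)) * exp (- u / c) = exp ((v - u) / (2 * c))"
            "exp ((u + v) / (2 * c)) * exp (- v / c) = exp (- ((v - u) / (2 * c)))"
            using c by (simp_all add: exp_add[symmetric] field_simps)
          then show ?thesis by (simp add: right_diff_distrib mult.assoc)
        qed
        moreover have "\<bar>exp (- u / c) - exp (- v / c)\<bar> = exp (- u / c) - exp (- v / c)"
          using ex by simp
        moreover have "2 * c * sinh (\<bar>u - v\<bar> / (2 * c)) = c * (exp ((v - u) / (2 * c)) - exp (- ((v - u) / (2 * c))))"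
        proof -
          have "\<bar>u - v\<bar> = v - u" using that by simp
          then show ?thesis by (simp add: sinh_field_def)
        qed
        ultimately show ?thesis unfolding s by (simp only:)
      qed
      have "2 * c * sinh (\<bar>u - v\<bar> / (2 * c)) = sqrt (c * exp (u / c)) * sqrt (c * exp (v / c)) * \<bar>exp (- u / c) - exp (- v / c)\<bar>"
      proof (cases "u < v")
        case False
        then have "v < u" using uv by simp
        from *[OF this] show ?thesis by (simp add: abs_minus_commute mult.commute)
      qed (rule *)
      moreover have sq: "sqrt (c * exp (x / c)) powr (- \<alpha>) = w x" for x
        using c by (simp add: powr_half_sqrt[symmetric] powr_powr w_def)
      moreover have "k u v = (2 * c * sinh (\<bar>u - v\<bar> / (2 * c))) powr (- \<alpha>)"
        by (simp add: kern_def c(1))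
      moreover have "(x * y * z) powr (- \<alpha>) = x powr (- \<alpha>) * y powr (- \<alpha>) * z powr (- \<alpha>)"
        if "0 \<le> x" "0 \<le> y" "0 \<le> z" for x y z :: real
        using that by (simp add: powr_mult)
      ultimately show ?thesis using c by simp
    qed
  qed (auto simp: h)
qed

definition A :: "nat \<Rightarrow> nat \<Rightarrow> real" where
  "A i j = L2_inner nu (laguerre i) (hs.K (laguerre j))"

lemma compression_eq: "laguerre_compression \<alpha> \<kappa> N = Matrix.mat N N (\<lambda>(i, j). A i j)"
  by (simp add: laguerre_compression_def A_def S_op_eq_integral_op)

lemma quadratic_form_eq:
  "dotp N x (appl N A x) = L2_inner nu (\<lambda>u. \<Sum>i<N. x i * laguerre i u) (hs.K (\<lambda>u. \<Sum>i<N. x i * laguerre i u))"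
proof -
  define h where "h = (\<lambda>u. \<Sum>i<N. x i * laguerre i u)"
  have h: "h \<in> L2 nu" unfolding h_def by (intro L2_sum L2_scale laguerre_L2)
  have inner: "L2_inner nu g h = (\<Sum>i<N. x i * L2_inner nu g (laguerre i))" if "g \<in> L2 nu" for g
    unfolding h_def using that by (subst L2_inner_sum) (auto simp: L2_scale laguerre_L2 L2_inner_scale)
  have "L2_inner nu h (hs.K h) = L2_inner nu (hs.K h) h" by (rule L2_inner_commute)
  also have "\<dots> = (\<Sum>i<N. x i * L2_inner nu (hs.K h) (laguerre i))" by (rule inner[OF hs.K_L2[OF h]])
  also have "\<dots> = (\<Sum>i<N. x i * (\<Sum>j<N. x j * A i j))"
  proof (rule sum.cong[OF refl])
    fix i
    have "L2_inner nu (hs.K h) (laguerre i) = L2_inner nu h (hs.K (laguerre i))"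
      by (rule hs.K_symmetric[OF h laguerre_L2, symmetric])
    also have "\<dots> = L2_inner nu (hs.K (laguerre i)) h" by (rule L2_inner_commute)
    also have "\<dots> = (\<Sum>j<N. x j * L2_inner nu (hs.K (laguerre i)) (laguerre j))"
      by (rule inner[OF hs.K_L2[OF laguerre_L2]])
    also have "\<dots> = (\<Sum>j<N. x j * A i j)"
      using hs.K_symmetric[OF laguerre_L2 laguerre_L2] by (simp add: A_def)
    finally show "x i * L2_inner nu (hs.K h) (laguerre i) = x i * (\<Sum>j<N. x j * A i j)" by simp
  qed
  also have "\<dots> = dotp N x (appl N A x)"
    unfolding dotp_appl by (simp add: sum_distrib_left ac_simps)
  finally show ?thesis by (simp add: h_def)
qed

sublocale m: hs_matrix A "\<lambda>i. L2_inner nu (hs.K (laguerre i)) (hs.K (laguerre i))" "Q2 \<alpha> \<kappa>"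
proof
  show "A i j = A j i" for i j
    unfolding A_def by (rule hs.matrix_sym[OF laguerre_basis])
  show "(\<lambda>j. (A i j)\<^sup>2) sums L2_inner nu (hs.K (laguerre i)) (hs.K (laguerre i))" for i
    unfolding A_def by (rule hs.matrix_row_sums(2)[OF laguerre_basis laguerre_L2])
  show "(\<lambda>i. L2_inner nu (hs.K (laguerre i)) (hs.K (laguerre i))) sums Q2 \<alpha> \<kappa>"
    using hs.K_basis_squares_sums[OF laguerre_basis] by (simp add: hs2_eq)
  show "0 \<le> dotp N x (appl N A x)" for x N
    unfolding quadratic_form_eq by (intro op_nonneg L2_sum L2_scale laguerre_L2)
  show "0 < A 0 0"
  proof -
    have one: "(\<lambda>_. 1) \<in> L2 nu" using laguerre_L2[of 0] by (simp add: laguerre_0)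
    have "ennreal (A 0 0) = (\<integral>\<^sup>+z. ennreal (case z of (u, v) \<Rightarrow> k u v) \<partial>(nu \<Otimes>\<^sub>M nu))"
      unfolding A_def laguerre_0 hs.K_inner_eq_double[OF one one]
      using hs.quadratic_integrable[OF one one] kern_nonneg
      by (subst nn_integral_eq_integral) (auto simp: case_prod_unfold)
    also have "\<dots> = (\<integral>\<^sup>+u. \<integral>\<^sup>+v. ennreal (kfun \<alpha> \<kappa> \<bar>u - v\<bar>) \<partial>nu \<partial>nu)"
      by (subst nu.nn_integral_fst[symmetric]) (auto simp: kern_eq_kfun)
    also have "\<dots> = (\<integral>\<^sup>+r. ennreal (kfun \<alpha> \<kappa> r) \<partial>nu)"
      by (rule nu_abs_difference) measurable
    also have "\<dots> > 0"
    proof (cases "\<kappa> = \<infinity>")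
      case True
      then show ?thesis using kfun_integral_inf[of \<alpha>] \<alpha> by (simp add: Gamma_real_pos)
    next
      case False
      then obtain c where c: "\<kappa> = ereal c" "1 / 2 < c" using \<kappa> by (cases \<kappa>) auto
      then show ?thesis
        using kfun_laplace[of c \<alpha> 1] \<alpha> by (simp add: Beta_def Gamma_real_pos)
    qed
    finally show ?thesis by simp
  qed
qed

end

section \<open>The rank-two operator on the unit interval\<close>

lemma space_unit_interval: "space unit_interval = {0<..<1}"
  by (simp add: unit_interval_def space_restrict_space)

lemma unit_interval_measurable_iff:
  fixes f :: "real \<Rightarrow> real"
  shows "f \<in> borel_measurable unit_interval \<longleftrightarrow> (\<lambda>x. indicator {0<..<1} x * f x) \<in> borel_measurable borel"
  unfolding unit_interval_def by (subst borel_measurable_restrict_space_iff) auto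

lemma borel_measurable_unit_interval[measurable_dest]:
  fixes f :: "real \<Rightarrow> real"
  shows "f \<in> borel_measurable borel \<Longrightarrow> f \<in> borel_measurable unit_interval"
  unfolding unit_interval_measurable_iff by measurable

lemma AE_unit_interval: "AE x in unit_interval. 0 < x \<and> x < 1"
  by (rule AE_I2) (simp add: space_unit_interval)

locale unit_transfer =
  fixes c :: real
  assumes c: "0 < c"
begin

text \<open>
  The unitary map from \<open>L\<^sup>2(0, 1)\<close> to \<open>L\<^sup>2(\<nu>)\<close> that belongs to the substitution
  \<open>x = exp (- u / c)\<close>, and its inverse. Functions on the unit interval are arbitrary outside of it; the
  indicator in \<open>W\<close> discards these values and makes \<open>W f\<close> measurable on the whole line.
\<close>

definition W :: "(real \<Rightarrow> real) \<Rightarrow> real \<Rightarrow> real" where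
  "W f u = c powr (- 1 / 2) * exp (- u / c) powr ((1 - c) / 2) * (indicator {0<..<1} (exp (- u / c)) * f (exp (- u / c)))"

definition V :: "(real \<Rightarrow> real) \<Rightarrow> real \<Rightarrow> real" where
  "V g x = c powr (1 / 2) * x powr ((c - 1) / 2) * g (- c * ln x)"

lemma W_pos: "0 < u \<Longrightarrow> W f u = c powr (- 1 / 2) * exp (- u / c) powr ((1 - c) / 2) * f (exp (- u / c))"
  using c by (simp add: W_def)

lemma W_measurable:
  assumes "f \<in> borel_measurable unit_interval"
  shows "W f \<in> borel_measurable borel"
proof -
  have "(\<lambda>x. indicator {0<..<1} x * f x) \<in> borel_measurable borel"
    using assms by (simp add: unit_interval_measurable_iff)
  then have [measurable]: "(\<lambda>u. indicator {0<..<1} (exp (- u / c)) * f (exp (- u / c))) \<in> borel_measurable borel"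
    by (rule measurable_compose[rotated]) measurable
  show ?thesis unfolding W_def[abs_def] by measurable
qed

lemma V_measurable:
  assumes [measurable]: "g \<in> borel_measurable borel"
  shows "V g \<in> borel_measurable unit_interval"
  by (rule borel_measurable_unit_interval) (unfold V_def[abs_def], measurable)

lemma nu_integral_unit:
  fixes F :: "real \<Rightarrow> real"
  assumes [measurable]: "F \<in> borel_measurable borel"
  shows "(\<integral>u. F u \<partial>nu) = (\<integral>x. c * x powr (c - 1) * F (- c * ln x) \<partial>unit_interval)" (is ?th1)
    and "integrable nu F \<longleftrightarrow> integrable unit_interval (\<lambda>x. c * x powr (c - 1) * F (- c * ln x))" (is ?th2)
proof -
  have [measurable]: "(\<lambda>x. - c * ln x) \<in> measurable (unit_density c) borel"
    by (simp add: unit_density_def)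
  have nonneg: "0 \<le> c * x powr (c - 1) * indicator {0<..<1} x" for x :: real
    using c by simp
  have "(\<integral>u. F u \<partial>nu) = (\<integral>x. F (- c * ln x) \<partial>unit_density c)"
    unfolding nu_eq_distr[OF c] by (rule integral_distr) measurable
  also have "\<dots> = (\<integral>x. (c * x powr (c - 1) * indicator {0<..<1} x) * F (- c * ln x) \<partial>lborel)"
    unfolding unit_density_def using nonneg by (subst integral_real_density) auto
  also have "\<dots> = (\<integral>x. c * x powr (c - 1) * F (- c * ln x) \<partial>unit_interval)"
    unfolding unit_interval_def by (subst integral_restrict_space) (auto simp: ac_simps)
  finally show ?th1 .
  have "integrable nu F \<longleftrightarrow> integrable (unit_density c) (\<lambda>x. F (- c * ln x))"
    unfolding nu_eq_distr[OF c] by (rule integrable_distr_eq) measurable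
  also have "\<dots> \<longleftrightarrow> integrable lborel (\<lambda>x. (c * x powr (c - 1) * indicator {0<..<1} x) * F (- c * ln x))"
    unfolding unit_density_def using nonneg by (subst integrable_real_density) auto
  also have "\<dots> \<longleftrightarrow> integrable unit_interval (\<lambda>x. c * x powr (c - 1) * F (- c * ln x))"
    unfolding unit_interval_def by (subst integrable_restrict_space) (auto simp: ac_simps)
  finally show ?th2 .
qed

text \<open>
  The properties are to be eigenvalue equations, whose solution sets are not known to be measurable;
  hence the second direction passes through a measurable null set.
\<close>

lemma AE_nu_imp_unit: "(AE u in nu. P u) \<longrightarrow> (AE x in unit_interval. P (- c * ln x))"
  and AE_unit_imp_nu: "(AE x in unit_interval. G x) \<longrightarrow> (AE u in nu. G (exp (- u / c)))"
proof -
  have meas[measurable]: "(\<lambda>x. - c * ln x) \<in> measurable (unit_density c) borel"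
    by (simp add: unit_density_def)
  have AE_density: "(AE x in unit_density c. R x) \<longleftrightarrow> (AE x in unit_interval. R x)" for R
  proof -
    have "(AE x in unit_density c. R x) \<longleftrightarrow> (AE x in lborel. 0 < ennreal (c * x powr (c - 1) * indicator {0<..<1} x) \<longrightarrow> R x)"
      unfolding unit_density_def by (rule AE_density) measurable
    also have "\<dots> \<longleftrightarrow> (AE x in lborel. x \<in> {0<..<1} \<longrightarrow> R x)"
      using c by (intro AE_cong) (auto simp: ennreal_zero_less_mult_iff split: split_indicator)
    also have "\<dots> \<longleftrightarrow> (AE x in unit_interval. R x)"
      unfolding unit_interval_def by (subst AE_restrict_space_iff) auto
    finally show ?thesis .
  qed
  show "(AE u in nu. P u) \<longrightarrow> (AE x in unit_interval. P (- c * ln x))"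
  proof
    assume "AE u in nu. P u"
    then have "AE u in distr (unit_density c) borel (\<lambda>x. - c * ln x). P u"
      by (simp only: nu_eq_distr[OF c, symmetric])
    then have "AE x in unit_density c. P (- c * ln x)" by (rule AE_distrD[OF meas])
    then show "AE x in unit_interval. P (- c * ln x)" by (simp only: AE_density)
  qed
  show "(AE x in unit_interval. G x) \<longrightarrow> (AE u in nu. G (exp (- u / c)))"
  proof
    assume "AE x in unit_interval. G x"
    then have "AE x in unit_density c. G x" by (simp only: AE_density)
    then obtain N where N: "N \<in> null_sets (unit_density c)" "{x \<in> space (unit_density c). \<not> G x} \<subseteq> N"
      by (auto simp: eventually_ae_filter)
    then have Nb[measurable]: "N \<in> sets borel" by (auto simp: unit_density_def)
    have "AE x in unit_density c. 0 < x \<and> x < 1" unfolding AE_density by (rule AE_unit_interval)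
    moreover have "AE x in unit_density c. x \<notin> N" by (rule AE_not_in[OF N(1)])
    ultimately have "AE x in unit_density c. exp (- (- c * ln x) / c) \<notin> N"
      by eventually_elim (use c in simp)
    then have "AE u in distr (unit_density c) borel (\<lambda>x. - c * ln x). exp (- u / c) \<notin> N"
      by (subst AE_distr_iff[OF meas]) auto
    then have "AE u in nu. exp (- u / c) \<notin> N" by (simp only: nu_eq_distr[OF c, symmetric])
    then show "AE u in nu. G (exp (- u / c))"
      by eventually_elim (use N(2) in \<open>auto simp: unit_density_def\<close>)
  qed
qed

lemma W_substituted:
  assumes "0 < x" "x < 1"
  shows "W f (- c * ln x) = c powr (- 1 / 2) * x powr ((1 - c) / 2) * f x"
proof -
  have "0 < - c * ln x" using assms c by (simp add: mult_pos_neg)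
  moreover have "exp (- (- c * ln x) / c) = x" using assms c by simp
  ultimately show ?thesis by (simp only: W_pos)
qed

lemma W_weight:
  assumes "0 < x"
  shows "c * x powr (c - 1) * ((c powr (- 1 / 2) * x powr ((1 - c) / 2) * a) * (c powr (- 1 / 2) * x powr ((1 - c) / 2) * b)) = a * b"
proof -
  have "c powr (- 1 / 2) * c powr (- 1 / 2) = c powr (- 1)" by (simp add: powr_add[symmetric])
  then have c1: "c * (c powr (- 1 / 2) * c powr (- 1 / 2)) = 1" using c by (simp add: powr_minus)
  have "x powr (c - 1) * (x powr ((1 - c) / 2) * x powr ((1 - c) / 2)) = x powr ((c - 1) + ((1 - c) / 2 + (1 - c) / 2))"
    by (simp only: powr_add)
  also have "\<dots> = 1" using assms by (simp add: field_simps)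
  finally have x1: "x powr (c - 1) * (x powr ((1 - c) / 2) * x powr ((1 - c) / 2)) = 1" .
  have "c * x powr (c - 1) * ((c powr (- 1 / 2) * x powr ((1 - c) / 2) * a) * (c powr (- 1 / 2) * x powr ((1 - c) / 2) * b))
    = (c * (c powr (- 1 / 2) * c powr (- 1 / 2))) * (x powr (c - 1) * (x powr ((1 - c) / 2) * x powr ((1 - c) / 2))) * (a * b)"
    by (simp only: ac_simps)
  then show ?thesis unfolding c1 x1 by simp
qed

lemma W_inner:
  assumes "f \<in> borel_measurable unit_interval" "g \<in> borel_measurable unit_interval"
  shows "L2_inner nu (W f) (W g) = L2_inner unit_interval f g"
proof -
  note [measurable] = W_measurable[OF assms(1)] W_measurable[OF assms(2)]
  have "L2_inner nu (W f) (W g) = (\<integral>x. c * x powr (c - 1) * (W f (- c * ln x) * W g (- c * ln x)) \<partial>unit_interval)"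
    unfolding L2_inner_def by (rule nu_integral_unit(1)) measurable
  also have "\<dots> = L2_inner unit_interval f g"
    unfolding L2_inner_def
  proof (rule Bochner_Integration.integral_cong[OF refl])
    fix x assume "x \<in> space unit_interval"
    then have x: "0 < x" "x < 1" by (auto simp: space_unit_interval)
    show "c * x powr (c - 1) * (W f (- c * ln x) * W g (- c * ln x)) = f x * g x"
      unfolding W_substituted[OF x] by (rule W_weight[OF x(1)])
  qed
  finally show ?thesis .
qed

lemma W_L2:
  assumes "f \<in> borel_measurable unit_interval"
  shows "W f \<in> L2 nu \<longleftrightarrow> f \<in> L2 unit_interval"
proof -
  note [measurable] = W_measurable[OF assms(1)]
  have "integrable nu (\<lambda>u. (W f u)\<^sup>2) \<longleftrightarrow> integrable unit_interval (\<lambda>x. c * x powr (c - 1) * (W f (- c * ln x))\<^sup>2)"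
    by (rule nu_integral_unit(2)) measurable
  also have "\<dots> \<longleftrightarrow> integrable unit_interval (\<lambda>x. (f x)\<^sup>2)"
  proof (rule Bochner_Integration.integrable_cong[OF refl])
    fix x assume "x \<in> space unit_interval"
    then have x: "0 < x" "x < 1" by (auto simp: space_unit_interval)
    show "c * x powr (c - 1) * (W f (- c * ln x))\<^sup>2 = (f x)\<^sup>2"
      unfolding W_substituted[OF x] power2_eq_square by (rule W_weight[OF x(1)])
  qed
  finally show ?thesis using assms by (simp add: L2_def)
qed

lemma W_V: "0 < u \<Longrightarrow> W (V g) u = g u"
proof -
  assume u: "0 < u"
  define x where "x = exp (- u / c)"
  have x: "0 < x" "- c * ln x = u" using c by (auto simp: x_def)
  have "c powr (- 1 / 2) * c powr (1 / 2) = 1" using c by (simp add: powr_add[symmetric])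
  moreover have "x powr ((1 - c) / 2) * x powr ((c - 1) / 2) = 1"
  proof -
    have "(1 - c) / 2 + (c - 1) / 2 = 0" by (simp add: field_simps)
    then show ?thesis using x by (simp add: powr_add[symmetric])
  qed
  moreover have "W (V g) u = (c powr (- 1 / 2) * c powr (1 / 2)) * (x powr ((1 - c) / 2) * x powr ((c - 1) / 2)) * g u"
    unfolding W_pos[OF u] x_def[symmetric] V_def x(2) by (simp only: ac_simps)
  ultimately show ?thesis by simp
qed

lemma W_V_AE: "AE u in nu. W (V g) u = g u"
  using AE_nu_pos by eventually_elim (rule W_V)

lemma V_L2:
  assumes g: "g \<in> L2 nu"
  shows "V g \<in> L2 unit_interval"
proof -
  have "g \<in> borel_measurable borel" using L2_measurable[OF g] by simp
  then have VM: "V g \<in> borel_measurable unit_interval" by (rule V_measurable)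
  have "W (V g) \<in> L2 nu"
  proof (rule L2_AE_cong[OF g])
    show "AE u in nu. g u = W (V g) u" using W_V_AE[of g] by eventually_elim simp
  qed (use W_measurable[OF VM] in simp)
  then show ?thesis using W_L2[OF VM] by simp
qed

lemma W_null:
  assumes "f \<in> borel_measurable unit_interval"
  shows "(AE u in nu. W f u = 0) \<longleftrightarrow> (AE x in unit_interval. f x = 0)"
proof
  assume "AE u in nu. W f u = 0"
  then have "AE x in unit_interval. W f (- c * ln x) = 0" using AE_nu_imp_unit by blast
  with AE_unit_interval show "AE x in unit_interval. f x = 0"
  proof eventually_elim
    case (elim x)
    then have "c powr (- 1 / 2) * x powr ((1 - c) / 2) * f x = 0" using W_substituted[of x f] by simp
    then show ?case using c elim by simp
  qed
next
  assume "AE x in unit_interval. f x = 0"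
  then have "AE u in nu. f (exp (- u / c)) = 0" using AE_unit_imp_nu by blast
  then show "AE u in nu. W f u = 0" by eventually_elim (simp add: W_def)
qed

lemma basis_W:
  assumes e: "L2_orthonormal_basis unit_interval e"
  shows "L2_orthonormal_basis nu (\<lambda>i. W (e i))"
  unfolding L2_orthonormal_basis_def
proof (intro conjI allI ballI impI)
  have eL: "e i \<in> L2 unit_interval" for i using e by (simp add: L2_orthonormal_basis_def)
  note eM = L2_measurable[OF eL]
  show "W (e i) \<in> L2 nu" for i using W_L2[OF eM] eL by simp
  show "L2_inner nu (W (e i)) (W (e j)) = (if i = j then 1 else 0)" for i j
    using e by (simp add: W_inner[OF eM eM] L2_orthonormal_basis_def)
  fix g assume g: "g \<in> L2 nu" and orth: "\<forall>i. L2_inner nu (W (e i)) g = 0"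
  have VL: "V g \<in> L2 unit_interval" by (rule V_L2[OF g])
  note VM = L2_measurable[OF VL]
  have "L2_inner unit_interval (e i) (V g) = L2_inner nu (W (e i)) g" for i
    using W_inner[OF eM VM, of i] W_V_AE[of g] W_measurable[OF eM] W_measurable[OF VM] L2_measurable[OF g]
      L2_inner_cong_AE[of "W (e i)" nu "W (V g)" "W (e i)" g] by simp
  then have "AE x in unit_interval. V g x = 0"
    using e VL orth unfolding L2_orthonormal_basis_def by simp
  then have "AE u in nu. W (V g) u = 0" using W_null[OF VM] by simp
  with W_V_AE[of g] show "AE u in nu. g u = 0" by eventually_elim simp
qed

lemma basis_V: "L2_orthonormal_basis unit_interval (\<lambda>i. V (laguerre i))"
  unfolding L2_orthonormal_basis_def
proof (intro conjI allI ballI impI)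
  show VL: "V (laguerre i) \<in> L2 unit_interval" for i by (rule V_L2[OF laguerre_L2])
  note VM = L2_measurable[OF VL]
  note LM = L2_measurable[OF laguerre_L2]
  have inner: "L2_inner unit_interval (V (laguerre i)) f = L2_inner nu (laguerre i) (W f)"
    if f: "f \<in> borel_measurable unit_interval" for i f
    using W_inner[OF VM f, of i] W_V_AE[of "laguerre i"] W_measurable[OF VM] W_measurable[OF f] LM
      L2_inner_cong_AE[of "W (V (laguerre i))" nu "W f" "laguerre i" "W f"] by simp
  show "L2_inner unit_interval (V (laguerre i)) (V (laguerre j)) = (if i = j then 1 else 0)" for i j
  proof -
    have "L2_inner nu (laguerre i) (W (V (laguerre j))) = L2_inner nu (laguerre i) (laguerre j)"
      using W_V_AE[of "laguerre j"] W_measurable[OF VM, of j] LM by (intro L2_inner_cong_AE) auto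
    then show ?thesis by (simp add: inner[OF VM] laguerre_orthonormal)
  qed
  fix f assume f: "f \<in> L2 unit_interval" and orth: "\<forall>i. L2_inner unit_interval (V (laguerre i)) f = 0"
  note fM = L2_measurable[OF f]
  have "AE u in nu. W f u = 0"
    using laguerre_complete[of "W f"] W_L2[OF fM] f orth inner[OF fM] by simp
  then show "AE x in unit_interval. f x = 0" using W_null[OF fM] by simp
qed

end

locale power_kernel = unit_transfer c for c +
  fixes \<alpha> d :: real
  assumes \<alpha>: "0 < \<alpha>" "\<alpha> < 1 / 2" and cd: "c = 1 - d - \<alpha>" and c2: "1 / 2 < c"
begin

sublocale ek: exponential_kernel \<alpha> "ereal c"
  by unfold_locales (use \<alpha> c2 in auto)

abbreviation T where "T \<equiv> T_op \<alpha> d"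
abbreviation S where "S \<equiv> S_op \<alpha> (ereal c)"

lemma T_measurable:
  assumes f: "f \<in> borel_measurable unit_interval"
  shows "T f \<in> borel_measurable unit_interval"
proof -
  have [measurable]: "(\<lambda>x. indicator {0<..<1} x * f x) \<in> borel_measurable borel"
    using f by (simp add: unit_interval_measurable_iff)
  have "T f = (\<lambda>x. \<integral>y. x powr (- d / 2) * y powr (- d / 2) * \<bar>x - y\<bar> powr (- \<alpha>) * (indicator {0<..<1} y * f y) \<partial>lborel)"
    unfolding T_op_def unit_interval_def
    by (subst integral_restrict_space) (auto intro!: Bochner_Integration.integral_cong ext simp: ac_simps)
  also have "\<dots> \<in> borel_measurable borel" by measurable
  finally show ?thesis by (rule borel_measurable_unit_interval)
qed

text \<open>
  Under \<open>x = exp (- u / c)\<close>, \<open>y = exp (- v / c)\<close> the kernel of \<open>S\<close> is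
  \<open>c\<^sup>-\<^sup>\<alpha> (x y)\<^bsup>\<alpha>/2\<^esup> |x - y|\<^sup>-\<^sup>\<alpha>\<close>. The choice \<open>c = 1 - d - \<alpha>\<close> is the one for which the powers of \<open>x\<close> and
  \<open>y\<close> from this factor, from the density of \<open>\<nu>\<close> and from \<open>W\<close> combine to \<open>x\<^bsup>-d/2\<^esup> y\<^bsup>-d/2\<^esup>\<close>.
\<close>

lemma W_T:
  assumes f: "f \<in> borel_measurable unit_interval" and u: "0 < u"
  shows "W (T f) u = c powr (\<alpha> - 1) * S (W f) u"
proof -
  define x where "x = exp (- u / c)"
  have x: "0 < x" "x < 1" "- c * ln x = u" using c u by (auto simp: x_def)
  note [measurable] = W_measurable[OF f]
  have [measurable]: "kern \<alpha> (ereal c) u \<in> borel_measurable borel"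
    unfolding kern_eq_kfun[abs_def] by measurable
  have kern: "kern \<alpha> (ereal c) u (- c * ln y) = c powr (- \<alpha>) * (x powr (\<alpha> / 2) * y powr (\<alpha> / 2)) * \<bar>x - y\<bar> powr (- \<alpha>)"
    if y: "0 < y" "y < 1" for y
  proof -
    have *: "kfun \<alpha> (ereal c) \<bar>- c * ln x - - c * ln y\<bar> = c powr (- \<alpha>) * (x powr (\<alpha> / 2) * y powr (\<alpha> / 2)) * \<bar>x - y\<bar> powr (- \<alpha>)"
      if xy: "x < y" "0 < x" for x y :: real
    proof -
      have "- c * ln x - - c * ln y = - c * ln (x / y)"
        using xy by (simp add: ln_div right_diff_distrib)
      moreover have "0 \<le> - c * ln (x / y)" using xy c by (simp add: mult_le_0_iff)
      ultimately have "kfun \<alpha> (ereal c) \<bar>- c * ln x - - c * ln y\<bar> = kfun \<alpha> (ereal c) (- c * ln (x / y))" by simp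
      also have "\<dots> = c powr (- \<alpha>) * (x / y) powr (\<alpha> / 2) * (1 - x / y) powr (- \<alpha>)"
        using xy c by (intro kfun_substitution) auto
      also have "1 - x / y = (y - x) / y" using xy by (simp add: field_simps)
      also have "c powr (- \<alpha>) * (x / y) powr (\<alpha> / 2) * ((y - x) / y) powr (- \<alpha>)
        = c powr (- \<alpha>) * (x powr (\<alpha> / 2) * (y powr (- (\<alpha> / 2)) * y powr \<alpha>)) * (y - x) powr (- \<alpha>)"
        using xy by (simp add: powr_divide powr_minus field_simps)
      also have "y powr (- (\<alpha> / 2)) * y powr \<alpha> = y powr (\<alpha> / 2)"
        by (simp add: powr_add[symmetric])
      finally show ?thesis using xy by simp
    qed
    consider "x < y" | "y < x" | "x = y" by linarith
    then show ?thesis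
    proof cases
      case 1
      then show ?thesis using *[OF 1 x(1)] unfolding kern_eq_kfun x(3)[symmetric] by simp
    next
      case 2
      then show ?thesis using *[OF 2 y(1)] unfolding kern_eq_kfun x(3)[symmetric]
        by (simp add: abs_minus_commute mult.commute)
    next
      case 3
      then show ?thesis unfolding kern_eq_kfun x(3)[symmetric] by (simp add: kfun_def)
    qed
  qed
  define I where "I = (\<integral>y. y powr (- d / 2) * \<bar>x - y\<bar> powr (- \<alpha>) * f y \<partial>unit_interval)"
  have "S (W f) u = (\<integral>y. c * y powr (c - 1) * (kern \<alpha> (ereal c) u (- c * ln y) * W f (- c * ln y)) \<partial>unit_interval)"
    unfolding S_op_def by (rule nu_integral_unit(1)) measurable
  also have "\<dots> = (\<integral>y. (c powr (1 / 2 - \<alpha>) * x powr (\<alpha> / 2)) * (y powr (- d / 2) * \<bar>x - y\<bar> powr (- \<alpha>) * f y) \<partial>unit_interval)"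
  proof (rule Bochner_Integration.integral_cong[OF refl])
    fix y assume "y \<in> space unit_interval"
    then have y: "0 < y" "y < 1" by (auto simp: space_unit_interval)
    have "y powr (c - 1) * y powr (\<alpha> / 2) * y powr ((1 - c) / 2) = y powr ((c - 1) + \<alpha> / 2 + (1 - c) / 2)"
      by (simp only: powr_add)
    also have "(c - 1) + \<alpha> / 2 + (1 - c) / 2 = - d / 2" by (simp add: cd field_simps)
    finally have e1: "y powr (c - 1) * y powr (\<alpha> / 2) * y powr ((1 - c) / 2) = y powr (- d / 2)" .
    have "c powr 1 * c powr (- \<alpha>) * c powr (- 1 / 2) = c powr (1 + - \<alpha> + - 1 / 2)"
      by (simp only: powr_add)
    also have "1 + - \<alpha> + - 1 / 2 = 1 / 2 - \<alpha>" by simp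
    finally have e2: "c * c powr (- \<alpha>) * c powr (- 1 / 2) = c powr (1 / 2 - \<alpha>)" using c by simp
    have "c * y powr (c - 1) * (kern \<alpha> (ereal c) u (- c * ln y) * W f (- c * ln y))
      = (c * c powr (- \<alpha>) * c powr (- 1 / 2)) * x powr (\<alpha> / 2) * ((y powr (c - 1) * y powr (\<alpha> / 2) * y powr ((1 - c) / 2)) * \<bar>x - y\<bar> powr (- \<alpha>) * f y)"
      unfolding kern[OF y] W_substituted[OF y] by (simp only: ac_simps)
    then show "c * y powr (c - 1) * (kern \<alpha> (ereal c) u (- c * ln y) * W f (- c * ln y))
      = (c powr (1 / 2 - \<alpha>) * x powr (\<alpha> / 2)) * (y powr (- d / 2) * \<bar>x - y\<bar> powr (- \<alpha>) * f y)"
      unfolding e1 e2 .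
  qed
  also have "\<dots> = c powr (1 / 2 - \<alpha>) * x powr (\<alpha> / 2) * I"
    unfolding I_def by (rule integral_mult_right_zero)
  finally have S: "S (W f) u = c powr (1 / 2 - \<alpha>) * x powr (\<alpha> / 2) * I" .
  have "T f x = (\<integral>y. x powr (- d / 2) * (y powr (- d / 2) * \<bar>x - y\<bar> powr (- \<alpha>) * f y) \<partial>unit_interval)"
    unfolding T_op_def by (simp add: mult.assoc)
  also have "\<dots> = x powr (- d / 2) * I" unfolding I_def by (rule integral_mult_right_zero)
  finally have T: "T f x = x powr (- d / 2) * I" .
  have "W (T f) u = c powr (- 1 / 2) * (x powr ((1 - c) / 2) * x powr (- d / 2)) * I"
    unfolding W_pos[OF u] x_def[symmetric] T by (simp only: ac_simps)
  also have "x powr ((1 - c) / 2) * x powr (- d / 2) = x powr ((1 - c) / 2 + - d / 2)" by (simp only: powr_add)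
  also have "(1 - c) / 2 + - d / 2 = \<alpha> / 2" by (simp add: cd field_simps)
  also have "c powr (- 1 / 2) = c powr ((\<alpha> - 1) + (1 / 2 - \<alpha>))" by simp
  also have "\<dots> = c powr (\<alpha> - 1) * c powr (1 / 2 - \<alpha>)" by (simp only: powr_add)
  finally show ?thesis unfolding S by (simp only: ac_simps)
qed

lemma S_cong_AE:
  assumes "f \<in> borel_measurable borel" "g \<in> borel_measurable borel" "AE u in nu. f u = g u"
  shows "S f = S g"
  unfolding S_op_eq_integral_op using assms by (intro ext ek.hs.K_cong_AE) auto

lemma S_scale: "S (\<lambda>u. a * f u) = (\<lambda>u. a * S f u)"
  unfolding S_op_eq_integral_op by (rule ek.hs.K_scale)

lemma eigenvalue_iff: "L2_eigenvalue unit_interval T (c powr (\<alpha> - 1) * t) \<longleftrightarrow> L2_eigenvalue nu S t"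
proof
  assume "L2_eigenvalue unit_interval T (c powr (\<alpha> - 1) * t)"
  then obtain f where f: "f \<in> L2 unit_interval" "\<not> (AE x in unit_interval. f x = 0)"
    "AE x in unit_interval. T f x = c powr (\<alpha> - 1) * t * f x"
    unfolding L2_eigenvalue_def by blast
  note fM = L2_measurable[OF f(1)]
  have "AE u in nu. T f (exp (- u / c)) = c powr (\<alpha> - 1) * t * f (exp (- u / c))"
    using AE_unit_imp_nu f(3) by blast
  with AE_nu_pos have "AE u in nu. S (W f) u = t * W f u"
  proof eventually_elim
    case (elim u)
    have "c powr (\<alpha> - 1) * S (W f) u = W (T f) u" by (rule W_T[OF fM elim(1), symmetric])
    also have "\<dots> = c powr (\<alpha> - 1) * (t * W f u)"
      unfolding W_pos[OF elim(1)] elim(2) by (simp only: ac_simps)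
    finally show ?case using c by simp
  qed
  then show "L2_eigenvalue nu S t"
    using f W_L2[OF fM] W_null[OF fM] unfolding L2_eigenvalue_def by blast
next
  assume "L2_eigenvalue nu S t"
  then obtain g where g: "g \<in> L2 nu" "\<not> (AE u in nu. g u = 0)" "AE u in nu. S g u = t * g u"
    unfolding L2_eigenvalue_def by blast
  define f where "f = V g"
  have f: "f \<in> L2 unit_interval" unfolding f_def by (rule V_L2[OF g(1)])
  note fM = L2_measurable[OF f]
  have Wf: "AE u in nu. W f u = g u" unfolding f_def by (rule W_V_AE)
  have SW: "S (W f) = S g"
    using W_measurable[OF fM] L2_measurable[OF g(1)] Wf by (intro S_cong_AE) auto
  have "AE u in nu. T f (exp (- u / c)) = c powr (\<alpha> - 1) * t * f (exp (- u / c))"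
    using AE_nu_pos g(3) Wf
  proof eventually_elim
    case (elim u)
    have "W (T f) u = c powr (\<alpha> - 1) * t * W f u"
      using W_T[OF fM elim(1)] elim by (simp add: SW)
    then show ?case using c elim(1) by (simp add: W_pos)
  qed
  then have "AE x in unit_interval. T f (exp (- (- c * ln x) / c)) = c powr (\<alpha> - 1) * t * f (exp (- (- c * ln x) / c))"
    using AE_nu_imp_unit[of "\<lambda>u. T f (exp (- u / c)) = c powr (\<alpha> - 1) * t * f (exp (- u / c))"] by blast
  with AE_unit_interval have "AE x in unit_interval. T f x = c powr (\<alpha> - 1) * t * f x"
    by eventually_elim (use c in simp)
  moreover have "\<not> (AE x in unit_interval. f x = 0)"
  proof
    assume "AE x in unit_interval. f x = 0"
    then have "AE u in nu. W f u = 0" using W_null[OF fM] by simp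
    with Wf have "AE u in nu. g u = 0" by eventually_elim simp
    then show False using g(2) by simp
  qed
  ultimately show "L2_eigenvalue unit_interval T (c powr (\<alpha> - 1) * t)"
    using f unfolding L2_eigenvalue_def by blast
qed

lemma trace_T_square: "L2_trace unit_interval (T ^^ 2) = (c powr (\<alpha> - 1))\<^sup>2 * Q2 \<alpha> (ereal c)"
proof -
  have hs: "((\<lambda>i. L2_inner unit_interval (e i) ((T ^^ 2) (e i))) has_sum (c powr (\<alpha> - 1))\<^sup>2 * Q2 \<alpha> (ereal c)) UNIV"
    if e: "L2_orthonormal_basis unit_interval e" for e
  proof -
    have eL: "e i \<in> L2 unit_interval" for i using e by (simp add: L2_orthonormal_basis_def)
    note eM = L2_measurable[OF eL]
    note TM = T_measurable[OF eM]
    have "L2_inner unit_interval (e i) ((T ^^ 2) (e i)) = (c powr (\<alpha> - 1))\<^sup>2 * L2_inner nu (W (e i)) (S (S (W (e i))))" for i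
    proof -
      have [measurable]: "S (W (e i)) \<in> borel_measurable borel" "S (S (W (e i))) \<in> borel_measurable borel"
        using ek.hs.K_measurable W_measurable[OF eM] unfolding S_op_eq_integral_op by simp_all
      have "AE u in nu. W (T (e i)) u = c powr (\<alpha> - 1) * S (W (e i)) u"
        using AE_nu_pos by eventually_elim (rule W_T[OF eM])
      then have SW: "S (W (T (e i))) = (\<lambda>u. c powr (\<alpha> - 1) * S (S (W (e i))) u)"
        using S_cong_AE[OF W_measurable[OF TM, of i], of "\<lambda>u. c powr (\<alpha> - 1) * S (W (e i)) u"] S_scale by simp
      have "L2_inner unit_interval (e i) ((T ^^ 2) (e i)) = L2_inner nu (W (e i)) (W (T (T (e i))))"
        using W_inner[OF eM T_measurable[OF TM]] by (simp add: numeral_2_eq_2)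
      also have "\<dots> = L2_inner nu (W (e i)) (\<lambda>u. (c powr (\<alpha> - 1))\<^sup>2 * S (S (W (e i))) u)"
      proof (rule L2_inner_cong_AE)
        show "AE u in nu. W (T (T (e i))) u = (c powr (\<alpha> - 1))\<^sup>2 * S (S (W (e i))) u"
          using AE_nu_pos
        proof eventually_elim
          case (elim u)
          show ?case using W_T[OF TM elim, of i] by (simp add: SW power2_eq_square)
        qed
      qed (use W_measurable[OF eM] W_measurable[OF T_measurable[OF TM]] in auto)
      finally show ?thesis by (simp add: L2_inner_scale)
    qed
    moreover have "((\<lambda>i. L2_inner nu (W (e i)) (S (S (W (e i))))) has_sum Q2 \<alpha> (ereal c)) UNIV"
      using ek.hs.K_square_has_sum[OF basis_W[OF e]] by (simp add: S_op_eq_integral_op ek.hs2_eq)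
    ultimately show ?thesis using has_sum_cmult_right by simp
  qed
  have "L2_has_trace unit_interval (T ^^ 2) ((c powr (\<alpha> - 1))\<^sup>2 * Q2 \<alpha> (ereal c))"
    unfolding L2_has_trace_def using hs basis_V by blast
  moreover have "t = (c powr (\<alpha> - 1))\<^sup>2 * Q2 \<alpha> (ereal c)" if "L2_has_trace unit_interval (T ^^ 2) t" for t
  proof -
    have "((\<lambda>i. L2_inner unit_interval (V (laguerre i)) ((T ^^ 2) (V (laguerre i)))) has_sum t) UNIV"
      using that basis_V unfolding L2_has_trace_def by blast
    then show ?thesis by (rule has_sum_unique[OF _ hs[OF basis_V]])
  qed
  ultimately show ?thesis unfolding L2_trace_def by (rule the_equality)
qed

end

section \<open>Two-sided bounds for the greatest eigenvalue\<close>

context hs_matrix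
begin

definition remainder :: "nat \<Rightarrow> real \<Rightarrow> nat \<Rightarrow> real" where
  "remainder j T N = T - (\<Sum>k=1..<N. lam N k ^ j)"

lemma remainder_antimono:
  assumes "1 \<le> N" "N \<le> N'"
  shows "remainder j T N' \<le> remainder j T N"
proof -
  have "(\<Sum>k=1..<N. lam N k ^ j) \<le> (\<Sum>k=1..<N. lam N' k ^ j)"
    using assms by (intro sum_mono power_mono ev_mono ev_nonneg) auto
  also have "\<dots> \<le> (\<Sum>k=1..<N'. lam N' k ^ j)"
    using assms by (intro sum_mono2) (auto intro!: zero_le_power ev_nonneg)
  finally show ?thesis by (simp add: remainder_def)
qed

text \<open>
  The remainder is the defect in the trace plus the \<open>j\<close>-th power of the top eigenvalue of the compression;
  the defect tends to \<open>0\<close>.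
\<close>

lemma remainder_tendsto:
  assumes "(\<lambda>N. \<Sum>k<N. lam N k ^ j) \<longlonglongrightarrow> T"
  shows "remainder j T \<longlonglongrightarrow> top_ev ^ j"
proof -
  have "(\<lambda>N. T - (\<Sum>k<N. lam N k ^ j) + lam N 0 ^ j) \<longlonglongrightarrow> T - T + top_ev ^ j"
    by (intro tendsto_intros assms ev_tendsto_top)
  moreover have "\<forall>\<^sub>F N in sequentially. T - (\<Sum>k<N. lam N k ^ j) + lam N 0 ^ j = remainder j T N"
  proof (rule eventually_sequentiallyI[of 1])
    fix N :: nat assume "1 \<le> N"
    then have "(\<Sum>k<N. lam N k ^ j) = lam N 0 ^ j + (\<Sum>k=1..<N. lam N k ^ j)"
      unfolding lessThan_atLeast0 by (simp add: sum.atLeast_Suc_lessThan)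
    then show "T - (\<Sum>k<N. lam N k ^ j) + lam N 0 ^ j = remainder j T N"
      by (simp add: remainder_def)
  qed
  ultimately show ?thesis by (simp add: tendsto_cong)
qed

lemma remainder_ge_top:
  assumes lim: "(\<lambda>N. \<Sum>k<N. lam N k ^ j) \<longlonglongrightarrow> T" and N: "1 \<le> N"
  shows "top_ev ^ j \<le> remainder j T N"
  by (rule LIMSEQ_le_const2[OF remainder_tendsto[OF lim]]) (use N remainder_antimono in blast)

lemma root_of_top: "0 < j \<Longrightarrow> (top_ev ^ j) powr (1 / real j) = top_ev"
  using top_ev_pos by (simp add: powr_realpow[symmetric] powr_powr)

lemma remainder_root_bounds:
  assumes lim: "(\<lambda>N. \<Sum>k<N. lam N k ^ j) \<longlonglongrightarrow> T" and j: "0 < j"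
  shows "1 \<le> N \<Longrightarrow> top_ev \<le> remainder j T N powr (1 / real j)"
    and "1 \<le> N \<Longrightarrow> N \<le> N' \<Longrightarrow> remainder j T N' powr (1 / real j) \<le> remainder j T N powr (1 / real j)"
    and "(\<lambda>N. remainder j T N powr (1 / real j)) \<longlonglongrightarrow> top_ev"
proof -
  have top: "0 < top_ev ^ j" using top_ev_pos by simp
  show "top_ev \<le> remainder j T N powr (1 / real j)" if "1 \<le> N"
    using powr_mono2[OF _ less_imp_le[OF top] remainder_ge_top[OF lim that], of "1 / real j"]
    by (simp add: root_of_top[OF j])
  show "remainder j T N' powr (1 / real j) \<le> remainder j T N powr (1 / real j)" if "1 \<le> N" "N \<le> N'"
    using remainder_ge_top[OF lim, of N'] that top by (intro powr_mono2 remainder_antimono) auto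
  have "(\<lambda>N. remainder j T N powr (1 / real j)) \<longlonglongrightarrow> (top_ev ^ j) powr (1 / real j)"
    by (rule tendsto_powr[OF remainder_tendsto[OF lim] tendsto_const less_imp_neq[OF top, symmetric]])
  then show "(\<lambda>N. remainder j T N powr (1 / real j)) \<longlonglongrightarrow> top_ev"
    by (simp add: root_of_top[OF j])
qed

end

context exponential_kernel
begin

lemma has_trace_square: "L2_has_trace nu (S_op \<alpha> \<kappa> ^^ 2) (Q 2 \<alpha> \<kappa>)"
  unfolding L2_has_trace_def S_op_eq_integral_op
  using laguerre_basis hs.K_square_has_sum by (auto simp: Q_def hs2_eq numeral_2_eq_2)

lemma has_trace_cube: "L2_has_trace nu (S_op \<alpha> \<kappa> ^^ 3) (Q 3 \<alpha> \<kappa>)"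
  unfolding L2_has_trace_def S_op_eq_integral_op
  using laguerre_basis hs.K_cube_has_sum by (auto simp: Q_def trace_cube_eq numeral_3_eq_3)

lemma compression_square_traces: "(\<lambda>N. \<Sum>k<N. m.lam N k ^ 2) \<longlonglongrightarrow> Q 2 \<alpha> \<kappa>"
  using m.squares_box_limit by (simp add: m.ev_squares Q_def)

lemma compression_cube_traces: "(\<lambda>N. \<Sum>k<N. m.lam N k ^ 3) \<longlonglongrightarrow> Q 3 \<alpha> \<kappa>"
proof -
  have KL: "hs.K (laguerre i) \<in> L2 nu" "hs.K (hs.K (laguerre i)) \<in> L2 nu" for i
    by (intro hs.K_L2 laguerre_L2)+
  have "(\<lambda>N. \<Sum>i<N. \<Sum>m<N. \<Sum>l<N. A i m * A m l * A l i) \<longlonglongrightarrow> Q3 \<alpha> \<kappa>"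
  proof (rule m.cubes_box_limit)
    show "(\<lambda>l. A m l * A l i) sums L2_inner nu (laguerre m) (hs.K (hs.K (laguerre i)))" for m i
      unfolding A_def by (rule hs.matrix_row_sums(1)[OF laguerre_basis KL(1)])
    show "(\<lambda>m. A i m * L2_inner nu (laguerre m) (hs.K (hs.K (laguerre i)))) sums
        L2_inner nu (laguerre i) (hs.K (hs.K (hs.K (laguerre i))))" for i
      unfolding A_def by (rule hs.matrix_row_sums(1)[OF laguerre_basis KL(2)])
    show "(\<lambda>i. L2_inner nu (laguerre i) (hs.K (hs.K (hs.K (laguerre i))))) sums Q3 \<alpha> \<kappa>"
      using has_sum_imp_sums[OF hs.K_cube_has_sum[OF laguerre_basis]] by (simp add: trace_cube_eq)
  qed
  then show ?thesis by (simp add: m.ev_cubes Q_def)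
qed

lemma theta_eq: "theta \<alpha> \<kappa> N i = m.lam N (i - 1)"
  by (simp add: theta_def compression_eq mat_ev_def)

lemma top_is_eigenvalue: "L2_eigenvalue nu (S_op \<alpha> \<kappa>) m.top_ev"
proof -
  obtain y j where "summable (\<lambda>i. (y i)\<^sup>2)" "y j \<noteq> 0" "\<And>i. (\<lambda>l. A i l * y l) sums (m.top_ev * y i)"
    using m.top_ev_eigenvector by blast
  then show ?thesis
    unfolding S_op_eq_integral_op A_def by (rule hs.eigenvalue_of_coefficients[OF laguerre_basis])
qed

lemma eigenvalue_le_top:
  assumes "L2_eigenvalue nu (S_op \<alpha> \<kappa>) c"
  shows "c \<le> m.top_ev"
proof -
  obtain x j where "summable (\<lambda>i. (x i)\<^sup>2)" "x j \<noteq> 0"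
    "\<And>i. (\<lambda>l. L2_inner nu (laguerre i) (hs.K (laguerre l)) * x l) sums (c * x i)"
    using hs.coefficients_of_eigenvalue[OF laguerre_basis assms[unfolded S_op_eq_integral_op]] by blast
  then show ?thesis unfolding A_def[symmetric] by (rule m.eigenvalue_le_top)
qed

lemma lambda_max_eq: "L2_lambda_max nu (S_op \<alpha> \<kappa>) = m.top_ev"
  unfolding L2_lambda_max_def
proof (rule Greatest_equality)
  show "L2_eigenvalue nu (S_op \<alpha> \<kappa>) m.top_ev" by (rule top_is_eigenvalue)
qed (rule eigenvalue_le_top)

lemma U_bound_eq: "U_bound \<alpha> \<kappa> N = min (m.remainder 2 (Q 2 \<alpha> \<kappa>) N powr (1 / real 2)) (m.remainder 3 (Q 3 \<alpha> \<kappa>) N powr (1 / real 3))"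
proof -
  have "(\<Sum>i = 2..N. theta \<alpha> \<kappa> N i ^ j) = (\<Sum>k=1..<N. m.lam N k ^ j)" for j
  proof -
    have "(\<Sum>i = 2..N. theta \<alpha> \<kappa> N i ^ j) = (\<Sum>i = Suc 1..<Suc N. m.lam N (i - 1) ^ j)"
      unfolding theta_eq by (rule sum.cong) auto
    also have "\<dots> = (\<Sum>k=1..<N. m.lam N k ^ j)"
      by (subst sum.shift_bounds_Suc_ivl) simp
    finally show ?thesis .
  qed
  then show ?thesis by (simp add: U_bound_def m.remainder_def)
qed

lemmas square_bounds = m.remainder_root_bounds[OF compression_square_traces pos2]
lemmas cube_bounds = m.remainder_root_bounds[OF compression_cube_traces zero_less_numeral]

lemma U_bound_ge: "1 \<le> N \<Longrightarrow> m.top_ev \<le> U_bound \<alpha> \<kappa> N"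
  unfolding U_bound_eq using square_bounds(1) cube_bounds(1) by simp

lemma U_bound_antimono: "1 \<le> N \<Longrightarrow> N \<le> N' \<Longrightarrow> U_bound \<alpha> \<kappa> N' \<le> U_bound \<alpha> \<kappa> N"
  unfolding U_bound_eq using square_bounds(2) cube_bounds(2) by (intro min.mono)

lemma U_bound_tendsto: "U_bound \<alpha> \<kappa> \<longlonglongrightarrow> m.top_ev"
  using tendsto_min[OF square_bounds(3) cube_bounds(3)] unfolding U_bound_eq[abs_def] by simp

lemma theta_le_top: "1 \<le> N \<Longrightarrow> theta \<alpha> \<kappa> N 1 \<le> m.top_ev"
  by (simp add: theta_eq m.ev_le_top)

lemma theta_tendsto: "(\<lambda>N. theta \<alpha> \<kappa> N 1) \<longlonglongrightarrow> m.top_ev"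
  using m.ev_tendsto_top by (simp add: theta_eq)

lemma normalized_bounds:
  "convergent_bounds (\<lambda>N. theta \<alpha> \<kappa> N 1 / sqrt (2 * Q2 \<alpha> \<kappa>)) (\<lambda>N. U_bound \<alpha> \<kappa> N / sqrt (2 * Q2 \<alpha> \<kappa>))
     (m.top_ev / sqrt (2 * Q2 \<alpha> \<kappa>))"
proof -
  have "0 < sqrt (2 * Q2 \<alpha> \<kappa>)" using Q2_pos[OF \<alpha> \<kappa>] by simp
  then show ?thesis
    unfolding convergent_bounds_def
    by (intro conjI allI impI divide_right_mono theta_le_top U_bound_ge tendsto_divide tendsto_const
        theta_tendsto U_bound_tendsto) simp_all
qed

end

text \<open>
  The greatest eigenvalue of \<open>T\<close> and the Hilbert--Schmidt norm of \<open>T\<close> both carry the factor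
  \<open>c powr (\<alpha> - 1)\<close>.
\<close>

lemma (in power_kernel) Lambda2_eq: "Lambda2 \<alpha> d = ek.m.top_ev / sqrt (2 * Q2 \<alpha> (ereal c))"
proof -
  define a where "a = c powr (\<alpha> - 1)"
  have a: "0 < a" using c by (simp add: a_def)
  have "L2_lambda_max unit_interval T = a * ek.m.top_ev"
    unfolding L2_lambda_max_def
  proof (rule Greatest_equality)
    show "L2_eigenvalue unit_interval T (a * ek.m.top_ev)"
      unfolding a_def eigenvalue_iff by (rule ek.top_is_eigenvalue)
    fix y assume "L2_eigenvalue unit_interval T y"
    then have "L2_eigenvalue unit_interval T (a * (y / a))" using a by simp
    then have "y / a \<le> ek.m.top_ev"
      unfolding a_def eigenvalue_iff by (rule ek.eigenvalue_le_top)
    then show "y \<le> a * ek.m.top_ev" using a by (simp add: field_simps)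
  qed
  moreover have "sqrt (2 * L2_trace unit_interval (T ^^ 2)) = a * sqrt (2 * Q2 \<alpha> (ereal c))"
  proof -
    have "2 * L2_trace unit_interval (T ^^ 2) = a\<^sup>2 * (2 * Q2 \<alpha> (ereal c))"
      unfolding trace_T_square a_def by simp
    then show ?thesis using a by (simp only: real_sqrt_mult) simp
  qed
  ultimately show ?thesis using a by (simp add: Lambda2_def)
qed

theorem proposition6p3:
  fixes \<alpha> :: real and \<kappa> :: ereal
  assumes "0 < \<alpha>" and "\<alpha> < 1 / 2" and "ereal (1 / 2) < \<kappa>"
  shows
    "(\<forall>j \<in> {2, 3}. L2_has_trace nu (S_op \<alpha> \<kappa> ^^ j) (Q j \<alpha> \<kappa>)) \<and>
     (\<forall>N\<ge>1. length (eigenvalues_desc (laguerre_compression \<alpha> \<kappa> N)) = N \<and>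
        (\<forall>i \<in> {1..N}. 0 \<le> theta \<alpha> \<kappa> N i)) \<and>
     (\<forall>N\<ge>1. theta \<alpha> \<kappa> N 1 \<le> L2_lambda_max nu (S_op \<alpha> \<kappa>) \<and>
        L2_lambda_max nu (S_op \<alpha> \<kappa>) \<le> U_bound \<alpha> \<kappa> N) \<and>
     mono_on {1..} (\<lambda>N. theta \<alpha> \<kappa> N 1) \<and>
     (\<lambda>N. theta \<alpha> \<kappa> N 1) \<longlonglongrightarrow> L2_lambda_max nu (S_op \<alpha> \<kappa>) \<and>
     antimono_on {1..} (U_bound \<alpha> \<kappa>) \<and>
     U_bound \<alpha> \<kappa> \<longlonglongrightarrow> L2_lambda_max nu (S_op \<alpha> \<kappa>) \<and>
     (\<forall>d. 2 * d + 2 * \<alpha> < 1 \<and> \<kappa> = ereal (1 - d - \<alpha>) \<longrightarrow>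
        convergent_bounds
          (\<lambda>N. theta \<alpha> \<kappa> N 1 / sqrt (2 * Q2 \<alpha> \<kappa>))
          (\<lambda>N. U_bound \<alpha> \<kappa> N / sqrt (2 * Q2 \<alpha> \<kappa>)) (Lambda2 \<alpha> d)) \<and>
     (\<kappa> = \<infinity> \<longrightarrow>
        convergent_bounds
          (\<lambda>N. theta \<alpha> \<kappa> N 1 / sqrt (2 * Q2 \<alpha> \<kappa>))
          (\<lambda>N. U_bound \<alpha> \<kappa> N / sqrt (2 * Q2 \<alpha> \<kappa>)) (Lambda2_exp \<alpha>))"
proof -
  interpret exponential_kernel \<alpha> \<kappa> by unfold_locales fact+
  have trace: "\<forall>j \<in> {2, 3}. L2_has_trace nu (S_op \<alpha> \<kappa> ^^ j) (Q j \<alpha> \<kappa>)"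
    using has_trace_square has_trace_cube by simp
  have eigenvalues: "\<forall>N\<ge>1. length (eigenvalues_desc (laguerre_compression \<alpha> \<kappa> N)) = N \<and>
      (\<forall>i \<in> {1..N}. 0 \<le> theta \<alpha> \<kappa> N i)"
    by (auto simp: compression_eq m.ev_length theta_eq intro!: m.ev_nonneg)
  have bounds: "\<forall>N\<ge>1. theta \<alpha> \<kappa> N 1 \<le> L2_lambda_max nu (S_op \<alpha> \<kappa>) \<and>
      L2_lambda_max nu (S_op \<alpha> \<kappa>) \<le> U_bound \<alpha> \<kappa> N"
    using theta_le_top U_bound_ge by (simp add: lambda_max_eq)
  have lower_mono: "mono_on {1..} (\<lambda>N. theta \<alpha> \<kappa> N 1)"
    by (rule mono_onI) (simp add: theta_eq m.ev_mono)
  have upper_antimono: "antimono_on {1..} (U_bound \<alpha> \<kappa>)"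
    by (rule monotone_onI) (simp add: U_bound_antimono)
  have finite_case: "convergent_bounds
      (\<lambda>N. theta \<alpha> \<kappa> N 1 / sqrt (2 * Q2 \<alpha> \<kappa>))
      (\<lambda>N. U_bound \<alpha> \<kappa> N / sqrt (2 * Q2 \<alpha> \<kappa>)) (Lambda2 \<alpha> d)"
    if d: "2 * d + 2 * \<alpha> < 1" "\<kappa> = ereal (1 - d - \<alpha>)" for d
  proof -
    interpret power_kernel "1 - d - \<alpha>" \<alpha> d by unfold_locales (use assms d in auto)
    show ?thesis using ek.normalized_bounds unfolding Lambda2_eq d(2) .
  qed
  have infinite_case: "convergent_bounds
      (\<lambda>N. theta \<alpha> \<kappa> N 1 / sqrt (2 * Q2 \<alpha> \<kappa>))
      (\<lambda>N. U_bound \<alpha> \<kappa> N / sqrt (2 * Q2 \<alpha> \<kappa>)) (Lambda2_exp \<alpha>)" if "\<kappa> = \<infinity>"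
  proof -
    have "Lambda2_exp \<alpha> = m.top_ev / sqrt (2 * Q2 \<alpha> \<kappa>)"
      using lambda_max_eq that by (simp add: Lambda2_exp_def Q2_def)
    then show ?thesis using normalized_bounds by simp
  qed
  show ?thesis
    using trace eigenvalues bounds lower_mono upper_antimono finite_case infinite_case
      theta_tendsto U_bound_tendsto
    unfolding lambda_max_eq by blast
qed

end
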